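(* Let $0<n<N$, $k=N-n$. The algebra $\mathcal V_n^{\mathbb F}=\mathbb F_q\otimes V_n$ with product $\circledast$ is semisimple and canonically isomorphic to the generalised matrix algebra with basis $\{|y_\alpha\rangle\}_{\alpha\in\Pi_{n,k}}$ and multiplication $$|y_\alpha\rangle\circledast|y_\beta\rangle=\delta_{\alpha\beta}\,\mathfrak e(y_\alpha)\,|y_\alpha\rangle,\qquad\alpha,\beta\in\Pi_{n,k};$$ that is, the on-shell Bethe vectors yield (after dividing $|y_\alpha\rangle$ by $\mathfrak e(y_\alpha)$) a complete set of idempotents for $\mathcal V_n^{\mathbb F}$.
   Context: Set $\Lambda=\mathbb Z[T_1,\dots,T_N]$, $t_i:=T_{N+1-i}$. $V$ has basis $v_0,v_1$; $V_n$ is the span of the vectors $v_{\varepsilon_1}\otimes\cdots\otimes v_{\varepsilon_N}$ with exactly $n$ of the $\varepsilon_j\in\{0,1\}$ equal to 1. $\Pi_{n,k}=\{\lambda:k\ge\lambda_1\ge\dots\ge\lambda_n\ge0\}$, $I(\lambda)=\{\lambda_{n+1-i}+i:1\le i\le n\}$, $|\lambda\rangle\in V_n$ is the basis vector with $\varepsilon_j=1$ iff $j\in I(\lambda)$; $\lambda^\vee=(k-\lambda_n,\dots,k-\lambda_1)$, $\lambda'$ is the conjugate. $\sigma^+v_0=v_1$, $\sigma^+v_1=0$, $\sigma^-v_1=v_0$, $\sigma^-v_0=0$; $L'_j(x)=\begin{pmatrix}1+xt_j\sigma_j^+\sigma_j^- & x\sigma_j^+\\ \sigma_j^- & x\sigma_j^+\sigma_j^-\end{pmatrix}$,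 $L'_N\cdots L'_1=\begin{pmatrix}A'&B'\\C'&D'\end{pmatrix}$, $E(x)=A'+qD'=\sum_rE_rx^r$ (the $E_r$ commute; $E_r=0$ for $r<0$). On $\Lambda[q]\otimes V_n$: $S_\lambda=\det(E_{\lambda'_i-i+j})_{1\le i,j\le k}$, $\tilde S_\lambda=\sum_{\mu\subseteq\lambda}(-1)^{|\lambda/\mu|}\det(e_{\lambda_i-\mu_j-i+j}(t_1,\dots,t_{n+\lambda_i-i}))_{1\le i,j\le n}S_\mu$. The product is defined by $|\lambda\rangle\circledast|\mu\rangle=\tilde S_\lambda|\mu\rangle$, extended linearly. $\mathbb F_q=\mathbb C[q^{\pm1/N}]\widehat\otimes\mathbb C\{\!\{T_1,\dots,T_N\}\!\}$ (completed tensor product with the algebraically closed field of Puiseux series). Bethe roots: $y_1,\dots,y_N$ are the solutions of $\prod_{j=1}^N(y-t_j)+(-1)^nq=0$ with $y_j|_{q=0}=t_j$; $y_\alpha=(y_i)_{i\in I(\alpha)}$. The on-shell Bethe vectors are $|y_\alpha\rangle=\sum_{\lambda\in\Pi_{n,k}}s_{\lambda^\vee}(y_\alpha|T)|\lambda\rangle$, where $s_\lambda(x|a)=\det[(x_j|a)^{\lambda_i+n-i}]/\det[(x_j|a)^{n-i}]$, $(x|a)^r=\prod_{i=1}^r(x-a_i)$, and $\mathfrak e(y_\alpha)=\prod_{i\in I(\alpha),\,j\in\{1,\dots,N\}\setminus I(\alpha)}(y_i-y_j)$. *)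

theory Defs
  imports
    "HOL-Computational_Algebra.Formal_Laurent_Series"
    "HOL-Library.Function_Algebras"
    "HOL-Library.Set_Algebras"
    "HOL-Library.Cardinality"
    "HOL-Algebra.QuotRing"
    "HOL-Algebra.Module"
    "Jordan_Normal_Form.Determinant"
begin

no_notation vec_index (infixl "$" 100)

section \<open>Puiseux series in several variables\<close>

text \<open>
  The field \<open>\<complex>{{T\<^sub>1,\<dots>,T\<^sub>N}}\<close> is the iterated Puiseux series field \<open>\<complex>{{T\<^sub>1}}\<cdots>{{T\<^sub>N}}\<close>, the usual
  algebraically closed field of Puiseux series in \<open>N\<close> variables. A series is its coefficient function on
  exponents \<open>e\<close>, where \<open>e i\<close> is the exponent of \<open>T\<^sub>i\<close> and \<open>e i = 0\<close> unless \<open>1 \<le> i \<le> N\<close>. It lies in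
  the field for \<open>m + 1\<close> variables iff the exponents of \<open>T\<^bsub>m+1\<^esub>\<close> are bounded below with a common
  denominator, and for all \<open>c\<close> the coefficient of \<open>T\<^bsub>m+1\<^esub>\<^sup>c\<close> lies in the field for \<open>m\<close> variables.
  The number of variables is carried by the type: it is \<^term>\<open>CARD('n)\<close>.
\<close>

primrec puiseux_support :: "nat \<Rightarrow> (nat \<Rightarrow> rat) set \<Rightarrow> bool" where
  "puiseux_support 0 A \<longleftrightarrow> A \<subseteq> {0}"
| "puiseux_support (Suc m) A \<longleftrightarrow>
     (\<exists>d b. 0 < d \<and> (\<forall>e\<in>A. of_nat d * e (Suc m) \<in> \<int> \<and> b \<le> e (Suc m))) \<and>
     (\<forall>c. puiseux_support m {e. e (Suc m) = 0 \<and> e(Suc m := c) \<in> A})"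

lemma puiseux_support_mono:
  "puiseux_support m A \<Longrightarrow> B \<subseteq> A \<Longrightarrow> puiseux_support m B"
proof (induction m arbitrary: A B)
  case (Suc m)
  show ?case
    unfolding puiseux_support.simps
  proof (intro conjI allI)
    show "\<exists>d b. 0 < d \<and> (\<forall>e\<in>B. of_nat d * e (Suc m) \<in> \<int> \<and> b \<le> e (Suc m))"
    proof -
      obtain d b where "0 < d" "\<forall>e\<in>A. of_nat d * e (Suc m) \<in> \<int> \<and> b \<le> e (Suc m)"
        using Suc.prems by auto
      then show ?thesis using Suc.prems(2) by (intro exI[of _ d] exI[of _ b]) auto
    qed
    fix c
    show "puiseux_support m {e. e (Suc m) = 0 \<and> e(Suc m := c) \<in> B}"
      by (rule Suc.IH[of "{e. e (Suc m) = 0 \<and> e(Suc m := c) \<in> A}"]) (use Suc.prems in auto)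
  qed
qed auto

lemma common_denominator:
  fixes x :: rat
  assumes "of_nat d * x \<in> \<int>"
  shows "of_nat (d * d') * x \<in> \<int>" "of_nat (d' * d) * x \<in> \<int>"
  using Ints_mult[OF Ints_of_nat[of d'] assms] by (simp_all add: ac_simps)

lemma puiseux_support_empty [simp]: "puiseux_support m {}"
  by (induction m) (auto intro: exI[of _ 1])

lemma puiseux_support_Un:
  "puiseux_support m A \<Longrightarrow> puiseux_support m B \<Longrightarrow> puiseux_support m (A \<union> B)"
proof (induction m arbitrary: A B)
  case (Suc m)
  obtain d b where d: "0 < d" "\<forall>e\<in>A. of_nat d * e (Suc m) \<in> \<int> \<and> b \<le> e (Suc m)"
    using Suc.prems by auto
  obtain d' b' where d': "0 < d'" "\<forall>e\<in>B. of_nat d' * e (Suc m) \<in> \<int> \<and> b' \<le> e (Suc m)"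
    using Suc.prems by auto
  show ?case
    unfolding puiseux_support.simps
  proof (intro conjI allI)
    show "\<exists>d b. 0 < d \<and> (\<forall>e\<in>A \<union> B. of_nat d * e (Suc m) \<in> \<int> \<and> b \<le> e (Suc m))"
      by (rule exI[of _ "d * d'"], rule exI[of _ "min b b'"])
        (use d d' common_denominator in \<open>auto simp del: of_nat_mult\<close>)
    fix c
    have "{e. e (Suc m) = 0 \<and> e(Suc m := c) \<in> A \<union> B} =
      {e. e (Suc m) = 0 \<and> e(Suc m := c) \<in> A} \<union> {e. e (Suc m) = 0 \<and> e(Suc m := c) \<in> B}"
      by auto
    then show "puiseux_support m {e. e (Suc m) = 0 \<and> e(Suc m := c) \<in> A \<union> B}"
      using Suc by auto
  qed
qed auto

lemma puiseux_support_UN: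
  "finite I \<Longrightarrow> (\<And>i. i \<in> I \<Longrightarrow> puiseux_support m (A i)) \<Longrightarrow> puiseux_support m (\<Union>i\<in>I. A i)"
  by (induction rule: finite_induct) (auto intro: puiseux_support_Un)

lemma finite_bounded_denominator:
  assumes "0 < d"
  shows "finite {x::rat. of_nat d * x \<in> \<int> \<and> b \<le> x \<and> x \<le> b'}"
proof -
  have "{x::rat. of_nat d * x \<in> \<int> \<and> b \<le> x \<and> x \<le> b'} \<subseteq>
    (\<lambda>z. of_int z / of_nat d) ` {\<lceil>of_nat d * b\<rceil>..\<lfloor>of_nat d * b'\<rfloor>}"
  proof
    fix x :: rat assume "x \<in> {x. of_nat d * x \<in> \<int> \<and> b \<le> x \<and> x \<le> b'}"
    then obtain z where z: "of_nat d * x = of_int z" and x: "b \<le> x" "x \<le> b'"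
      by (auto elim: Ints_cases)
    have "of_nat d * b \<le> of_int z" "of_int z \<le> of_nat d * b'"
      using x unfolding z[symmetric] by (auto intro: mult_left_mono)
    then have "z \<in> {\<lceil>of_nat d * b\<rceil>..\<lfloor>of_nat d * b'\<rfloor>}"
      by (auto simp: ceiling_le_iff le_floor_iff)
    moreover have "x = of_int z / of_nat d" using z assms by (simp add: field_simps)
    ultimately show "x \<in> (\<lambda>z. of_int z / of_nat d) ` {\<lceil>of_nat d * b\<rceil>..\<lfloor>of_nat d * b'\<rfloor>}" by blast
  qed
  then show ?thesis by (rule finite_subset) auto
qed

lemma puiseux_support_finite_sum:
  "puiseux_support m A \<Longrightarrow> puiseux_support m B \<Longrightarrow> finite {a. a \<in> A \<and> e - a \<in> B}"
proof (induction m arbitrary: A B e)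
  case 0
  then show ?case by (auto intro: finite_subset[of _ "{0}"])
next
  case (Suc m)
  obtain d b where d: "0 < d" "\<forall>e\<in>A. of_nat d * e (Suc m) \<in> \<int> \<and> b \<le> e (Suc m)"
    using Suc.prems by auto
  obtain d' b' where d': "0 < d'" "\<forall>e\<in>B. of_nat d' * e (Suc m) \<in> \<int> \<and> b' \<le> e (Suc m)"
    using Suc.prems by auto
  define C where "C = {x::rat. of_nat d * x \<in> \<int> \<and> b \<le> x \<and> x \<le> e (Suc m) - b'}"
  define sl where "sl = (\<lambda>(A::(nat \<Rightarrow> rat) set) c. {e. e (Suc m) = 0 \<and> e(Suc m := c) \<in> A})"
  have "{a. a \<in> A \<and> e - a \<in> B} \<subseteq>
    (\<Union>c\<in>C. (\<lambda>a. a(Suc m := c)) ` {a. a \<in> sl A c \<and> e(Suc m := 0) - a \<in> sl B (e (Suc m) - c)})"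
  proof
    fix a assume a: "a \<in> {a. a \<in> A \<and> e - a \<in> B}"
    let ?c = "a (Suc m)" and ?a = "a(Suc m := 0)"
    have "b' \<le> (e - a) (Suc m)" using a d' by blast
    then have "?c \<in> C" using a d d' unfolding C_def by (auto simp: fun_diff_def)
    moreover have "?a \<in> sl A ?c" using a by (auto simp: sl_def)
    moreover have "(e(Suc m := 0) - ?a)(Suc m := e (Suc m) - ?c) = e - a"
      by (auto simp: fun_eq_iff)
    then have "e(Suc m := 0) - ?a \<in> sl B (e (Suc m) - ?c)" using a by (auto simp: sl_def)
    moreover have "a = ?a(Suc m := ?c)" by simp
    ultimately show "a \<in> (\<Union>c\<in>C. (\<lambda>a. a(Suc m := c)) `
      {a. a \<in> sl A c \<and> e(Suc m := 0) - a \<in> sl B (e (Suc m) - c)})" by blast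
  qed
  moreover have "finite C" unfolding C_def using d(1) by (rule finite_bounded_denominator)
  moreover have "finite {a. a \<in> sl A c \<and> e' - a \<in> sl B c'}" for c c' e'
    by (rule Suc.IH) (use Suc.prems in \<open>auto simp: sl_def\<close>)
  ultimately show ?case by (meson finite_UN_I finite_imageI finite_subset)
qed

lemma puiseux_support_plus:
  "puiseux_support m A \<Longrightarrow> puiseux_support m B \<Longrightarrow> puiseux_support m (A + B)"
proof (induction m arbitrary: A B)
  case 0
  then have "a + b = 0" if "a \<in> A" "b \<in> B" for a b using that by fastforce
  then show ?case by (auto elim!: set_plus_elim)
next
  case (Suc m)
  obtain d b where d: "0 < d" "\<forall>e\<in>A. of_nat d * e (Suc m) \<in> \<int> \<and> b \<le> e (Suc m)"
    using Suc.prems by auto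
  obtain d' b' where d': "0 < d'" "\<forall>e\<in>B. of_nat d' * e (Suc m) \<in> \<int> \<and> b' \<le> e (Suc m)"
    using Suc.prems by auto
  define sl where "sl = (\<lambda>(A::(nat \<Rightarrow> rat) set) c. {e. e (Suc m) = 0 \<and> e(Suc m := c) \<in> A})"
  show ?case
    unfolding puiseux_support.simps
  proof (intro conjI allI)
    have "of_nat (d * d') * (x + y) \<in> \<int>"
      if "of_nat d * x \<in> \<int>" "of_nat d' * y \<in> \<int>" for x y :: rat
      unfolding distrib_left using that by (intro Ints_add common_denominator)
    then show "\<exists>d b. 0 < d \<and> (\<forall>e\<in>A + B. of_nat d * e (Suc m) \<in> \<int> \<and> b \<le> e (Suc m))"
      by (intro exI[of _ "d * d'"] exI[of _ "b + b'"])
        (use d d' in \<open>auto elim!: set_plus_elim intro!: add_mono simp del: of_nat_mult\<close>)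
    fix c
    define C where "C = {x::rat. of_nat d * x \<in> \<int> \<and> b \<le> x \<and> x \<le> c - b'}"
    have "{e. e (Suc m) = 0 \<and> e(Suc m := c) \<in> A + B} \<subseteq> (\<Union>x\<in>C. sl A x + sl B (c - x))"
    proof
      fix e assume "e \<in> {e. e (Suc m) = 0 \<and> e(Suc m := c) \<in> A + B}"
      then obtain x y where e: "e (Suc m) = 0" "e(Suc m := c) = x + y" and xy: "x \<in> A" "y \<in> B"
        by (auto elim!: set_plus_elim)
      from e(2) have c: "c = x (Suc m) + y (Suc m)" by (metis fun_upd_same plus_fun_apply)
      have "x (Suc m) \<in> C" using d d' xy c unfolding C_def by fastforce
      moreover have "x(Suc m := 0) \<in> sl A (x (Suc m))" using xy by (auto simp: sl_def)
      moreover have "y(Suc m := 0) \<in> sl B (c - x (Suc m))" using xy c by (auto simp: sl_def)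
      moreover have "e = x(Suc m := 0) + y(Suc m := 0)"
        using e by (auto simp: fun_eq_iff) (metis fun_upd_other plus_fun_apply)
      ultimately show "e \<in> (\<Union>x\<in>C. sl A x + sl B (c - x))" by (auto intro!: set_plus_intro)
    qed
    moreover have "puiseux_support m (\<Union>x\<in>C. sl A x + sl B (c - x))"
      by (rule puiseux_support_UN)
        (use Suc d(1) finite_bounded_denominator in \<open>auto simp: C_def sl_def\<close>)
    ultimately show "puiseux_support m {e. e (Suc m) = 0 \<and> e(Suc m := c) \<in> A + B}"
      by (rule puiseux_support_mono[rotated])
  qed
qed

lemma puiseux_support_zero [simp]: "puiseux_support m {0}"
proof (induction m)
  case (Suc m)
  have "puiseux_support m {e. e (Suc m) = 0 \<and> e(Suc m := c) \<in> {0}}" for c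
    by (rule puiseux_support_mono[OF Suc]) (auto simp: fun_eq_iff split: if_splits)
  then show ?case unfolding puiseux_support.simps by (auto intro!: exI[of _ "1::nat"] exI[of _ "0::rat"])
qed auto

typedef (overloaded) ('n::finite) puiseux =
  "{f :: (nat \<Rightarrow> rat) \<Rightarrow> complex. puiseux_support CARD('n) {e. f e \<noteq> 0}}"
  morphisms puiseux_coeff Abs_puiseux
  by (rule exI[of _ "\<lambda>_. 0"]) simp

setup_lifting type_definition_puiseux

lemma puiseux_support_coeff: "puiseux_support CARD('n) {e. puiseux_coeff (f :: 'n::finite puiseux) e \<noteq> 0}"
  using puiseux_coeff[of f] by simp

lemma puiseux_eqI: "(\<And>e. puiseux_coeff f e = puiseux_coeff g e) \<Longrightarrow> f = g"
  by (metis ext puiseux_coeff_inject)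

definition convolve :: "((nat \<Rightarrow> rat) \<Rightarrow> complex) \<Rightarrow> ((nat \<Rightarrow> rat) \<Rightarrow> complex) \<Rightarrow> (nat \<Rightarrow> rat) \<Rightarrow> complex" where
  "convolve f g e = (\<Sum>a | f a \<noteq> 0 \<and> g (e - a) \<noteq> 0. f a * g (e - a))"

lemma convolve_superset:
  assumes "finite S" "{a. f a \<noteq> 0 \<and> g (e - a) \<noteq> 0} \<subseteq> S"
  shows "convolve f g e = (\<Sum>a\<in>S. f a * g (e - a))"
  unfolding convolve_def by (rule sum.mono_neutral_left) (use assms in auto)

lemma convolve_support: "{e. convolve f g e \<noteq> 0} \<subseteq> {e. f e \<noteq> 0} + {e. g e \<noteq> 0}"
proof
  fix e assume "e \<in> {e. convolve f g e \<noteq> 0}"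
  then obtain a where "f a \<noteq> 0" "g (e - a) \<noteq> 0"
    unfolding convolve_def by (auto elim!: sum.not_neutral_contains_not_neutral)
  moreover have "e = a + (e - a)" by simp
  ultimately show "e \<in> {e. f e \<noteq> 0} + {e. g e \<noteq> 0}" by (metis mem_Collect_eq set_plus_intro)
qed

lemma puiseux_support_convolve:
  assumes "puiseux_support m {e. f e \<noteq> 0}" "puiseux_support m {e. g e \<noteq> 0}"
  shows "puiseux_support m {e. convolve f g e \<noteq> 0}"
  using puiseux_support_mono[OF puiseux_support_plus[OF assms] convolve_support] .

lemma puiseux_support_add:
  assumes "puiseux_support m {e. f e \<noteq> 0}" "puiseux_support m {e. g e \<noteq> 0}"
  shows "puiseux_support m {e. f e + g e \<noteq> (0::complex)}"
  by (rule puiseux_support_mono[OF puiseux_support_Un[OF assms]]) auto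

instantiation puiseux :: (finite) comm_ring_1
begin

lift_definition zero_puiseux :: "'a puiseux" is "\<lambda>_. 0" by simp
lift_definition one_puiseux :: "'a puiseux" is "\<lambda>e. if e = 0 then 1 else 0" by simp
lift_definition plus_puiseux :: "'a puiseux \<Rightarrow> 'a puiseux \<Rightarrow> 'a puiseux" is "\<lambda>f g e. f e + g e"
  by (rule puiseux_support_add)
lift_definition uminus_puiseux :: "'a puiseux \<Rightarrow> 'a puiseux" is "\<lambda>f e. - f e" by simp
lift_definition times_puiseux :: "'a puiseux \<Rightarrow> 'a puiseux \<Rightarrow> 'a puiseux" is convolve
  by (rule puiseux_support_convolve)
definition minus_puiseux :: "'a puiseux \<Rightarrow> 'a puiseux \<Rightarrow> 'a puiseux" where
  "minus_puiseux f g = f + - g"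

lemma finite_puiseux_coeff:
  "finite {a. puiseux_coeff (f :: 'a puiseux) a \<noteq> 0 \<and> puiseux_coeff (g :: 'a puiseux) (e - a) \<noteq> 0}"
  using puiseux_support_finite_sum[OF puiseux_support_coeff[of f] puiseux_support_coeff[of g], of e] by simp

lemma times_puiseux_superset:
  assumes "finite S" "{a. puiseux_coeff (f :: 'a puiseux) a \<noteq> 0 \<and> puiseux_coeff g (e - a) \<noteq> 0} \<subseteq> S"
  shows "puiseux_coeff (f * g) e = (\<Sum>a\<in>S. puiseux_coeff f a * puiseux_coeff g (e - a))"
  unfolding times_puiseux.rep_eq by (rule convolve_superset[OF assms])

instance
proof
  fix f g h :: "'a puiseux"
  show "f + g + h = f + (g + h)" by transfer (simp add: add.assoc)
  show "f + g = g + f" by transfer (simp add: add.commute)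
  show "0 + f = f" by transfer simp
  show "- f + f = 0" by transfer simp
  show "f - g = f + - g" by (simp add: minus_puiseux_def)
  show "(0::'a puiseux) \<noteq> 1"
  proof
    assume "(0::'a puiseux) = 1"
    then have "puiseux_coeff (0::'a puiseux) 0 = puiseux_coeff (1::'a puiseux) 0" by simp
    then show False by (simp add: zero_puiseux.rep_eq one_puiseux.rep_eq)
  qed
  show comm: "f * g = g * f" for f g :: "'a puiseux"
  proof (rule puiseux_eqI)
    fix e
    show "puiseux_coeff (f * g) e = puiseux_coeff (g * f) e"
      unfolding times_puiseux.rep_eq convolve_def
      by (rule sum.reindex_bij_witness[of _ "\<lambda>a. e - a" "\<lambda>a. e - a"]) auto
  qed
  show "1 * f = f"
  proof (rule puiseux_eqI)
    fix e
    show "puiseux_coeff (1 * f) e = puiseux_coeff f e"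
      by (subst times_puiseux_superset[of "{0}"]) (auto simp: one_puiseux.rep_eq)
  qed
  show "(f + g) * h = f * h + g * h"
  proof (rule puiseux_eqI)
    fix e
    let ?S = "{a. puiseux_coeff f a \<noteq> 0 \<and> puiseux_coeff h (e - a) \<noteq> 0} \<union>
      {a. puiseux_coeff g a \<noteq> 0 \<and> puiseux_coeff h (e - a) \<noteq> 0}"
    have S: "finite ?S" using finite_puiseux_coeff by blast
    have *: "puiseux_coeff ((f + g) * h) e = (\<Sum>a\<in>?S. puiseux_coeff (f + g) a * puiseux_coeff h (e - a))"
      by (rule times_puiseux_superset[OF S]) (auto simp: plus_puiseux.rep_eq)
    have **: "puiseux_coeff (f * h) e = (\<Sum>a\<in>?S. puiseux_coeff f a * puiseux_coeff h (e - a))"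
      "puiseux_coeff (g * h) e = (\<Sum>a\<in>?S. puiseux_coeff g a * puiseux_coeff h (e - a))"
      by (rule times_puiseux_superset[OF S]; auto)+
    show "puiseux_coeff ((f + g) * h) e = puiseux_coeff (f * h + g * h) e"
      unfolding * plus_puiseux.rep_eq ** by (simp add: distrib_right sum.distrib)
  qed
  show "f * g * h = f * (g * h)"
  proof (rule puiseux_eqI)
    fix e
    let ?f = "puiseux_coeff f" and ?g = "puiseux_coeff g" and ?h = "puiseux_coeff h"
    let ?F = "{a. ?f a \<noteq> 0}" and ?G = "{a. ?g a \<noteq> 0}" and ?H = "{a. ?h a \<noteq> 0}"
    define S where "S = {s. s \<in> ?F + ?G \<and> e - s \<in> ?H}"
    define A where "A = {a. a \<in> ?F \<and> e - a \<in> ?G + ?H}"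
    have S: "finite S" unfolding S_def
      by (intro puiseux_support_finite_sum[of "CARD('a)"] puiseux_support_plus puiseux_support_coeff)
    have A: "finite A" unfolding A_def
      by (intro puiseux_support_finite_sum[of "CARD('a)"] puiseux_support_plus puiseux_support_coeff)
    have fg: "puiseux_coeff (f * g) s = (\<Sum>a\<in>A. ?f a * ?g (s - a))" if "?h (e - s) \<noteq> 0" for s
    proof (rule times_puiseux_superset[OF A], rule subsetI)
      fix a assume a: "a \<in> {a. ?f a \<noteq> 0 \<and> ?g (s - a) \<noteq> 0}"
      have "e - a = (s - a) + (e - s)" by simp
      then have "e - a \<in> ?G + ?H" using a that by (metis (mono_tags, lifting) mem_Collect_eq set_plus_intro)
      then show "a \<in> A" using a by (simp add: A_def)
    qed
    have gh: "puiseux_coeff (g * h) (e - a) = (\<Sum>s\<in>S. ?g (s - a) * ?h (e - s))" if "?f a \<noteq> 0" for a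
    proof -
      let ?S = "(\<lambda>s. s - a) ` S"
      have "puiseux_coeff (g * h) (e - a) = (\<Sum>b\<in>?S. ?g b * ?h (e - a - b))"
      proof (rule times_puiseux_superset, use S in simp, rule subsetI)
        fix b assume b: "b \<in> {b. ?g b \<noteq> 0 \<and> ?h (e - a - b) \<noteq> 0}"
        have "a + b \<in> ?F + ?G" using b that by (intro set_plus_intro) auto
        then have "a + b \<in> S" using b by (simp add: S_def diff_diff_eq)
        then show "b \<in> ?S" by (rule rev_image_eqI) simp
      qed
      also have "\<dots> = (\<Sum>s\<in>S. ?g (s - a) * ?h (e - s))"
        by (subst sum.reindex) (auto simp: inj_on_def algebra_simps)
      finally show ?thesis .
    qed
    have "puiseux_coeff (f * g * h) e = (\<Sum>s\<in>S. puiseux_coeff (f * g) s * ?h (e - s))"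
      by (rule times_puiseux_superset[OF S])
        (use convolve_support[of ?f ?g] in \<open>auto simp: S_def times_puiseux.rep_eq\<close>)
    also have "\<dots> = (\<Sum>s\<in>S. \<Sum>a\<in>A. ?f a * ?g (s - a) * ?h (e - s))"
      by (rule sum.cong[OF refl]) (simp add: S_def fg sum_distrib_right)
    also have "\<dots> = (\<Sum>a\<in>A. \<Sum>s\<in>S. ?f a * ?g (s - a) * ?h (e - s))"
      by (rule sum.swap)
    also have "\<dots> = (\<Sum>a\<in>A. ?f a * puiseux_coeff (g * h) (e - a))"
      by (rule sum.cong[OF refl]) (simp add: A_def gh sum_distrib_left mult.assoc)
    also have "\<dots> = puiseux_coeff (f * (g * h)) e"
      by (rule times_puiseux_superset[OF A, symmetric])
        (use convolve_support[of ?g ?h] in \<open>auto simp: A_def times_puiseux.rep_eq\<close>)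
    finally show "puiseux_coeff (f * g * h) e = puiseux_coeff (f * (g * h)) e" .
  qed
qed

end

lemma puiseux_support_vanish: "puiseux_support m A \<Longrightarrow> e \<in> A \<Longrightarrow> m < i \<Longrightarrow> e i = 0"
proof (induction m arbitrary: A e)
  case (Suc m)
  let ?A = "{x. x (Suc m) = 0 \<and> x(Suc m := e (Suc m)) \<in> A}"
  have "(e(Suc m := 0))(Suc m := e (Suc m)) = e" by auto
  then have "e(Suc m := 0) \<in> ?A" using Suc.prems(2) by (metis (mono_tags, lifting) fun_upd_same mem_Collect_eq)
  moreover have "puiseux_support m ?A" using Suc.prems(1) by simp
  ultimately have "(e(Suc m := 0)) i = 0" using Suc.IH Suc.prems(3) by (meson Suc_lessD)
  then show ?case using Suc.prems by simp
qed auto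

lemma puiseux_support_Suc:
  assumes "puiseux_support m A"
  shows "puiseux_support (Suc m) A"
proof -
  have z: "e (Suc m) = 0" if "e \<in> A" for e
    using puiseux_support_vanish[OF assms that] by simp
  have "puiseux_support m {e. e (Suc m) = 0 \<and> e(Suc m := c) \<in> A}" for c
  proof (rule puiseux_support_mono[OF assms], rule subsetI)
    fix e assume e: "e \<in> {e. e (Suc m) = 0 \<and> e(Suc m := c) \<in> A}"
    then have "c = 0" using z by fastforce
    then have "e(Suc m := c) = e" using e by auto
    then show "e \<in> A" using e by simp
  qed
  then show ?thesis
    unfolding puiseux_support.simps
    by (intro conjI allI exI[of _ "1::nat"] exI[of _ "0::rat"]) (simp_all add: z)
qed

lemma puiseux_support_le: "m \<le> m' \<Longrightarrow> puiseux_support m A \<Longrightarrow> puiseux_support m' A"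
  by (induction rule: dec_induct) (blast intro: puiseux_support_Suc)+

definition puiseux_level :: "nat \<Rightarrow> 'n::finite puiseux \<Rightarrow> bool" where
  "puiseux_level m f \<longleftrightarrow> puiseux_support m {e. puiseux_coeff f e \<noteq> 0}"

lemma puiseux_level_add: "puiseux_level m f \<Longrightarrow> puiseux_level m g \<Longrightarrow> puiseux_level m (f + g)"
  unfolding puiseux_level_def plus_puiseux.rep_eq by (rule puiseux_support_add)

lemma puiseux_level_times: "puiseux_level m f \<Longrightarrow> puiseux_level m g \<Longrightarrow> puiseux_level m (f * g)"
  unfolding puiseux_level_def times_puiseux.rep_eq by (rule puiseux_support_convolve)

lemma puiseux_level_uminus: "puiseux_level m f \<Longrightarrow> puiseux_level m (- f)"
  unfolding puiseux_level_def uminus_puiseux.rep_eq by simp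

lemma puiseux_level_zero: "puiseux_level m 0"
  unfolding puiseux_level_def zero_puiseux.rep_eq by simp

lemma puiseux_level_sum: "(\<And>i. i \<in> I \<Longrightarrow> puiseux_level m (f i)) \<Longrightarrow> puiseux_level m (sum f I)"
  by (induction I rule: infinite_finite_induct) (auto intro: puiseux_level_add puiseux_level_zero)

lemma puiseux_level_right_inverse:
  assumes "\<And>j. puiseux_level m (p $ j)" "puiseux_level m u"
  shows "puiseux_level m (fps_right_inverse p u $ j)"
proof (induction j rule: less_induct)
  case (less j)
  show ?case
  proof (cases j)
    case (Suc j')
    have "puiseux_level m (fps_right_inverse_constructor p u (j - i))" if "i \<in> {1..j}" for i
      using less[of "j - i"] that by simp
    then show ?thesis
      unfolding Suc fps_nth_Abs_fps fps_right_inverse_constructor.simps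
      by (intro puiseux_level_times puiseux_level_uminus puiseux_level_sum) (use assms Suc in auto)
  qed (use assms in auto)
qed

lemma puiseux_coeff_sum: "puiseux_coeff (sum f I) e = (\<Sum>i\<in>I. puiseux_coeff (f i) e)"
  by (induction I rule: infinite_finite_induct) (simp_all add: zero_puiseux.rep_eq plus_puiseux.rep_eq)

lemma puiseux_level_inverse:
  fixes f :: "'n::finite puiseux"
  shows "m \<le> CARD('n) \<Longrightarrow> puiseux_level m f \<Longrightarrow> f \<noteq> 0 \<Longrightarrow> \<exists>g. puiseux_level m g \<and> f * g = 1"
proof (induction m arbitrary: f)
  case 0
  define g :: "'n puiseux" where "g = Abs_puiseux (\<lambda>e. if e = 0 then inverse (puiseux_coeff f 0) else 0)"
  have g: "puiseux_coeff g e = (if e = 0 then inverse (puiseux_coeff f 0) else 0)" for e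
    unfolding g_def
    by (subst Abs_puiseux_inverse) (auto intro: puiseux_support_mono[OF puiseux_support_zero])
  have f: "puiseux_coeff f e = 0" if "e \<noteq> 0" for e
    using 0 that by (auto simp: puiseux_level_def)
  then have f0: "puiseux_coeff f 0 \<noteq> 0"
    using 0 by (metis puiseux_eqI zero_puiseux.rep_eq)
  have "f * g = 1"
  proof (rule puiseux_eqI)
    fix e
    show "puiseux_coeff (f * g) e = puiseux_coeff 1 e"
      by (subst times_puiseux_superset[of "{0}"])
        (use f f0 in \<open>auto simp: g one_puiseux.rep_eq\<close>)
  qed
  moreover have "puiseux_level 0 g" by (auto simp: puiseux_level_def g)
  ultimately show ?case by blast
next
  case (Suc m)
  let ?s = "Suc m"
  obtain d b where d: "0 < d" and
    db: "\<And>e. puiseux_coeff f e \<noteq> 0 \<Longrightarrow> of_nat d * e ?s \<in> \<int> \<and> b \<le> e ?s"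
    using Suc.prems(2) by (auto simp: puiseux_level_def)
  define sl :: "rat \<Rightarrow> 'n puiseux" where
    "sl = (\<lambda>c. Abs_puiseux (\<lambda>e. if e ?s = 0 then puiseux_coeff f (e(?s := c)) else 0))"
  have supp: "puiseux_support m {e. (if e ?s = 0 then puiseux_coeff f (e(?s := c)) else 0) \<noteq> 0}" for c
    by (rule puiseux_support_mono[of _ "{e. e ?s = 0 \<and> e(?s := c) \<in> {e. puiseux_coeff f e \<noteq> 0}}"])
      (use Suc.prems(2) in \<open>auto simp: puiseux_level_def split: if_splits\<close>)
  have sl: "puiseux_coeff (sl c) e = (if e ?s = 0 then puiseux_coeff f (e(?s := c)) else 0)" for c e
    unfolding sl_def
    by (subst Abs_puiseux_inverse) (use puiseux_support_le[OF _ supp] Suc.prems(1) in auto)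
  have sl_level: "puiseux_level m (sl c)" for c
    unfolding puiseux_level_def sl by (rule supp)
  have sl_nz: "sl (e ?s) \<noteq> 0" if "puiseux_coeff f e \<noteq> 0" for e
  proof
    assume "sl (e ?s) = 0"
    then have "puiseux_coeff (sl (e ?s)) (e(?s := 0)) = 0" by (simp add: zero_puiseux.rep_eq)
    then show False using that by (simp add: sl)
  qed
  have sl_ex: "\<exists>e. puiseux_coeff f e \<noteq> 0 \<and> e ?s = c" if nz: "sl c \<noteq> 0" for c
  proof -
    obtain e where "puiseux_coeff (sl c) e \<noteq> 0"
      using nz by (metis puiseux_eqI zero_puiseux.rep_eq)
    then show ?thesis by (intro exI[of _ "e(?s := c)"]) (auto simp: sl split: if_splits)
  qed
  obtain e1 where e1: "puiseux_coeff f e1 \<noteq> 0"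
    using Suc.prems(3) by (metis puiseux_eqI zero_puiseux.rep_eq)
  define C where "C = {c. sl c \<noteq> 0 \<and> c \<le> e1 ?s}"
  have "C \<subseteq> {x. of_nat d * x \<in> \<int> \<and> b \<le> x \<and> x \<le> e1 ?s}"
    unfolding C_def using sl_ex db by blast
  then have C: "finite C" "C \<noteq> {}"
    using finite_bounded_denominator[OF d] finite_subset sl_nz[OF e1] by (blast, auto simp: C_def)
  define c0 where "c0 = Min C"
  have c0: "sl c0 \<noteq> 0" using Min_in[OF C] by (simp add: C_def c0_def)
  have c0_le: "c0 \<le> e ?s" if "puiseux_coeff f e \<noteq> 0" for e
  proof (cases "e ?s \<le> e1 ?s")
    case True
    then have "e ?s \<in> C" using sl_nz[OF that] by (simp add: C_def)
    then show ?thesis using C by (simp add: c0_def)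
  next
    case False
    moreover have "c0 \<le> e1 ?s" using Min_in[OF C] by (simp add: C_def c0_def)
    ultimately show ?thesis by simp
  qed
  have dc0: "of_nat d * c0 \<in> \<int>" using sl_ex[OF c0] db by blast
  define p where "p = Abs_fps (\<lambda>j. sl (c0 + of_nat j / of_nat d))"
  have p: "p $ j = sl (c0 + of_nat j / of_nat d)" for j by (simp add: p_def)
  obtain u where u: "puiseux_level m u" "sl c0 * u = 1"
    using Suc.IH[of "sl c0"] Suc.prems(1) sl_level c0 by auto
  define r where "r = fps_right_inverse p u"
  have pr: "p * r = 1" unfolding r_def by (rule fps_right_inverse) (simp add: p u)
  have r_level: "puiseux_level m (r $ j)" for j
    unfolding r_def by (rule puiseux_level_right_inverse) (simp_all add: p sl_level u)
  define Y where "Y = (\<lambda>e. if of_nat d * (e ?s + c0) \<in> \<nat>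
    then puiseux_coeff (r $ nat \<lfloor>of_nat d * (e ?s + c0)\<rfloor>) (e(?s := 0)) else 0)"
  have Y_supp: "puiseux_support ?s {e. Y e \<noteq> 0}"
    unfolding puiseux_support.simps
  proof (intro conjI allI)
    show "\<exists>d b. 0 < d \<and> (\<forall>e\<in>{e. Y e \<noteq> 0}. of_nat d * e ?s \<in> \<int> \<and> b \<le> e ?s)"
    proof (intro exI[of _ d] exI[of _ "- c0"] conjI ballI d)
      fix e assume "e \<in> {e. Y e \<noteq> 0}"
      then have *: "of_nat d * (e ?s + c0) \<in> \<nat>" by (auto simp: Y_def split: if_splits)
      have "of_nat d * e ?s = of_nat d * (e ?s + c0) - of_nat d * c0" by (simp add: algebra_simps)
      then show "of_nat d * e ?s \<in> \<int>" using * dc0 Nats_subset_Ints by (metis Ints_diff subsetD)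
      have "0 \<le> of_nat d * (e ?s + c0)" using * by (auto elim!: Nats_cases)
      then have "0 \<le> e ?s + c0" using d by (simp add: zero_le_mult_iff)
      then show "- c0 \<le> e ?s" by simp
    qed
    fix c
    show "puiseux_support m {e. e ?s = 0 \<and> e(?s := c) \<in> {e. Y e \<noteq> 0}}"
    proof (rule puiseux_support_mono)
      show "puiseux_support m {e. puiseux_coeff (r $ nat \<lfloor>of_nat d * (c + c0)\<rfloor>) e \<noteq> 0}"
        using r_level by (simp add: puiseux_level_def)
      show "{e. e ?s = 0 \<and> e(?s := c) \<in> {e. Y e \<noteq> 0}} \<subseteq>
        {e. puiseux_coeff (r $ nat \<lfloor>of_nat d * (c + c0)\<rfloor>) e \<noteq> 0}"
      proof
        fix e assume e: "e \<in> {e. e ?s = 0 \<and> e(?s := c) \<in> {e. Y e \<noteq> 0}}"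
        then have "e(?s := 0) = e" by auto
        then show "e \<in> {e. puiseux_coeff (r $ nat \<lfloor>of_nat d * (c + c0)\<rfloor>) e \<noteq> 0}"
          using e by (auto simp: Y_def split: if_splits)
      qed
    qed
  qed
  define g :: "'n puiseux" where "g = Abs_puiseux Y"
  have g: "puiseux_coeff g = Y"
    unfolding g_def by (subst Abs_puiseux_inverse)
      (use puiseux_support_le[OF _ Y_supp] Suc.prems(1) in auto)
  have "f * g = 1"
  proof (rule puiseux_eqI)
    fix e
    have exps: "\<exists>i l. a ?s = c0 + of_nat i / of_nat d \<and> of_nat d * ((e - a) ?s + c0) = of_nat l \<and>
      of_nat d * e ?s = of_nat (i + l)"
      if a: "puiseux_coeff f a \<noteq> 0" "Y (e - a) \<noteq> 0" for a
    proof -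
      have "of_nat d * (a ?s - c0) \<in> \<int>"
        using db[OF a(1)] dc0 by (simp add: right_diff_distrib)
      moreover have "0 \<le> of_nat d * (a ?s - c0)" using c0_le[OF a(1)] by simp
      ultimately obtain i where i: "of_nat d * (a ?s - c0) = of_nat i"
        by (metis Ints_cases of_int_0_le_iff of_int_of_nat_eq zero_le_imp_eq_int)
      obtain l where l: "of_nat d * ((e - a) ?s + c0) = of_nat l"
        using a(2) by (auto simp: Y_def elim!: Nats_cases split: if_splits)
      have "a ?s = c0 + of_nat i / of_nat d" using i d by (simp add: field_simps)
      moreover have "of_nat d * e ?s = of_nat (i + l)"
        using i l by (simp add: algebra_simps)
      ultimately show ?thesis using l by blast
    qed
    show "puiseux_coeff (f * g) e = puiseux_coeff 1 e"
    proof (cases "of_nat d * e ?s \<in> \<nat>")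
      case False
      then have "{a. puiseux_coeff f a \<noteq> 0 \<and> Y (e - a) \<noteq> 0} = {}"
        using exps by (metis (mono_tags, lifting) Collect_empty_eq of_nat_in_Nats)
      then have "puiseux_coeff (f * g) e = 0"
        by (subst times_puiseux_superset[of "{}"]) (simp_all add: g)
      moreover have "e \<noteq> 0" using False by auto
      ultimately show ?thesis by (simp add: one_puiseux.rep_eq)
    next
      case True
      then obtain J where J: "of_nat d * e ?s = of_nat J" by (auto elim: Nats_cases)
      define e' where "e' = e(?s := 0)"
      define T where "T = (\<lambda>i. {a. puiseux_coeff (p $ i) a \<noteq> 0 \<and> puiseux_coeff (r $ (J - i)) (e' - a) \<noteq> 0})"
      have Yval: "Y (e - a) = puiseux_coeff (r $ (J - i)) (e' - a(?s := 0))"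
        if "a ?s = c0 + of_nat i / of_nat d" "i \<le> J" for a i
      proof -
        have *: "of_nat d * ((e - a) ?s + c0) = of_nat (J - i)"
          using that J d by (simp add: field_simps of_nat_diff)
        have **: "(e - a)(?s := 0) = e' - a(?s := 0)" by (auto simp: e'_def fun_eq_iff)
        show ?thesis unfolding Y_def * ** by simp
      qed
      have "puiseux_coeff (f * g) e =
        (\<Sum>a | puiseux_coeff f a \<noteq> 0 \<and> Y (e - a) \<noteq> 0. puiseux_coeff f a * Y (e - a))"
        unfolding times_puiseux.rep_eq convolve_def g ..
      also have "\<dots> = (\<Sum>(i, a)\<in>Sigma {0..J} T. puiseux_coeff (p $ i) a * puiseux_coeff (r $ (J - i)) (e' - a))"
      proof (rule sum.reindex_bij_witness[of _ "\<lambda>(i, a). a(?s := c0 + of_nat i / of_nat d)"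
          "\<lambda>a. (nat \<lfloor>of_nat d * (a ?s - c0)\<rfloor>, a(?s := 0))"])
        fix a assume "a \<in> {a. puiseux_coeff f a \<noteq> 0 \<and> Y (e - a) \<noteq> 0}"
        then have a: "puiseux_coeff f a \<noteq> 0" "Y (e - a) \<noteq> 0" by auto
        obtain i l where i: "a ?s = c0 + of_nat i / of_nat d" and "of_nat d * e ?s = of_nat (i + l)"
          using exps[OF a] by blast
        then have "i + l = J" using J by (metis of_nat_eq_iff)
        then have iJ: "i \<le> J" by simp
        have ni: "nat \<lfloor>of_nat d * (a ?s - c0)\<rfloor> = i" unfolding i using d by simp
        have pf: "puiseux_coeff (p $ i) (a(?s := 0)) = puiseux_coeff f a"
          unfolding p sl by (simp add: i[symmetric])
        show "(case (nat \<lfloor>of_nat d * (a ?s - c0)\<rfloor>, a(?s := 0)) of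
          (i, a) \<Rightarrow> a(?s := c0 + of_nat i / of_nat d)) = a"
          unfolding ni by (simp add: i[symmetric])
        show "(nat \<lfloor>of_nat d * (a ?s - c0)\<rfloor>, a(?s := 0)) \<in> Sigma {0..J} T"
          unfolding ni T_def using a iJ Yval[of a i, OF i iJ] pf by simp
        show "(case (nat \<lfloor>of_nat d * (a ?s - c0)\<rfloor>, a(?s := 0)) of
          (i, a) \<Rightarrow> puiseux_coeff (p $ i) a * puiseux_coeff (r $ (J - i)) (e' - a)) =
          puiseux_coeff f a * Y (e - a)"
          unfolding ni using Yval[of a i, OF i iJ] pf by simp
      next
        fix x assume "x \<in> Sigma {0..J} T"
        then obtain i a where x: "x = (i, a)" and iJ: "i \<le> J"
          and a: "puiseux_coeff (p $ i) a \<noteq> 0" "puiseux_coeff (r $ (J - i)) (e' - a) \<noteq> 0"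
          by (auto simp: T_def)
        let ?a = "a(?s := c0 + of_nat i / of_nat d)"
        have a0: "a ?s = 0" using a(1) by (auto simp: p sl split: if_splits)
        then have aa: "a(?s := 0) = a" by auto
        have "Y (e - ?a) = puiseux_coeff (r $ (J - i)) (e' - a)"
          using Yval[of ?a i] iJ aa by simp
        moreover have "puiseux_coeff f ?a = puiseux_coeff (p $ i) a" using a0 by (simp add: p sl)
        ultimately show "(case x of (i, a) \<Rightarrow> a(?s := c0 + of_nat i / of_nat d)) \<in> {a. puiseux_coeff f a \<noteq> 0 \<and> Y (e - a) \<noteq> 0}"
          unfolding x using a by simp
        show "(nat \<lfloor>of_nat d * ((case x of (i, a) \<Rightarrow> a(?s := c0 + of_nat i / of_nat d)) ?s - c0)\<rfloor>, (case x of (i, a) \<Rightarrow> a(?s := c0 + of_nat i / of_nat d))(?s := 0)) = x"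
          unfolding x using d aa by simp
      qed
      also have "\<dots> = (\<Sum>i=0..J. \<Sum>a\<in>T i. puiseux_coeff (p $ i) a * puiseux_coeff (r $ (J - i)) (e' - a))"
        unfolding T_def by (rule sum.Sigma[symmetric]) (auto intro: finite_puiseux_coeff)
      also have "\<dots> = (\<Sum>i=0..J. puiseux_coeff (p $ i * r $ (J - i)) e')"
        unfolding times_puiseux.rep_eq convolve_def T_def ..
      also have "\<dots> = puiseux_coeff (\<Sum>i=0..J. p $ i * r $ (J - i)) e'"
        by (rule puiseux_coeff_sum[symmetric])
      also have "\<dots> = puiseux_coeff ((1::'n puiseux fps) $ J) e'"
        unfolding pr[symmetric] fps_mult_nth ..
      also have "\<dots> = puiseux_coeff 1 e"
      proof -
        have "J = 0 \<and> e' = 0 \<longleftrightarrow> e = 0"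
        proof
          assume *: "J = 0 \<and> e' = 0"
          then have "e ?s = 0" using J d by simp
          then have "e' = e" unfolding e'_def by auto
          then show "e = 0" using * by simp
        next
          assume "e = 0"
          then show "J = 0 \<and> e' = 0" using J by (auto simp: e'_def fun_eq_iff)
        qed
        then show ?thesis by (auto simp: one_puiseux.rep_eq zero_puiseux.rep_eq)
      qed
      finally show ?thesis .
    qed
  qed
  moreover have "puiseux_level ?s g" unfolding puiseux_level_def g by (rule Y_supp)
  ultimately show ?case by blast
qed

instantiation puiseux :: (finite) inverse
begin

definition inverse_puiseux :: "'a puiseux \<Rightarrow> 'a puiseux" where
  "inverse_puiseux f = (if f = 0 then 0 else THE g. f * g = 1)"
definition divide_puiseux :: "'a puiseux \<Rightarrow> 'a puiseux \<Rightarrow> 'a puiseux" where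
  "divide_puiseux f g = f * inverse g"

instance ..

end

instance puiseux :: (finite) field
proof
  fix f g :: "'a puiseux"
  show "inverse f * f = 1" if nz: "f \<noteq> 0"
  proof -
    have "puiseux_level CARD('a) f" unfolding puiseux_level_def by (rule puiseux_support_coeff)
    then obtain g where g: "f * g = 1" using puiseux_level_inverse[OF order_refl _ nz] by blast
    have "\<exists>!g. f * g = 1"
      by (rule ex1I[of _ g]) (use g in \<open>metis mult.left_commute mult.right_neutral\<close>)+
    then have "f * inverse f = 1"
      unfolding inverse_puiseux_def using nz theI'[of "\<lambda>g. f * g = 1"] by simp
    then show ?thesis by (simp add: mult.commute)
  qed
  show "f / g = f * inverse g" by (rule divide_puiseux_def)
  show "inverse (0::'a puiseux) = 0" by (simp add: inverse_puiseux_def)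
qed

text \<open>This is \<open>T\<^sub>i\<close> for \<open>1 \<le> i \<le> N\<close>; it is not used for other \<open>i\<close>.\<close>

definition puiseux_var :: "nat \<Rightarrow> 'n::finite puiseux" where
  "puiseux_var i = Abs_puiseux (\<lambda>e. if e = (\<lambda>j. if j = i then 1 else 0) then 1 else 0)"

lemma puiseux_support_var:
  "1 \<le> i \<Longrightarrow> i \<le> m \<Longrightarrow> puiseux_support m {\<lambda>j. if j = i then 1 else 0}"
proof (induction m)
  case (Suc m)
  show ?case
  proof (cases "i = Suc m")
    case True
    have "puiseux_support m {e. e (Suc m) = 0 \<and> e(Suc m := c) \<in> {\<lambda>j. if j = Suc m then 1 else 0}}" for c
      by (rule puiseux_support_mono[OF puiseux_support_zero]) (auto simp: fun_eq_iff split: if_splits)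
    then show ?thesis
      unfolding True puiseux_support.simps
      by (intro conjI allI exI[of _ "1::nat"] exI[of _ "0::rat"]) simp_all
  next
    case False
    then show ?thesis using Suc by (intro puiseux_support_Suc) simp
  qed
qed simp

lemma puiseux_coeff_var:
  "1 \<le> i \<Longrightarrow> i \<le> CARD('n) \<Longrightarrow> puiseux_coeff (puiseux_var i :: 'n::finite puiseux) e =
    (if e = (\<lambda>j. if j = i then 1 else 0) then 1 else 0)"
  unfolding puiseux_var_def using puiseux_support_var[of i "CARD('n)"]
  by (subst Abs_puiseux_inverse) (simp_all add: puiseux_support_mono)


section \<open>The field \<open>\<bbbF>\<^sub>q\<close>\<close>

text \<open>
  Completing the tensor product at \<open>q = 0\<close> gives the Laurent series in \<open>q\<^bsup>1/N\<^esup>\<close> over the Puiseux series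
  field. The variable \<^const>\<open>fls_X\<close> stands for \<open>q\<^bsup>1/N\<^esup>\<close>.
\<close>

type_synonym 'n Fq = "'n puiseux fls"

definition Fq_T :: "nat \<Rightarrow> 'n::finite Fq" where
  "Fq_T i = fls_const (puiseux_var i)"

definition Fq_q :: "'n::finite Fq" where
  "Fq_q = fls_X ^ CARD('n)"


section \<open>The spin chain\<close>

text \<open>
  A vector of the \<open>N\<close>-fold tensor power of \<open>V\<close> is given by its coordinates: the coordinate at a set
  \<open>J\<close> of positions belongs to the basis vector with \<open>v\<^sub>1\<close> at the positions in \<open>J\<close> and \<open>v\<^sub>0\<close> elsewhere.
  The scalars are left arbitrary because the operators act with coefficients in \<open>\<bbbF>\<^sub>q\<close> as well as in
  the polynomial ring \<open>\<bbbF>\<^sub>q[x]\<close>.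
\<close>

type_synonym 'a spin = "nat set \<Rightarrow> 'a"
type_synonym 'a spin_op = "'a spin \<Rightarrow> 'a spin"

definition spin_basis :: "nat set \<Rightarrow> 'a::zero_neq_one spin" where
  "spin_basis K = (\<lambda>J. if J = K then 1 else 0)"

definition sigma_plus :: "nat \<Rightarrow> 'a::zero spin_op" where
  "sigma_plus j v = (\<lambda>J. if j \<in> J then v (J - {j}) else 0)"

definition sigma_minus :: "nat \<Rightarrow> 'a::zero spin_op" where
  "sigma_minus j v = (\<lambda>J. if j \<in> J then 0 else v (insert j J))"

datatype 'b mat2 = Mat2 (entry_A: 'b) (entry_B: 'b) (entry_C: 'b) (entry_D: 'b)

definition mat2_mult :: "'a::comm_ring_1 spin_op mat2 \<Rightarrow> 'a spin_op mat2 \<Rightarrow> 'a spin_op mat2" where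
  "mat2_mult M M' = Mat2
     (\<lambda>v J. entry_A M (entry_A M' v) J + entry_B M (entry_C M' v) J)
     (\<lambda>v J. entry_A M (entry_B M' v) J + entry_B M (entry_D M' v) J)
     (\<lambda>v J. entry_C M (entry_A M' v) J + entry_D M (entry_C M' v) J)
     (\<lambda>v J. entry_C M (entry_B M' v) J + entry_D M (entry_D M' v) J)"

definition lax :: "(nat \<Rightarrow> 'a::comm_ring_1) \<Rightarrow> 'a \<Rightarrow> nat \<Rightarrow> 'a spin_op mat2" where
  "lax t x j = Mat2
     (\<lambda>v J. v J + x * t j * sigma_plus j (sigma_minus j v) J)
     (\<lambda>v J. x * sigma_plus j v J)
     (\<lambda>v J. sigma_minus j v J)
     (\<lambda>v J. x * sigma_plus j (sigma_minus j v) J)"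

text \<open>\<open>monodromy t x m\<close> is the product \<open>L'\<^sub>m \<cdots> L'\<^sub>1\<close>.\<close>

primrec monodromy :: "(nat \<Rightarrow> 'a::comm_ring_1) \<Rightarrow> 'a \<Rightarrow> nat \<Rightarrow> 'a spin_op mat2" where
  "monodromy t x 0 = Mat2 (\<lambda>v. v) (\<lambda>v J. 0) (\<lambda>v J. 0) (\<lambda>v. v)"
| "monodromy t x (Suc m) = mat2_mult (lax t x (Suc m)) (monodromy t x m)"

text \<open>
  \<open>E(x)\<close> acts over the polynomial ring, with the spectral parameter \<open>x\<close> the indeterminate
  \<^term>\<open>[:0, 1:]\<close>; \<open>E\<^sub>r\<close> extracts the coefficient of \<open>x\<^sup>r\<close>. Here and below \<open>T\<close> is indexed from 1 and
  \<open>t\<^sub>i = T\<^bsub>N+1-i\<^esub>\<close>.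
\<close>

definition rev_param :: "nat \<Rightarrow> (nat \<Rightarrow> 'a) \<Rightarrow> nat \<Rightarrow> 'a" where
  "rev_param N T i = T (N + 1 - i)"

definition transfer_E :: "nat \<Rightarrow> (nat \<Rightarrow> 'a::comm_ring_1) \<Rightarrow> 'a \<Rightarrow> 'a poly spin_op" where
  "transfer_E N T q v =
     (let M = monodromy (\<lambda>j. [:rev_param N T j:]) [:0, 1:] N
      in (\<lambda>J. entry_A M v J + [:q:] * entry_D M v J))"

definition E_op :: "nat \<Rightarrow> (nat \<Rightarrow> 'a::comm_ring_1) \<Rightarrow> 'a \<Rightarrow> int \<Rightarrow> 'a spin_op" where
  "E_op N T q r v =
     (\<lambda>J. if r < 0 then 0 else poly.coeff (transfer_E N T q (\<lambda>K. [:v K:]) J) (nat r))"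


section \<open>Partitions and the product\<close>

text \<open>A partition with \<open>n\<close> parts is a list of length \<open>n\<close>; the part \<open>\<lambda>\<^sub>i\<close> is \<open>l ! (i - 1)\<close>.\<close>

definition box_partitions :: "nat \<Rightarrow> nat \<Rightarrow> nat list set" where
  "box_partitions n k = {l. length l = n \<and> sorted_wrt (\<ge>) l \<and> (\<forall>a\<in>set l. a \<le> k)}"

definition position :: "nat list \<Rightarrow> nat \<Rightarrow> nat" where
  "position l i = l ! (length l - i) + i"

definition positions :: "nat list \<Rightarrow> nat set" where
  "positions l = position l ` {1..length l}"

definition conjugate_part :: "nat list \<Rightarrow> nat \<Rightarrow> nat" where
  "conjugate_part l i = card {j. j < length l \<and> i \<le> l ! j}"

definition dual_partition :: "nat \<Rightarrow> nat list \<Rightarrow> nat list" where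
  "dual_partition k l = map (\<lambda>a. k - a) (rev l)"

text \<open>
  Leibniz determinant of a \<open>k \<times> k\<close> matrix of operators (rows and columns indexed from 1), the product
  over the rows taken from left to right. It is applied to commuting entries only.
\<close>

definition op_det :: "nat \<Rightarrow> (nat \<Rightarrow> nat \<Rightarrow> 'a::comm_ring_1 spin_op) \<Rightarrow> 'a spin_op" where
  "op_det k M v =
     (\<lambda>J. \<Sum>p | p permutes {1..k}. of_int (sign p) * foldr (\<lambda>i. M i (p i)) [1..<Suc k] v J)"

definition S_op :: "nat \<Rightarrow> nat \<Rightarrow> (nat \<Rightarrow> 'a::comm_ring_1) \<Rightarrow> 'a \<Rightarrow> nat list \<Rightarrow> 'a spin_op" where
  "S_op N n T q l =
     op_det (N - n) (\<lambda>i j. E_op N T q (int (conjugate_part l i) - int i + int j))"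

text \<open>\<open>elem_sym r m t\<close> is the elementary symmetric polynomial \<open>e\<^sub>r(t\<^sub>1, \<dots>, t\<^sub>m)\<close>.\<close>

definition elem_sym :: "int \<Rightarrow> nat \<Rightarrow> (nat \<Rightarrow> 'a::comm_ring_1) \<Rightarrow> 'a" where
  "elem_sym r m t = (\<Sum>A | A \<subseteq> {1..m} \<and> int (card A) = r. \<Prod>a\<in>A. t a)"

text \<open>Matrix entries of \<^const>\<open>mat\<close> are indexed from 0.\<close>

definition S_tilde :: "nat \<Rightarrow> nat \<Rightarrow> (nat \<Rightarrow> 'a::comm_ring_1) \<Rightarrow> 'a \<Rightarrow> nat list \<Rightarrow> 'a spin_op" where
  "S_tilde N n T q l v =
     (\<lambda>J. \<Sum>m | m \<in> box_partitions n (N - n) \<and> (\<forall>i<n. m ! i \<le> l ! i).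
        (- 1) ^ (sum_list l - sum_list m) *
        det (mat n n (\<lambda>(i, j).
          elem_sym (int (l ! i) - int (m ! j) - int i + int j) (n + l ! i - Suc i) (rev_param N T))) *
        S_op N n T q m v J)"

definition spin_mult ::
    "nat \<Rightarrow> nat \<Rightarrow> (nat \<Rightarrow> 'a::comm_ring_1) \<Rightarrow> 'a \<Rightarrow> 'a spin \<Rightarrow> 'a spin \<Rightarrow> 'a spin" where
  "spin_mult N n T q v w =
     (\<lambda>J. \<Sum>l\<in>box_partitions n (N - n). \<Sum>m\<in>box_partitions n (N - n).
        v (positions l) * w (positions m) * S_tilde N n T q l (spin_basis (positions m)) J)"

text \<open>The unit is \<open>|\<emptyset>\<rangle>\<close>, since \<open>S_tilde\<close> of the empty partition is the identity on \<open>V\<^sub>n\<close>.\<close>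

definition spin_algebra ::
    "nat \<Rightarrow> nat \<Rightarrow> (nat \<Rightarrow> 'a::comm_ring_1) \<Rightarrow> 'a \<Rightarrow> ('a, 'a spin) module" where
  "spin_algebra N n T q =
     \<lparr>carrier = {v. \<forall>J. v J \<noteq> 0 \<longrightarrow> J \<subseteq> {1..N} \<and> card J = n},
      mult = spin_mult N n T q,
      one = spin_basis (positions (replicate n 0)),
      zero = (\<lambda>J. 0),
      add = (\<lambda>v w J. v J + w J),
      smult = (\<lambda>c v J. c * v J)\<rparr>"


section \<open>Bethe roots and Bethe vectors\<close>

text \<open>
  The Bethe root \<open>y\<^sub>j\<close> is the solution that is regular at \<open>q = 0\<close> (no negative powers of \<open>q\<^bsup>1/N\<^esup>\<close>) with
  value \<open>t\<^sub>j\<close> there. As the \<open>t\<^sub>j\<close> are pairwise distinct, Hensel's lemma gives exactly one.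
\<close>

definition bethe_root :: "nat \<Rightarrow> nat \<Rightarrow> 'n::finite Fq" where
  "bethe_root n j = (THE y.
     (\<Prod>i=1..CARD('n). y - rev_param CARD('n) Fq_T i) + (- 1) ^ n * Fq_q = 0 \<and>
     0 \<le> fls_subdegree y \<and>
     fls_const (fls_nth y 0) = rev_param CARD('n) Fq_T j)"

definition factorial_power :: "'a::comm_ring_1 \<Rightarrow> (nat \<Rightarrow> 'a) \<Rightarrow> nat \<Rightarrow> 'a" where
  "factorial_power x a r = (\<Prod>i=1..r. x - a i)"

definition factorial_schur :: "nat \<Rightarrow> nat list \<Rightarrow> (nat \<Rightarrow> 'a::field) \<Rightarrow> (nat \<Rightarrow> 'a) \<Rightarrow> 'a" where
  "factorial_schur n l x a =
     det (mat n n (\<lambda>(i, j). factorial_power (x (Suc j)) a (l ! i + n - Suc i))) /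
     det (mat n n (\<lambda>(i, j). factorial_power (x (Suc j)) a (n - Suc i)))"

definition bethe_vector :: "nat \<Rightarrow> nat list \<Rightarrow> 'n::finite Fq spin" where
  "bethe_vector n l =
     (\<lambda>J. \<Sum>m\<in>box_partitions n (CARD('n) - n).
        factorial_schur n (dual_partition (CARD('n) - n) m) (\<lambda>j. bethe_root n (position l j)) Fq_T *
        spin_basis (positions m) J)"

definition bethe_euler :: "nat \<Rightarrow> nat list \<Rightarrow> 'n::finite Fq" where
  "bethe_euler n l =
     (\<Prod>i\<in>positions l. \<Prod>j\<in>{1..CARD('n)} - positions l. bethe_root n i - bethe_root n j)"


section \<open>Algebras\<close>

definition field_ring :: "'a::field ring" where
  "field_ring = \<lparr>carrier = UNIV, mult = (*), one = 1, zero = 0, add = (+)\<rparr>"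

definition left_ideal :: "('b, 'm) ring_scheme \<Rightarrow> 'b set \<Rightarrow> bool" where
  "left_ideal R I \<longleftrightarrow> additive_subgroup I R \<and> (\<forall>r\<in>carrier R. \<forall>x\<in>I. r \<otimes>\<^bsub>R\<^esub> x \<in> I)"

text \<open>The left regular module is semisimple: every submodule is a direct summand.\<close>

definition semisimple_ring :: "('b, 'm) ring_scheme \<Rightarrow> bool" where
  "semisimple_ring R \<longleftrightarrow> ring R \<and>
     (\<forall>I. left_ideal R I \<longrightarrow>
       (\<exists>I'. left_ideal R I' \<and> I \<inter> I' = {\<zero>\<^bsub>R\<^esub>} \<and> I <+>\<^bsub>R\<^esub> I' = carrier R))"

definition linear_combination ::
    "('a, 'b) module \<Rightarrow> 'i set \<Rightarrow> ('i \<Rightarrow> 'b) \<Rightarrow> ('i \<Rightarrow> 'a) \<Rightarrow> 'b" where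
  "linear_combination M A b c = (\<Oplus>\<^bsub>M\<^esub>i\<in>A. c i \<odot>\<^bsub>M\<^esub> b i)"

text \<open>Coefficient families indexed by \<open>A\<close> are the functions vanishing outside \<open>A\<close>.\<close>

definition is_basis :: "('a::zero, 'b) module \<Rightarrow> 'i set \<Rightarrow> ('i \<Rightarrow> 'b) \<Rightarrow> bool" where
  "is_basis M A b \<longleftrightarrow> finite A \<and> b ` A \<subseteq> carrier M \<and>
     (\<forall>v\<in>carrier M. \<exists>!c. (\<forall>i. i \<notin> A \<longrightarrow> c i = 0) \<and> v = linear_combination M A b c)"

text \<open>
  The algebra with basis \<open>(e\<^sub>i)\<close>, \<open>i \<in> A\<close>, and \<open>e\<^sub>i e\<^sub>j = \<delta>\<^bsub>ij\<^esub> c\<^sub>i e\<^sub>i\<close>; an element is its family of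
  coefficients. The stated unit is one when all \<open>c\<^sub>i\<close> are invertible.
\<close>

definition generalised_matrix_algebra :: "'i set \<Rightarrow> ('i \<Rightarrow> 'a::field) \<Rightarrow> ('a, 'i \<Rightarrow> 'a) module" where
  "generalised_matrix_algebra A c =
     \<lparr>carrier = {f. \<forall>i. i \<notin> A \<longrightarrow> f i = 0},
      mult = (\<lambda>f g i. c i * f i * g i),
      one = (\<lambda>i. if i \<in> A then inverse (c i) else 0),
      zero = (\<lambda>i. 0),
      add = (\<lambda>f g i. f i + g i),
      smult = (\<lambda>a f i. a * f i)\<rparr>"

definition algebra_iso :: "('a, 'm) ring_scheme \<Rightarrow> ('a, 'b) module \<Rightarrow> ('a, 'c) module \<Rightarrow> ('b \<Rightarrow> 'c) set" where
  "algebra_iso K A B =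
     {\<phi> \<in> ring_iso A B. \<forall>a\<in>carrier K. \<forall>x\<in>carrier A. \<phi> (a \<odot>\<^bsub>A\<^esub> x) = a \<odot>\<^bsub>B\<^esub> \<phi> x}"

definition complete_orthogonal_idempotents :: "('b, 'm) ring_scheme \<Rightarrow> 'i set \<Rightarrow> ('i \<Rightarrow> 'b) \<Rightarrow> bool" where
  "complete_orthogonal_idempotents R A u \<longleftrightarrow> finite A \<and>
     (\<forall>i\<in>A. u i \<in> carrier R \<and> u i \<noteq> \<zero>\<^bsub>R\<^esub>) \<and>
     (\<forall>i\<in>A. \<forall>j\<in>A. u i \<otimes>\<^bsub>R\<^esub> u j = (if i = j then u i else \<zero>\<^bsub>R\<^esub>)) \<and>
     (\<Oplus>\<^bsub>R\<^esub>i\<in>A. u i) = \<one>\<^bsub>R\<^esub>"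

end

theory Submission
  imports Defs
begin

text \<open>
Every operator in the statement is diagonal in the Bethe vectors, and the theorem follows once the
eigenvalues are known. Write \<open>t\<^sub>i = T\<^bsub>N+1-i\<^esub>\<close> and \<open>P(x) = \<Prod>\<^sub>i (x - t\<^sub>i)\<close>; the Bethe roots are the
solutions of \<open>P(y) = (-1)\<^bsup>n-1\<^esup> q\<close>. They exist and are distinct because they lift the simple
roots \<open>t\<^sub>j\<close> of \<open>P\<close> (\<open>root_system_bethe_root\<close>).

The coordinate of the Bethe vector of \<open>y\<^sub>\<alpha>\<close> at sites \<open>j\<^sub>1 < \<dots> < j\<^sub>n\<close> is the determinant of the values
\<open>\<psi>\<^sub>j(y)\<close>, \<open>\<psi>\<^sub>j(x) = \<Prod>\<^bsub>m>j\<^esub> (x - t\<^sub>m)\<close>, divided by the Vandermonde determinant of \<open>y\<^sub>\<alpha>\<close>. Since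
\<open>x \<psi>\<^sub>j = t\<^sub>j \<psi>\<^sub>j + \<psi>\<^bsub>j-1\<^esub>\<close>, multiplying each column by \<open>1 + x y\<close> lets every particle stay on its site
with weight \<open>1 + x t\<^sub>j\<close> or hop to the left neighbour with weight \<open>x\<close>; the terms in which two particles
meet have two equal rows. On shell \<open>\<psi>\<^sub>0 = (-1)\<^bsup>n-1\<^esup> q \<psi>\<^sub>N\<close>, so a particle that leaves at one end comes
back at the other end with weight \<open>q\<close>. This is how \<open>E(x)\<close> acts on coordinates, so it multiplies the
Bethe vector by \<open>\<Prod> (1 + x y)\<close> over the roots \<open>y\<close> in \<open>y\<^sub>\<alpha>\<close> (\<open>E_op_determinant_state\<close>).

Hence \<open>E\<^sub>r\<close> acts by the elementary symmetric polynomial \<open>e\<^sub>r(y\<^sub>\<alpha>)\<close>, and \<open>S\<^sub>\<lambda>\<close> by the Schur polynomial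
(\<open>dual_jacobi_trudi\<close>). Expanding the factorial powers \<open>(x|t)\<^sup>r\<close> in powers of \<open>x\<close> and applying the
Cauchy-Binet formula turns the alternating sum in the definition of the modified operators into the
factorial Schur function: they act by \<open>s\<^sub>\<lambda>(y\<^sub>\<alpha>|t)\<close> (\<open>S_tilde_eigenvector\<close>).

The product of the Bethe vectors of \<open>\<alpha>\<close> and \<open>\<beta>\<close> is thus the second one, multiplied by the sum over
\<open>\<lambda>\<close> of \<open>s\<^sub>\<mu>(y\<^sub>\<alpha>|T) s\<^sub>\<lambda>(y\<^sub>\<beta>|t)\<close>, where \<open>\<mu>\<close> is the dual partition of \<open>\<lambda>\<close>. By the Cauchy-Binet formula again, this sum is a
determinant in the divided differences \<open>(P(u) - P(w)) / (u - w)\<close> over the Vandermonde determinants.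
At two roots the divided difference is 0 if they differ and \<open>P'(u)\<close> if they agree, which leaves
\<open>\<delta>\<^bsub>\<alpha>\<beta>\<^esub>\<close> times the product \<open>e(y\<^sub>\<alpha>)\<close> (\<open>on_shell_orthogonality\<close>). The same identity says that two square
matrices are inverse to each other up to a diagonal factor, so the Bethe vectors form a basis, and
the whole algebra structure is carried over from the generalised matrix algebra.
\<close>

section \<open>Determinants of functions on index pairs\<close>

abbreviation det_of :: "nat \<Rightarrow> (nat \<Rightarrow> nat \<Rightarrow> 'a::comm_ring_1) \<Rightarrow> 'a" where
  "det_of n f \<equiv> det (mat n n (\<lambda>(i, j). f i j))"

lemma det_of_leibniz:
  "det_of n f = (\<Sum>p | p permutes {0..<n}. of_int (sign p) * (\<Prod>i=0..<n. f i (p i)))"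
proof -
  have "(\<Prod>i=0..<n. mat n n (\<lambda>(i, j). f i j) $$ (i, p i)) = (\<Prod>i=0..<n. f i (p i))"
    if "p permutes {0..<n}" for p
    by (rule prod.cong[OF refl]) (use permutes_in_image[OF that] in auto)
  then show ?thesis by (subst det_def'[of _ n]) auto
qed

lemma det_of_leibniz_columns:
  "det_of n f = (\<Sum>p | p permutes {0..<n}. of_int (sign p) * (\<Prod>j=0..<n. f (p j) j))"
proof -
  have "(\<Prod>j<n. mat n n (\<lambda>(i, j). f i j) $$ (p j, j)) = (\<Prod>j=0..<n. f (p j) j)"
    if "p permutes {0..<n}" for p
    unfolding lessThan_atLeast0
    by (rule prod.cong[OF refl]) (use permutes_in_image[OF that] in auto)
  then show ?thesis by (subst det_col[of _ n]) auto
qed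

lemma det_of_cong: "(\<And>i j. i < n \<Longrightarrow> j < n \<Longrightarrow> f i j = g i j) \<Longrightarrow> det_of n f = det_of n g"
  by (rule arg_cong[of _ _ det], rule eq_matI) auto

lemma det_of_transpose: "det_of n (\<lambda>i j. f j i) = det_of n f"
  by (subst det_of_leibniz, subst det_of_leibniz_columns) simp

lemma det_of_identical_rows:
  assumes "i < n" "j < n" "i \<noteq> j" "\<And>c. c < n \<Longrightarrow> f i c = f j c"
  shows "det_of n f = 0"
  by (rule det_identical_rows[of _ n i j]) (use assms in \<open>auto intro!: eq_vecI\<close>)

lemma det_of_permute_rows:
  assumes "p permutes {0..<n}"
  shows "det_of n (\<lambda>i j. f (p i) j) = of_int (sign p) * det_of n f"
proof -
  have "det_of n (\<lambda>i j. f (p i) j) = det (mat n n (\<lambda>(i, j). mat n n (\<lambda>(i, j). f i j) $$ (p i, j)))"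
    by (rule det_of_cong) (use permutes_in_image[OF assms] in auto)
  then show ?thesis using det_permute_rows[OF _ assms, of "mat n n (\<lambda>(i, j). f i j)"] by simp
qed

lemma det_of_scale_rows: "det_of n (\<lambda>i j. c i * f i j) = (\<Prod>i=0..<n. c i) * det_of n f"
  unfolding det_of_leibniz by (simp add: prod.distrib sum_distrib_left ac_simps)

lemma det_of_scale_columns: "det_of n (\<lambda>i j. c j * f i j) = (\<Prod>i=0..<n. c i) * det_of n f"
  unfolding det_of_leibniz_columns by (simp add: prod.distrib sum_distrib_left ac_simps)

text \<open>
Multilinearity: each row picks its summand \<open>f i\<close> independently.
\<close>

lemma det_of_sum_rows:
  assumes "finite S"
  shows "det_of n (\<lambda>i j. \<Sum>r\<in>S. A i r * B r j) =
    (\<Sum>f\<in>{0..<n} \<rightarrow>\<^sub>E S. (\<Prod>i=0..<n. A i (f i)) * det_of n (\<lambda>i j. B (f i) j))"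
proof -
  have "det_of n (\<lambda>i j. \<Sum>r\<in>S. A i r * B r j) =
    (\<Sum>p | p permutes {0..<n}. \<Sum>f\<in>{0..<n} \<rightarrow>\<^sub>E S.
      of_int (sign p) * (\<Prod>i=0..<n. A i (f i) * B (f i) (p i)))"
    unfolding det_of_leibniz
    by (subst prod_sum_PiE) (use assms in \<open>auto simp: sum_distrib_left\<close>)
  then show ?thesis
    unfolding det_of_leibniz by (subst (asm) sum.swap) (simp add: prod.distrib sum_distrib_left ac_simps)
qed

section \<open>Partitions in a box and the Cauchy-Binet formula\<close>

text \<open>
The strictly decreasing sequence \<open>\<lambda> + \<delta>\<close>, the row exponents of the alternant of \<open>\<lambda>\<close>. Indices start at 0.
\<close>

definition exponent :: "nat list \<Rightarrow> nat \<Rightarrow> nat" where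
  "exponent l i = l ! i + length l - Suc i"

lemma finite_box_partitions: "finite (box_partitions n k)"
proof (rule finite_subset)
  show "box_partitions n k \<subseteq> {l. set l \<subseteq> {..k} \<and> length l = n}"
    by (auto simp: box_partitions_def)
qed (simp add: finite_lists_length_eq)

lemma box_partitions_nth:
  assumes "l \<in> box_partitions n k"
  shows "length l = n" "i < n \<Longrightarrow> l ! i \<le> k" "i \<le> j \<Longrightarrow> j < n \<Longrightarrow> l ! j \<le> l ! i"
  using assms sorted_wrt_nth_less[of "(\<ge>)" l i j]
  by (auto simp: box_partitions_def le_less)

lemma exponent_less:
  assumes "l \<in> box_partitions n k" "i < j" "j < n"
  shows "exponent l j < exponent l i"
  using box_partitions_nth(1)[OF assms(1)] box_partitions_nth(3)[OF assms(1), of i j] assms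
  by (simp add: exponent_def)

lemma inj_on_exponent: "l \<in> box_partitions n k \<Longrightarrow> inj_on (exponent l) {0..<n}"
  by (rule linorder_inj_onI') (metis atLeastLessThan_iff exponent_less less_irrefl)

lemma exponent_less_length:
  assumes "l \<in> box_partitions n (N - n)" "n \<le> N" "i < n"
  shows "exponent l i < N"
  using box_partitions_nth(1)[OF assms(1)] box_partitions_nth(2)[OF assms(1,3)] assms(2,3)
  by (simp add: exponent_def)

lemma strict_sorted_nth_add:
  "sorted_wrt (<) (ys :: nat list) \<Longrightarrow> j + d < length ys \<Longrightarrow> ys ! j + d \<le> ys ! (j + d)"
proof (induction d)
  case (Suc d)
  have "ys ! (j + d) < ys ! (j + Suc d)"
    by (rule sorted_wrt_nth_less[OF Suc.prems(1)]) (use Suc in auto)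
  then show ?case using Suc by auto
qed simp

lemma sorted_list_of_exponents:
  assumes "l \<in> box_partitions n k"
  shows "sorted_list_of_set (exponent l ` {0..<n}) = rev (map (exponent l) [0..<n])"
proof -
  have "sorted_wrt (<) (rev (map (exponent l) [0..<n]))"
    using exponent_less[OF assms] by (auto simp: sorted_wrt_iff_nth_less rev_nth)
  then show ?thesis
    using sorted_list_of_set_unique[of "exponent l ` {0..<n}" "rev (map (exponent l) [0..<n])"]
    by (simp add: card_image[OF inj_on_exponent[OF assms]])
qed

text \<open>
Sorting an \<open>n\<close>-subset decreasingly and subtracting the staircase recovers the partition. All sums over
minors below are therefore sums over partitions in the box.
\<close>

lemma bij_betw_exponents:
  assumes "n \<le> N"
  shows "bij_betw (\<lambda>l. exponent l ` {0..<n}) (box_partitions n (N - n)) {R. R \<subseteq> {0..<N} \<and> card R = n}"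
proof (rule bij_betw_imageI)
  show "inj_on (\<lambda>l. exponent l ` {0..<n}) (box_partitions n (N - n))"
  proof (rule inj_onI)
    fix l m assume l: "l \<in> box_partitions n (N - n)" and m: "m \<in> box_partitions n (N - n)"
      and "exponent l ` {0..<n} = exponent m ` {0..<n}"
    then have "map (exponent l) [0..<n] = map (exponent m) [0..<n]"
      using sorted_list_of_exponents[OF l] sorted_list_of_exponents[OF m] by (metis rev_rev_ident)
    then have "exponent l i = exponent m i" if "i < n" for i using that by (simp add: map_eq_conv)
    then have "l ! i = m ! i" if "i < n" for i
      using box_partitions_nth(1)[OF l] box_partitions_nth(1)[OF m] that
      unfolding exponent_def by (metis Suc_leI add_diff_assoc add_right_cancel)
    then show "l = m"
      using box_partitions_nth(1)[OF l] box_partitions_nth(1)[OF m] by (simp add: list_eq_iff_nth_eq)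
  qed
  show "(\<lambda>l. exponent l ` {0..<n}) ` box_partitions n (N - n) = {R. R \<subseteq> {0..<N} \<and> card R = n}"
  proof (intro equalityI subsetI)
    fix R assume "R \<in> (\<lambda>l. exponent l ` {0..<n}) ` box_partitions n (N - n)"
    then obtain l where l: "l \<in> box_partitions n (N - n)" and R: "R = exponent l ` {0..<n}" by auto
    note exponent_less_length[OF l assms]
    then show "R \<in> {R. R \<subseteq> {0..<N} \<and> card R = n}"
      unfolding R using card_image[OF inj_on_exponent[OF l]] by auto
  next
    fix R :: "nat set" assume "R \<in> {R. R \<subseteq> {0..<N} \<and> card R = n}"
    then have R: "R \<subseteq> {0..<N}" "card R = n" by auto
    then have fin: "finite R" using finite_subset by blast
    define ys where "ys = sorted_list_of_set R"
    have ys: "sorted_wrt (<) ys" "length ys = n" "set ys = R"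
      unfolding ys_def using fin R by auto
    have step: "ys ! j + d \<le> ys ! (j + d)" if "j + d < n" for j d
      using strict_sorted_nth_add[OF ys(1)] ys(2) that by simp
    have lower: "j \<le> ys ! j" if "j < n" for j using step[of 0 j] that by simp
    have upper: "ys ! j + n \<le> N + j" if "j < n" for j
    proof -
      have "ys ! (n - 1) \<in> R" using ys(2,3) that nth_mem[of "n - 1" ys] by simp
      then have "ys ! (n - 1) < N" using R(1) by auto
      then show ?thesis using step[of j "n - 1 - j"] that by simp
    qed
    define l where "l = map (\<lambda>i. ys ! (n - Suc i) - (n - Suc i)) [0..<n]"
    have l_nth: "l ! i = ys ! (n - Suc i) - (n - Suc i)" if "i < n" for i
      using that by (simp add: l_def)
    have "sorted_wrt (\<ge>) l"
      unfolding sorted_wrt_iff_nth_less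
    proof (intro allI impI)
      fix i j assume ij: "i < j" "j < length l"
      then have "ys ! (n - Suc j) + (j - i) \<le> ys ! (n - Suc i)"
        using step[of "n - Suc j" "j - i"] by (simp add: l_def)
      then show "l ! j \<le> l ! i" using ij by (simp add: l_def)
    qed
    moreover have "a \<le> N - n" if "a \<in> set l" for a
    proof -
      obtain i where i: "i < n" "a = ys ! (n - Suc i) - (n - Suc i)"
        using \<open>a \<in> set l\<close> by (auto simp: l_def)
      then show ?thesis using upper[of "n - Suc i"] by linarith
    qed
    ultimately have l: "l \<in> box_partitions n (N - n)" by (simp add: box_partitions_def l_def)
    have "exponent l i = ys ! (n - Suc i)" if "i < n" for i
      using lower[of "n - Suc i"] that unfolding exponent_def l_nth[OF that] by (simp add: l_def)
    then have "exponent l ` {0..<n} = (\<lambda>i. ys ! (n - Suc i)) ` {0..<n}" by auto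
    also have "\<dots> = (!) ys ` ((\<lambda>i. n - Suc i) ` {0..<n})" by (simp add: image_image)
    also have "(\<lambda>i. n - Suc i) ` {0..<n} = {0..<n}"
    proof (intro equalityI subsetI)
      fix x assume "x \<in> {0..<n}"
      then show "x \<in> (\<lambda>i. n - Suc i) ` {0..<n}" by (intro image_eqI[of _ _ "n - Suc x"]) auto
    qed auto
    also have "(!) ys ` {0..<n} = R" using ys nth_image[of n ys] by simp
    finally show "R \<in> (\<lambda>l. exponent l ` {0..<n}) ` box_partitions n (N - n)" using l by blast
  qed
qed

text \<open>
In the multilinear expansion of the left-hand side only injective selections of summands contribute.
An injective selection is a subset, that is a partition in the box, together with an ordering of it;
the orderings, with their signs, assemble the first determinant.
\<close>

lemma cauchy_binet:
  assumes "n \<le> N"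
  shows "det_of n (\<lambda>i j. \<Sum>r<N. A i r * B r j) =
    (\<Sum>l\<in>box_partitions n (N - n).
      det_of n (\<lambda>i j. A i (exponent l j)) * det_of n (\<lambda>i j. B (exponent l i) j))"
proof -
  let ?X = "box_partitions n (N - n)" and ?P = "{p. p permutes {0..<n}}"
  let ?F = "{0..<n} \<rightarrow>\<^sub>E {..<N}"
  define t where "t f = (\<Prod>i=0..<n. A i (f i)) * det_of n (\<lambda>i j. B (f i) j)" for f
  define h where "h = (\<lambda>(l, p). restrict (exponent l \<circ> p) {0..<n})"
  have "det_of n (\<lambda>i j. \<Sum>r<N. A i r * B r j) = sum t ?F"
    unfolding t_def by (rule det_of_sum_rows) simp
  also have "\<dots> = sum t {f \<in> ?F. inj_on f {0..<n}}"
  proof (rule sum.mono_neutral_right)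
    show "finite ?F" by (simp add: finite_PiE)
    show "\<forall>f\<in>?F - {f \<in> ?F. inj_on f {0..<n}}. t f = 0"
    proof
      fix f assume "f \<in> ?F - {f \<in> ?F. inj_on f {0..<n}}"
      then obtain i j where "i < n" "j < n" "i \<noteq> j" "f i = f j" by (auto simp: inj_on_def)
      then have "det_of n (\<lambda>i j. B (f i) j) = 0" by (intro det_of_identical_rows[of i n j]) auto
      then show "t f = 0" by (simp add: t_def)
    qed
  qed auto
  also have "\<dots> = sum (t \<circ> h) (?X \<times> ?P)"
  proof (rule sum.reindex_cong[of h])
    show "inj_on h (?X \<times> ?P)"
    proof (rule inj_onI)
      fix x y assume xy: "x \<in> ?X \<times> ?P" "y \<in> ?X \<times> ?P" "h x = h y"
      obtain l p m q where x: "x = (l, p)" and y: "y = (m, q)" by (cases x, cases y)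
      have l: "l \<in> ?X" "p permutes {0..<n}" and m: "m \<in> ?X" "q permutes {0..<n}" using xy x y by auto
      have eq: "exponent l (p i) = exponent m (q i)" if "i < n" for i
        using fun_cong[OF xy(3), of i] that by (simp add: x y h_def)
      have "exponent l ` {0..<n} = (\<lambda>i. exponent l (p i)) ` {0..<n}"
        using permutes_image[OF l(2)] by (metis image_image)
      also have "\<dots> = (\<lambda>i. exponent m (q i)) ` {0..<n}" using eq by auto
      also have "\<dots> = exponent m ` {0..<n}" using permutes_image[OF m(2)] by (metis image_image)
      finally have lm: "l = m"
        using bij_betw_imp_inj_on[OF bij_betw_exponents[OF assms]] l m by (auto dest: inj_onD)
      have "p i = q i" for i
      proof (cases "i < n")
        case True
        then show ?thesis
          using eq[OF True] inj_onD[OF inj_on_exponent[OF l(1)], of "p i" "q i"]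
            permutes_in_image[OF l(2), of i] permutes_in_image[OF m(2), of i] by (simp add: lm)
      next
        case False
        then show ?thesis using l(2) m(2) by (simp add: permutes_def)
      qed
      then show "x = y" using lm x y by auto
    qed
    show "{f \<in> ?F. inj_on f {0..<n}} = h ` (?X \<times> ?P)"
    proof (intro equalityI subsetI)
      fix f assume f: "f \<in> {f \<in> ?F. inj_on f {0..<n}}"
      then have "f ` {0..<n} \<in> {R. R \<subseteq> {0..<N} \<and> card R = n}" by (auto simp: card_image)
      then have "f ` {0..<n} \<in> (\<lambda>l. exponent l ` {0..<n}) ` ?X"
        using bij_betw_imp_surj_on[OF bij_betw_exponents[OF assms]] by (simp only:)
      then obtain l where l: "l \<in> ?X" and img: "f ` {0..<n} = exponent l ` {0..<n}" by blast
      define g where "g = inv_into {0..<n} (exponent l)"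
      define p where "p i = (if i \<in> {0..<n} then g (f i) else i)" for i
      have el: "bij_betw (exponent l) {0..<n} (f ` {0..<n})"
        unfolding img by (rule inj_on_imp_bij_betw[OF inj_on_exponent[OF l]])
      have "bij_betw (g \<circ> f) {0..<n} {0..<n}"
        using f unfolding g_def
        by (intro bij_betw_trans[OF inj_on_imp_bij_betw bij_betw_inv_into[OF el]]) auto
      then have "bij_betw p {0..<n} {0..<n}"
        by (rule bij_betw_cong[THEN iffD1, rotated]) (simp add: p_def)
      then have p: "p permutes {0..<n}" by (rule bij_imp_permutes) (simp add: p_def)
      have "exponent l (p i) = f i" if "i < n" for i
        using that bij_betw_inv_into_right[OF el, of "f i"] by (simp add: p_def g_def)
      then have "f = h (l, p)" using f by (auto simp: h_def fun_eq_iff restrict_def PiE_def extensional_def)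
      then show "f \<in> h ` (?X \<times> ?P)" using l p by blast
    next
      fix f assume "f \<in> h ` (?X \<times> ?P)"
      then obtain l p where l: "l \<in> ?X" and p: "p permutes {0..<n}" and f: "f = h (l, p)" by auto
      have "f \<in> ?F" using exponent_less_length[OF l assms] permutes_in_image[OF p] by (simp add: f h_def PiE_iff)
      moreover have "inj_on f {0..<n}"
        unfolding f h_def prod.case inj_on_restrict_eq
        by (rule comp_inj_on[OF permutes_inj_on[OF p]]) (simp only: permutes_image[OF p] inj_on_exponent[OF l])
      ultimately show "f \<in> {f \<in> ?F. inj_on f {0..<n}}" by simp
    qed
  qed simp
  also have "\<dots> = (\<Sum>l\<in>?X. \<Sum>p\<in>?P. t (h (l, p)))" by (simp add: sum.cartesian_product)
  also have "\<dots> = (\<Sum>l\<in>?X. det_of n (\<lambda>i j. A i (exponent l j)) * det_of n (\<lambda>i j. B (exponent l i) j))"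
  proof (rule sum.cong[OF refl])
    fix l assume l: "l \<in> ?X"
    have "t (h (l, p)) = of_int (sign p) * (\<Prod>i=0..<n. A i (exponent l (p i))) *
      det_of n (\<lambda>i j. B (exponent l i) j)" if p: "p permutes {0..<n}" for p
    proof -
      have "det_of n (\<lambda>i j. B (h (l, p) i) j) = det_of n (\<lambda>i j. B (exponent l (p i)) j)"
        by (rule det_of_cong) (simp add: h_def)
      also have "\<dots> = of_int (sign p) * det_of n (\<lambda>i j. B (exponent l i) j)"
        by (rule det_of_permute_rows[OF p])
      finally show ?thesis by (simp add: t_def h_def)
    qed
    then show "(\<Sum>p\<in>?P. t (h (l, p))) =
      det_of n (\<lambda>i j. A i (exponent l j)) * det_of n (\<lambda>i j. B (exponent l i) j)"
      by (simp add: det_of_leibniz[of n "\<lambda>i j. A i (exponent l j)"] sum_distrib_right)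
  qed
  finally show ?thesis .
qed

section \<open>Block matrices, alternants and factorial powers\<close>

lemma sum_permutes_Suc:
  "(\<Sum>p | p permutes {1..k}. of_int (sign p) * (\<Prod>i=1..k. f i (p i))) = det_of k (\<lambda>i j. f (Suc i) (Suc j))"
proof -
  let ?S = "map_permutation {0..<k} Suc" and ?P = "map_permutation {1..k} (\<lambda>i. i - 1)"
  have S: "bij_betw Suc {0..<k} {1..k}" by (rule bij_betw_imageI) (auto simp: image_Suc_atLeastLessThan)
  have P: "bij_betw (\<lambda>i. i - 1) {1..k} {0..<k}"
    by (rule bij_betwI[of _ _ _ Suc]) auto
  show ?thesis
    unfolding det_of_leibniz
  proof (rule sum.reindex_bij_witness[of _ ?S ?P])
    fix p assume "p \<in> {p. p permutes {1..k}}"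
    then have p: "p permutes {1..k}" by simp
    have "?S (?P p) = map_permutation {1..k} (\<lambda>i. i) p"
      unfolding map_permutation_compose[OF P inj_on_subset[OF inj_Suc subset_UNIV]]
      by (rule map_permutation_cong) (use p in \<open>auto simp: inj_on_def\<close>)
    then show "?S (?P p) = p" using p by simp
    show "?P p \<in> {p. p permutes {0..<k}}" using map_permutation_permutes[OF P p] by simp
    have "?P p i = p (Suc i) - 1" if "i < k" for i
      using map_permutation_apply[OF bij_betw_imp_inj_on[OF P], of "Suc i" p] that by simp
    moreover have "Suc (p (Suc i) - 1) = p (Suc i)" if "i < k" for i
      using permutes_in_image[OF p, of "Suc i"] that by simp
    ultimately have "(\<Prod>i=0..<k. f (Suc i) (Suc (?P p i))) = (\<Prod>i=0..<k. f (Suc i) (p (Suc i)))" by simp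
    also have "\<dots> = (\<Prod>i=1..k. f i (p i))"
      by (simp add: prod.atLeast_Suc_atMost_Suc_shift prod.atLeast1_atMost_eq lessThan_atLeast0)
    finally show "of_int (sign (?P p)) * (\<Prod>i=0..<k. f (Suc i) (Suc (?P p i))) =
      of_int (sign p) * (\<Prod>i=1..k. f i (p i))"
      by (simp only: sign_map_permutation[OF bij_betw_imp_inj_on[OF P] p] finite_atLeastAtMost)
  next
    fix p assume "p \<in> {p. p permutes {0..<k}}"
    then have p: "p permutes {0..<k}" by simp
    have "?P (?S p) = map_permutation {0..<k} (\<lambda>i. i) p"
      unfolding map_permutation_compose[OF S bij_betw_imp_inj_on[OF P]]
      by (rule map_permutation_cong) (use p in \<open>auto simp: inj_on_def\<close>)
    then show "?P (?S p) = p" using p by simp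
    show "?S p \<in> {p. p permutes {1..k}}" using map_permutation_permutes[OF S p] by simp
  qed
qed

lemma det_of_block_lower:
  fixes f :: "nat \<Rightarrow> nat \<Rightarrow> 'a::idom"
  assumes "\<And>i j. i < k \<Longrightarrow> k \<le> j \<Longrightarrow> j < k + n \<Longrightarrow> f i j = 0"
  shows "det_of (k + n) f = det_of k f * det_of n (\<lambda>i j. f (k + i) (k + j))"
proof -
  have "mat (k + n) (k + n) (\<lambda>(i, j). f i j) =
    four_block_mat (mat k k (\<lambda>(i, j). f i j)) (0\<^sub>m k n)
      (mat n k (\<lambda>(i, j). f (k + i) j)) (mat n n (\<lambda>(i, j). f (k + i) (k + j)))"
    by (rule eq_matI) (use assms in auto)
  also have "det \<dots> = det_of k f * det_of n (\<lambda>i j. f (k + i) (k + j))"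
    by (rule det_four_block_mat_upper_right_zero) auto
  finally show ?thesis .
qed

lemma det_of_block_upper:
  fixes f :: "nat \<Rightarrow> nat \<Rightarrow> 'a::idom"
  assumes "\<And>i j. j < k \<Longrightarrow> k \<le> i \<Longrightarrow> i < k + n \<Longrightarrow> f i j = 0"
  shows "det_of (k + n) f = det_of k f * det_of n (\<lambda>i j. f (k + i) (k + j))"
  using det_of_block_lower[of k n "\<lambda>i j. f j i"] assms
  by (simp add: det_of_transpose[of _ f] det_of_transpose[of _ "\<lambda>i j. f (k + i) (k + j)"])

lemma det_of_lower_triangular:
  assumes "\<And>i j. i < j \<Longrightarrow> j < n \<Longrightarrow> f i j = 0"
  shows "det_of n f = (\<Prod>i=0..<n. f i i)"
  by (subst det_lower_triangular[of n]) (use assms in \<open>auto simp: prod_list_diag_prod\<close>)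

lemma det_of_upper_triangular:
  assumes "\<And>i j. j < i \<Longrightarrow> i < n \<Longrightarrow> f i j = 0"
  shows "det_of n f = (\<Prod>i=0..<n. f i i)"
  using det_of_lower_triangular[of n "\<lambda>i j. f j i"] assms by (simp add: det_of_transpose[of _ f])

lemma det_of_mult:
  "det_of n (\<lambda>i j. \<Sum>r<n. A i r * B r j) = det_of n A * det_of n B"
proof -
  have "mat n n (\<lambda>(i, j). A i j) * mat n n (\<lambda>(i, j). B i j) = mat n n (\<lambda>(i, j). \<Sum>r<n. A i r * B r j)"
    by (rule eq_matI) (auto simp: scalar_prod_def lessThan_atLeast0 intro: sum.cong)
  then show ?thesis using det_mult[of "mat n n (\<lambda>(i, j). A i j)" n "mat n n (\<lambda>(i, j). B i j)"] by simp
qed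

text \<open>
Choosing from each factor \<open>x - a\<^sub>i\<close> either term gives elementary symmetric polynomials. The sum runs to a
common bound \<open>N\<close> so that it is the matrix product in \<open>cauchy_binet\<close>; the excess terms vanish.
\<close>

lemma factorial_power_expand:
  fixes x :: "'a::comm_ring_1"
  assumes "r < N"
  shows "factorial_power x a r =
    (\<Sum>s<N. (- 1) ^ (r + s) * elem_sym (int r - int s) r a * x ^ s)"
proof -
  have "factorial_power x a r =
    (\<Sum>X\<in>Pow {1..r}. (- 1) ^ card X * (\<Prod>i\<in>X. a i) * (\<Prod>i\<in>{1..r} - X. x))"
    unfolding factorial_power_def by (rule prod_diff_conv_sum) simp
  also have "\<dots> = (\<Sum>X\<in>Pow {1..r}. (- 1) ^ card X * (\<Prod>i\<in>X. a i) * x ^ (r - card X))"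
    by (rule sum.cong) (auto simp: card_Diff_subset finite_subset)
  also have "\<dots> = (\<Sum>s<N. \<Sum>X | X \<in> Pow {1..r} \<and> r - card X = s.
      (- 1) ^ card X * (\<Prod>i\<in>X. a i) * x ^ (r - card X))"
    by (rule sum.group[symmetric]) (use assms in auto)
  also have "\<dots> = (\<Sum>s<N. (- 1) ^ (r + s) * elem_sym (int r - int s) r a * x ^ s)"
  proof (rule sum.cong[OF refl])
    fix s
    have card: "card X \<le> r" if "X \<subseteq> {1..r}" for X using card_mono[OF _ that] by simp
    have "(\<Sum>X | X \<in> Pow {1..r} \<and> r - card X = s. (- 1) ^ card X * (\<Prod>i\<in>X. a i) * x ^ (r - card X)) =
      (\<Sum>X | X \<subseteq> {1..r} \<and> int (card X) = int r - int s. (- 1) ^ (r + s) * x ^ s * (\<Prod>i\<in>X. a i))"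
    proof (rule sum.cong)
      show "{X. X \<in> Pow {1..r} \<and> r - card X = s} = {X. X \<subseteq> {1..r} \<and> int (card X) = int r - int s}"
        using card by force
      fix X assume "X \<in> {X. X \<subseteq> {1..r} \<and> int (card X) = int r - int s}"
      then have r: "r = card X + s" by auto
      have "(- 1) ^ (r + s) = ((- 1) ^ card X :: 'a)" by (simp add: r minus_one_power_iff)
      then show "(- 1) ^ card X * (\<Prod>i\<in>X. a i) * x ^ (r - card X) = (- 1) ^ (r + s) * x ^ s * (\<Prod>i\<in>X. a i)"
        by (simp add: r)
    qed
    then show "(\<Sum>X | X \<in> Pow {1..r} \<and> r - card X = s. (- 1) ^ card X * (\<Prod>i\<in>X. a i) * x ^ (r - card X)) =
      (- 1) ^ (r + s) * elem_sym (int r - int s) r a * x ^ s"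
      by (simp add: elem_sym_def sum_distrib_left sum_distrib_right ac_simps)
  qed
  finally show ?thesis .
qed

lemma elem_sym_neg: "r < 0 \<Longrightarrow> elem_sym r m a = 0"
  by (auto simp: elem_sym_def intro!: sum.neutral)

lemma elem_sym_0: "elem_sym 0 m a = 1"
proof -
  have "{A. A \<subseteq> {1..m} \<and> int (card A) = 0} = {{}}" using finite_subset by fastforce
  then show ?thesis by (simp add: elem_sym_def)
qed

text \<open>
The transition matrix from powers to factorial powers is lower unitriangular.
\<close>

lemma det_of_factorial_power:
  "det_of n (\<lambda>i j. factorial_power (x j) a i) = det_of n (\<lambda>i j. x j ^ i)"
proof -
  let ?C = "\<lambda>i s. (- 1) ^ (i + s) * elem_sym (int i - int s) i a"
  have "det_of n (\<lambda>i j. factorial_power (x j) a i) = det_of n (\<lambda>i j. \<Sum>s<n. ?C i s * x j ^ s)"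
    by (rule det_of_cong) (rule factorial_power_expand)
  also have "\<dots> = det_of n ?C * det_of n (\<lambda>i j. x j ^ i)" by (rule det_of_mult)
  also have "det_of n ?C = (\<Prod>i=0..<n. ?C i i)"
    by (rule det_of_lower_triangular) (simp add: elem_sym_neg)
  also have "\<dots> = 1" by (simp add: elem_sym_0 flip: mult_2)
  finally show ?thesis by simp
qed

text \<open>
As the alternant does not depend on the parameters of the factorial powers, the points \<open>x\<^sub>i\<close> themselves
may be taken as parameters; this makes the matrix triangular.
\<close>

lemma vandermonde: "det_of n (\<lambda>i j. x j ^ i) = (\<Prod>i=0..<n. \<Prod>j=0..<i. x i - x j)"
proof -
  \<comment> \<open>Parameters are indexed from 1, points from 0.\<close>
  let ?a = "\<lambda>i. x (i - 1)"
  have shift: "factorial_power y ?a i = (\<Prod>j=0..<i. y - x j)" for y i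
    unfolding factorial_power_def
    by (rule prod.reindex_bij_witness[of _ Suc "\<lambda>i. i - 1"]) auto
  have "det_of n (\<lambda>i j. x j ^ i) = det_of n (\<lambda>i j. factorial_power (x j) ?a i)"
    by (rule det_of_factorial_power[symmetric])
  also have "\<dots> = (\<Prod>i=0..<n. factorial_power (x i) ?a i)"
    unfolding shift by (rule det_of_upper_triangular) (auto intro!: prod_zero)
  finally show ?thesis by (simp only: shift)
qed

definition reversal :: "nat \<Rightarrow> nat \<Rightarrow> nat" where
  "reversal n i = (if i < n then n - Suc i else i)"

lemma reversal_permutes: "reversal n permutes {0..<n}"
  by (rule bij_imp_permutes, rule bij_betwI[of _ _ _ "reversal n"]) (auto simp: reversal_def)

lemma det_of_reverse: "det_of n (\<lambda>i j. f (n - Suc i) j) = of_int (sign (reversal n)) * det_of n f"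
proof -
  have "det_of n (\<lambda>i j. f (n - Suc i) j) = det_of n (\<lambda>i j. f (reversal n i) j)"
    by (rule det_of_cong) (simp add: reversal_def)
  then show ?thesis using det_of_permute_rows[OF reversal_permutes] by simp
qed

lemma det_of_factorial_power_decreasing:
  "det_of n (\<lambda>i j. factorial_power (x j) a (n - Suc i)) = det_of n (\<lambda>i j. x j ^ (n - Suc i))"
  by (rule trans[OF det_of_reverse[of n "\<lambda>i j. factorial_power (x j) a i"]],
      rule trans[OF _ det_of_reverse[of n "\<lambda>i j. x j ^ i", symmetric]])
    (rule arg_cong[OF det_of_factorial_power])

lemma vandermonde_nonzero:
  fixes x :: "nat \<Rightarrow> 'a::idom"
  assumes "inj_on x {0..<n}"
  shows "det_of n (\<lambda>i j. x j ^ i) \<noteq> 0"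
proof -
  have "x i - x j \<noteq> 0" if "i < n" "j < i" for i j
    using inj_onD[OF assms, of i j] that by auto
  then show ?thesis unfolding vandermonde by simp
qed

section \<open>The dual Jacobi-Trudi identity\<close>

lemma less_conjugate_part_iff:
  assumes l: "l \<in> box_partitions n k" and j: "j < n"
  shows "j < conjugate_part l i \<longleftrightarrow> i \<le> l ! j"
proof -
  let ?S = "{j. j < n \<and> i \<le> l ! j}"
  have S: "conjugate_part l i = card ?S"
    by (simp add: conjugate_part_def box_partitions_nth(1)[OF l])
  have fin: "finite ?S" by simp
  show ?thesis
  proof
    assume "i \<le> l ! j"
    then have "{0..j} \<subseteq> ?S"
      using j box_partitions_nth(3)[OF l, of _ j] by (auto intro: order_trans)
    from card_mono[OF fin this] show "j < conjugate_part l i" by (simp add: S)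
  next
    assume less: "j < conjugate_part l i"
    show "i \<le> l ! j"
    proof (rule ccontr)
      assume "\<not> i \<le> l ! j"
      then have "?S \<subseteq> {0..<j}"
        using box_partitions_nth(3)[OF l, of j] by (auto simp: not_le) (metis le_less_trans not_le)
      from card_mono[OF _ this] show False using less by (simp add: S)
    qed
  qed
qed

lemma conjugate_part_le:
  assumes "l \<in> box_partitions n k"
  shows "conjugate_part l i \<le> n"
proof -
  have "{j. j < n \<and> i \<le> l ! j} \<subseteq> {0..<n}" by auto
  from card_mono[OF _ this] show ?thesis
    by (simp add: conjugate_part_def box_partitions_nth(1)[OF assms])
qed

lemma conjugate_part_antimono: "i \<le> i' \<Longrightarrow> conjugate_part l i' \<le> conjugate_part l i"
  unfolding conjugate_part_def by (rule card_mono) auto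

text \<open>
The numbers \<open>n + s - \<lambda>'\<^bsub>s+1\<^esub>\<close> for \<open>s < k\<close>, followed by the exponents of \<open>\<lambda>\<close>. Both lists together exhaust
\<open>{0..<k + n}\<close>: they label the horizontal and vertical steps of the border of \<open>\<lambda>\<close>.
\<close>

definition arrangement :: "nat \<Rightarrow> nat \<Rightarrow> nat list \<Rightarrow> nat \<Rightarrow> nat" where
  "arrangement n k l s =
     (if s < k then n + s - conjugate_part l (Suc s)
      else if s < k + n then exponent l (s - k) else s)"

text \<open>
Whether box \<open>(j, s)\<close> lies in the partition decides which of \<open>n + s - \<lambda>'\<^bsub>s+1\<^esub>\<close> and \<open>\<lambda>\<^sub>j + n - 1 - j\<close> is the
larger one, so the two lists are disjoint.
\<close>

lemma arrangement_permutes: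
  assumes l: "l \<in> box_partitions n k"
  shows "arrangement n k l permutes {0..<k + n}"
proof (rule bij_imp_permutes)
  let ?c = "arrangement n k l"
  have rest: "?c s = n + s - conjugate_part l (Suc s)" if "s < k" for s
    using that by (simp add: arrangement_def)
  have part: "?c (k + j) = l ! j + n - Suc j" if "j < n" for j
    using that by (simp add: arrangement_def exponent_def box_partitions_nth(1)[OF l])
  note le = conjugate_part_le[OF l]
  have less: "?c s < ?c s'" if "s < s'" "s' < k" for s s'
    using conjugate_part_antimono[of "Suc s" "Suc s'" l] le[of "Suc s"] le[of "Suc s'"] that by (simp add: rest)
  have less': "?c (k + j) < ?c (k + j')" if "j' < j" "j < n" for j j'
    using exponent_less[OF l that] that by (simp add: arrangement_def)
  have neq: "?c s \<noteq> ?c (k + j)" if "s < k" "j < n" for s j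
    using less_conjugate_part_iff[OF l that(2), of "Suc s"] le[of "Suc s"] that
    by (cases "Suc s \<le> l ! j") (auto simp: rest part)
  have inj: "?c s \<noteq> ?c s'" if "s < s'" "s' < k + n" for s s'
  proof -
    consider "s' < k" | "s < k" "k \<le> s'" | "k \<le> s" using that by linarith
    then show ?thesis
    proof cases
      case 1 then show ?thesis using less[OF that(1)] by simp
    next
      case 2 then show ?thesis using neq[of s "s' - k"] that by simp
    next
      case 3
      have "s - k < s' - k" by (rule diff_less_mono[OF that(1) 3])
      moreover have "s' - k < n" using that 3 by linarith
      ultimately show ?thesis using less'[of "s - k" "s' - k"] that 3 by simp
    qed
  qed
  have "inj_on ?c {0..<k + n}"
    by (rule linorder_inj_onI') (use inj in auto)
  moreover have "?c s < k + n" if "s < k + n" for s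
  proof (cases "s < k")
    case True
    then show ?thesis by (simp add: rest)
  next
    case False
    then have "s - k < n" "s = k + (s - k)" using that by linarith+
    then have "?c s = l ! (s - k) + n - Suc (s - k)" "l ! (s - k) \<le> k"
      using part[of "s - k"] box_partitions_nth(2)[OF l, of "s - k"] by simp_all
    then show ?thesis using \<open>s - k < n\<close> by linarith
  qed
  ultimately show "bij_betw ?c {0..<k + n} {0..<k + n}"
    by (intro bij_betw_imageI endo_inj_surj) auto
qed (simp add: arrangement_def)

text \<open>
Removing the last box of the last nonzero row exchanges a horizontal with an adjacent vertical step of
the border.
\<close>

lemma arrangement_remove_box:
  assumes l: "l \<in> box_partitions n k" and i: "i < n" "0 < l ! i" "\<And>j. i < j \<Longrightarrow> j < n \<Longrightarrow> l ! j = 0"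
  defines "m \<equiv> l[i := l ! i - 1]"
  shows "m \<in> box_partitions n k"
    "arrangement n k l = transpose (exponent l i - 1) (exponent l i) \<circ> arrangement n k m"
proof -
  let ?c = "arrangement n k l" and ?d = "arrangement n k m"
  have len: "length l = n" "length m = n" using box_partitions_nth(1)[OF l] by (simp_all add: m_def)
  have m_nth: "m ! j = (if j = i then l ! i - 1 else l ! j)" if "j < n" for j
    using that i len by (simp add: m_def)
  show m: "m \<in> box_partitions n k"
    unfolding box_partitions_def
  proof (intro CollectI conjI len ballI)
    show "sorted_wrt (\<ge>) m"
      unfolding sorted_wrt_iff_nth_less
    proof (intro allI impI)
      fix a b assume ab: "a < b" "b < length m"
      show "m ! b \<le> m ! a"
        using box_partitions_nth(3)[OF l, of a b] ab i(3)[of b] len by (auto simp: m_nth)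
    qed
    fix a assume "a \<in> set m"
    then obtain j where "j < n" "a = m ! j" using len by (metis in_set_conv_nth)
    then show "a \<le> k" using box_partitions_nth(2)[OF l] by (auto simp: m_nth intro: le_diff_conv[THEN iffD2] trans_le_add1)
  qed
  let ?a = "exponent l i - 1" and ?b = "exponent l i"
  \<comment> \<open>In \<open>l\<close>, row \<open>i\<close> has exponent \<open>?b\<close> and column \<open>l ! i\<close> has label \<open>?a\<close>; in \<open>m\<close> they are exchanged.\<close>
  have b: "?b = l ! i + n - Suc i" by (simp add: exponent_def len)
  have ci: "?c (k + i) = ?b" using i by (simp add: arrangement_def)
  have di: "?d (k + i) = ?a" using i by (simp add: arrangement_def exponent_def len m_nth)
  have neq: "?c s \<noteq> ?b" "?d s \<noteq> ?a" if "s \<noteq> k + i" for s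
    using inj_eq[OF permutes_inj[OF arrangement_permutes[OF l]], of s "k + i"]
      inj_eq[OF permutes_inj[OF arrangement_permutes[OF m]], of s "k + i"] that
    by (simp_all only: ci di simp_thms)
  have conj: "conjugate_part l (l ! i) = Suc i" "conjugate_part m (l ! i) = i"
  proof -
    have "j < conjugate_part l (l ! i) \<longleftrightarrow> j < Suc i" if "j < n" for j
      unfolding less_conjugate_part_iff[OF l that]
      using box_partitions_nth(3)[OF l, of j i] i(1,2) i(3)[of j] that by (cases "j \<le> i") auto
    then show "conjugate_part l (l ! i) = Suc i"
      using conjugate_part_le[OF l, of "l ! i"] i(1) by (metis Suc_leI lessI linorder_neqE_nat not_less not_less_eq order_less_le_trans)
    have "j < conjugate_part m (l ! i) \<longleftrightarrow> j < i" if "j < n" for j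
      unfolding less_conjugate_part_iff[OF m that]
      using box_partitions_nth(3)[OF l, of j i] i(1,2) i(3)[of j] that by (cases "j \<le> i") (auto simp: m_nth)
    then show "conjugate_part m (l ! i) = i"
      using conjugate_part_le[OF m, of "l ! i"] i(1) by (metis less_irrefl linorder_neqE_nat order_less_le_trans)
  qed
  have conj_eq: "conjugate_part m s = conjugate_part l s" if "s \<noteq> l ! i" for s
    unfolding conjugate_part_def len
    by (rule arg_cong[of _ _ card]) (use that m_nth i in \<open>auto split: if_splits\<close>)
  have pos: "l ! i \<le> k" using box_partitions_nth(2)[OF l] i by simp
  show "?c = transpose ?a ?b \<circ> ?d"
  proof
    fix s
    consider "s = k + i" | "Suc s = l ! i" | "s \<noteq> k + i" "Suc s \<noteq> l ! i" by blast
    then show "?c s = (transpose ?a ?b \<circ> ?d) s"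
    proof cases
      case 1
      then show ?thesis by (simp add: ci di)
    next
      case 2
      then have s: "s < k" using pos by simp
      have "?c s = ?a" using s 2 conj i by (simp add: arrangement_def b)
      moreover have "?d s = ?b" using s 2 conj i by (simp add: arrangement_def b)
      ultimately show ?thesis by simp
    next
      case 3
      have "?c s = ?d s"
      proof (cases "k \<le> s \<and> s < k + n")
        case True
        then show ?thesis using 3 m_nth[of "s - k"] by (auto simp: arrangement_def exponent_def len)
      next
        case False
        then show ?thesis using 3 by (auto simp: arrangement_def conj_eq)
      qed
      then show ?thesis using neq[OF 3(1)] by (simp add: transpose_apply_other)
    qed
  qed
qed

text \<open>
One adjacent transposition for each box.
\<close>

lemma sign_arrangement:
  "l \<in> box_partitions n k \<Longrightarrow>
    sign (arrangement n k l) = (- 1) ^ sum_list l * sign (arrangement n k (replicate n 0))"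
proof (induction "sum_list l" arbitrary: l)
  case 0
  then have "l = replicate n 0"
    using box_partitions_nth(1)[OF 0(2)] by (intro replicate_eqI) auto
  then show ?case by (simp add: sum_list_replicate)
next
  case (Suc w)
  note l = Suc.prems
  let ?I = "{j. j < n \<and> 0 < l ! j}"
  have len: "length l = n" using box_partitions_nth(1)[OF l] .
  have "?I \<noteq> {}"
  proof
    assume "?I = {}"
    then have "\<forall>a\<in>set l. a = 0" using len by (auto simp: in_set_conv_nth)
    then have "sum_list l = 0" by (simp add: sum_list_eq_0_iff)
    then show False using Suc.hyps(2) by linarith
  qed
  define i where "i = Max ?I"
  have i: "i < n" "0 < l ! i" using Max_in[of ?I] \<open>?I \<noteq> {}\<close> by (auto simp: i_def)
  have zero: "l ! j = 0" if "i < j" "j < n" for j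
  proof (rule ccontr)
    assume "l ! j \<noteq> 0"
    then have "j \<le> i" unfolding i_def using that by (intro Max_ge) auto
    then show False using that by simp
  qed
  note remove = arrangement_remove_box[OF l i zero]
  let ?m = "l[i := l ! i - 1]"
  have sum: "sum_list l = Suc (sum_list ?m)"
    using sum_list_update[of i l "l ! i - 1"] i len elem_le_sum_list[of i l] by simp
  have "1 \<le> exponent l i" using i by (simp add: exponent_def len)
  then have "sign (transpose (exponent l i - 1) (exponent l i)) = - 1"
    by (simp add: sign_swap_id)
  moreover have "permutation (arrangement n k ?m)"
    using arrangement_permutes[OF remove(1)] permutation_permutes by blast
  moreover have "sign (arrangement n k l) =
    sign (transpose (exponent l i - 1) (exponent l i) \<circ> arrangement n k ?m)"
    by (rule arg_cong[OF remove(2)])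
  ultimately have "sign (arrangement n k l) = - sign (arrangement n k ?m)"
    by (simp only: sign_compose permutation_swap_id)
  also have "sign (arrangement n k ?m) = (- 1) ^ sum_list ?m * sign (arrangement n k (replicate n 0))"
    by (rule Suc.hyps(1)) (use Suc.hyps(2) sum remove(1) in auto)
  finally show ?case by (simp add: sum)
qed

text \<open>
The elementary symmetric polynomial \<open>e\<^sub>r(y\<^sub>0, \<dots>, y\<^bsub>n-1\<^esub>)\<close> in the form in which it occurs as an eigenvalue.
\<close>

definition elem_coeff :: "nat \<Rightarrow> (nat \<Rightarrow> 'a::comm_ring_1) \<Rightarrow> int \<Rightarrow> 'a" where
  "elem_coeff n y r = (if r < 0 then 0 else poly.coeff (\<Prod>b=0..<n. [:1, y b:]) (nat r))"

text \<open>
The factors \<open>x + y\<^sub>b\<close>, rather than \<open>x - y\<^sub>b\<close>, keep the coefficients free of signs; the signs then sit in the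
evaluation points \<open>- y\<^sub>b\<close>.
\<close>

lemma coeff_prod_linear:
  fixes y :: "nat \<Rightarrow> 'a::idom" and n :: nat
  defines "Q \<equiv> \<Prod>b=0..<n. [:y b, 1:]"
  shows "degree Q = n" "poly.coeff Q n = 1"
    "poly.coeff (monom 1 i * Q) s = elem_coeff n y (int n - int s + int i)"
proof -
  show deg: "degree Q = n" unfolding Q_def by (subst degree_prod_eq_sum_degree) auto
  have "lead_coeff Q = 1" unfolding Q_def by (subst lead_coeff_prod) auto
  then show "poly.coeff Q n = 1" by (simp add: deg)
  have "[:1, y b:] = reflect_poly [:y b, 1:]" for b by (simp add: reflect_poly_def)
  then have R: "(\<Prod>b=0..<n. [:1, y b:]) = reflect_poly Q" by (simp add: reflect_poly_prod Q_def)
  have Q0: "poly.coeff Q r = 0" if "n < r" for r using that deg by (simp add: coeff_eq_0)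
  show "poly.coeff (monom 1 i * Q) s = elem_coeff n y (int n - int s + int i)"
  proof (cases "i \<le> s \<and> s \<le> n + i")
    case True
    then obtain d where s: "s = i + d" "d \<le> n" by (auto simp: le_iff_add)
    then have "int n - int s + int i = int (n - d)" by simp
    then have "elem_coeff n y (int n - int s + int i) = poly.coeff (\<Prod>b=0..<n. [:1, y b:]) (n - d)"
      by (simp only: elem_coeff_def nat_int of_nat_less_0_iff if_False)
    then show ?thesis
      using s(2) by (simp add: s(1) R coeff_reflect_poly deg coeff_monom_mult)
  next
    case False
    then show ?thesis
      using Q0[of "s - i"] by (auto simp: elem_coeff_def R coeff_reflect_poly deg coeff_monom_mult)
  qed
qed

text \<open>
Let \<open>Q = \<Prod> (x + y\<^sub>b)\<close>. The matrix \<open>A\<close> has the coefficients of \<open>x\<^sup>i Q\<close> in its first \<open>k\<close> rows and unit vectors in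
the others; \<open>W\<close> maps a coefficient vector of a polynomial to its top \<open>k\<close> coefficients and to its values at
the points \<open>- y\<^sub>b\<close>. The values of \<open>x\<^sup>i Q\<close> vanish there, so \<open>A W\<close> is block triangular. With the columns
arranged by the partition, \<open>det A\<close> is the minor on the left and the lower block of \<open>A W\<close> is the alternant
on the right.
\<close>

lemma complementary_minor:
  fixes y :: "nat \<Rightarrow> 'a::idom"
  assumes l: "l \<in> box_partitions n k"
  defines "z \<equiv> det_of (k + n) (\<lambda>s j. if j < k then if s = n + j then 1 else 0 else (- y (j - k)) ^ s)"
  shows "det_of k (\<lambda>i j. elem_coeff n y (int n - int (arrangement n k l j) + int i)) *
      (of_int (sign (arrangement n k l)) * z) =
    det_of n (\<lambda>i j. (- y j) ^ exponent l i)"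
proof -
  let ?c = "arrangement n k l"
  define Q where "Q = (\<Prod>b=0..<n. [:y b, 1:])"
  define K where "K i s = poly.coeff (monom 1 i * Q) s" for i s
  have K: "K i s = elem_coeff n y (int n - int s + int i)" for i s
    unfolding K_def Q_def by (rule coeff_prod_linear)
  have K_shift: "K i (n + j) = (if i = j then 1 else 0)" if "i \<le> j" for i j
  proof (cases "i = j")
    case True
    then show ?thesis using coeff_prod_linear(2)[where n = n and y = y] by (simp add: K_def coeff_monom_mult Q_def)
  next
    case False
    then have "degree Q < n + j - i" using that coeff_prod_linear(1)[where n = n and y = y] by (simp add: Q_def)
    then show ?thesis using False that by (simp add: K_def coeff_monom_mult coeff_eq_0)
  qed
  have K_root: "(\<Sum>s<k + n. K i s * (- y j) ^ s) = 0" if "i < k" "j < n" for i j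
  proof -
    \<comment> \<open>The polynomial \<open>x\<^sup>i Q\<close> vanishes at \<open>- y\<^sub>j\<close>.\<close>
    let ?p = "monom 1 i * Q"
    have "degree ?p \<le> i + n"
      using degree_mult_le[of "monom 1 i" Q] coeff_prod_linear(1)[where n = n and y = y] degree_monom_le[of "1::'a" i]
      by (simp add: Q_def)
    then have "(\<Sum>s<k + n. K i s * (- y j) ^ s) = poly ?p (- y j)"
      unfolding poly_altdef K_def
      by (intro sum.mono_neutral_right) (use that in \<open>auto simp: not_le coeff_eq_0\<close>)
    also have "poly Q (- y j) = 0" using that by (auto simp: Q_def poly_prod intro!: prod_zero bexI[of _ j])
    then have "poly ?p (- y j) = 0" by simp
    finally show ?thesis .
  qed
  have perm: "?c permutes {0..<k + n}" by (rule arrangement_permutes[OF l])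
  have reindex: "(\<Sum>r<k + n. g (?c r)) = (\<Sum>s<k + n. g s)" for g :: "nat \<Rightarrow> 'a"
    using sum.permute[OF perm, of g] by (simp add: o_def lessThan_atLeast0)
  define A :: "nat \<Rightarrow> nat \<Rightarrow> 'a" where "A i r = (if i < k then K i (?c r) else if r = i then 1 else 0)" for i r
  define W :: "nat \<Rightarrow> nat \<Rightarrow> 'a"
    where "W s j = (if j < k then if s = n + j then 1 else 0 else (- y (j - k)) ^ s)" for s j
  have "det_of (k + n) A = det_of k A * det_of n (\<lambda>i j. A (k + i) (k + j))"
    by (rule det_of_block_upper) (auto simp: A_def)
  also have "det_of n (\<lambda>i j. A (k + i) (k + j)) = 1"
    by (subst det_of_lower_triangular) (auto simp: A_def)
  also have "det_of k A = det_of k (\<lambda>i j. K i (?c j))"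
    by (rule det_of_cong) (simp add: A_def)
  finally have A: "det_of (k + n) A = det_of k (\<lambda>i j. K i (?c j))" by simp
  have W: "det_of (k + n) (\<lambda>r j. W (?c r) j) = of_int (sign ?c) * z"
    unfolding z_def W_def[symmetric] by (rule det_of_permute_rows[OF perm])
  define P where "P i j = (\<Sum>r<k + n. A i r * W (?c r) j)" for i j
  have upper: "P i j = (\<Sum>s<k + n. K i s * W s j)" if "i < k" for i j
    unfolding P_def A_def using that reindex[of "\<lambda>s. K i s * W s j"] by simp
  have left: "P i j = K i (n + j)" if "i < k" "j < k" for i j
  proof -
    have "P i j = (\<Sum>s<k + n. if s = n + j then K i (n + j) else 0)"
      unfolding upper[OF that(1)] by (rule sum.cong) (use that in \<open>auto simp: W_def\<close>)
    then show ?thesis using that by simp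
  qed
  have right: "P i j = 0" if "i < k" "k \<le> j" "j < k + n" for i j
    unfolding upper[OF that(1)] using K_root[of i "j - k"] that by (simp add: W_def)
  have lower: "P (k + i) (k + j) = (- y j) ^ exponent l i" if "i < n" "j < n" for i j
  proof -
    have "P (k + i) (k + j) = (\<Sum>r<k + n. if r = k + i then W (?c r) (k + j) else 0)"
      unfolding P_def by (rule sum.cong) (auto simp: A_def)
    then show ?thesis using that by (simp add: W_def arrangement_def)
  qed
  have "det_of (k + n) A * det_of (k + n) (\<lambda>r j. W (?c r) j) = det_of (k + n) P"
    unfolding P_def by (rule det_of_mult[symmetric])
  also have "\<dots> = det_of k P * det_of n (\<lambda>i j. P (k + i) (k + j))"
    by (rule det_of_block_lower) (rule right)
  also have "det_of k P = 1"
    by (subst det_of_lower_triangular) (auto simp: left K_shift)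
  also have "det_of n (\<lambda>i j. P (k + i) (k + j)) = det_of n (\<lambda>i j. (- y j) ^ exponent l i)"
    by (rule det_of_cong) (rule lower)
  finally show ?thesis unfolding A W K by simp
qed

lemma sum_exponents:
  assumes "l \<in> box_partitions n k"
  shows "(\<Sum>i=0..<n. exponent l i) = sum_list l + (\<Sum>i=0..<n. n - Suc i)"
proof -
  have "(\<Sum>i=0..<n. exponent l i) = (\<Sum>i=0..<n. l ! i + (n - Suc i))"
    by (rule sum.cong) (auto simp: exponent_def box_partitions_nth(1)[OF assms])
  also have "\<dots> = (\<Sum>i=0..<n. l ! i) + (\<Sum>i=0..<n. n - Suc i)" by (rule sum.distrib)
  finally show ?thesis
    using box_partitions_nth(1)[OF assms] by (simp only: sum_list_sum_nth)
qed

text \<open>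
\<open>complementary_minor\<close> determines both alternants up to the same unknown factor \<open>z\<close> and up to signs; the
empty partition, for which the determinant on the left is triangular, eliminates \<open>z\<close>.
\<close>

theorem dual_jacobi_trudi:
  fixes y :: "nat \<Rightarrow> 'a::idom"
  assumes l: "l \<in> box_partitions n k"
  shows "det_of k (\<lambda>i j. elem_coeff n y (int (conjugate_part l (Suc i)) - int i + int j)) *
      det_of n (\<lambda>i j. y j ^ (n - Suc i)) =
    det_of n (\<lambda>i j. y j ^ exponent l i)"
proof -
  let ?E = "\<lambda>l. det_of k (\<lambda>i j. elem_coeff n y (int n - int (arrangement n k l j) + int i))"
  let ?s = "\<lambda>l. of_int (sign (arrangement n k l)) :: 'a"
  let ?a = "\<lambda>l. det_of n (\<lambda>i j. y j ^ exponent l i)"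
  define e :: "nat list" where "e = replicate n 0"
  define d where "d = (\<Sum>i=0..<n. n - Suc i)"
  define z where "z = det_of (k + n) (\<lambda>s j. if j < k then if s = n + j then 1 else 0 else (- y (j - k)) ^ s)"
  have e: "e \<in> box_partitions n k"
    by (auto simp: e_def box_partitions_def sorted_wrt_iff_nth_less)
  have minor: "?E l * (?s l * z) = (- 1) ^ (sum_list l + d) * ?a l" if "l \<in> box_partitions n k" for l
  proof -
    have "det_of n (\<lambda>i j. (- y j) ^ exponent l i) = det_of n (\<lambda>i j. (- 1) ^ exponent l i * y j ^ exponent l i)"
      by (rule det_of_cong) (rule power_minus)
    also have "\<dots> = (- 1) ^ (sum_list l + d) * ?a l"
      unfolding det_of_scale_rows power_sum[symmetric] sum_exponents[OF that] d_def ..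
    finally show ?thesis using complementary_minor[OF that, of y] by (simp add: z_def)
  qed
  have E: "?E l = det_of k (\<lambda>i j. elem_coeff n y (int (conjugate_part l (Suc i)) - int i + int j))"
    if "l \<in> box_partitions n k" for l
  proof -
    have "?E l = det_of k (\<lambda>i j. elem_coeff n y (int (conjugate_part l (Suc j)) - int j + int i))"
      by (rule det_of_cong, rule arg_cong[of _ _ "elem_coeff n y"])
        (use conjugate_part_le[OF that] in \<open>auto simp: arrangement_def of_nat_diff trans_le_add1\<close>)
    then show ?thesis by (simp add: det_of_transpose[of k "\<lambda>i j. elem_coeff n y (int (conjugate_part l (Suc i)) - int i + int j)"])
  qed
  have "conjugate_part e (Suc i) = 0" for i by (auto simp: conjugate_part_def e_def)
  then have "?E e = 1"
    unfolding E[OF e] by (subst det_of_upper_triangular) (auto simp: elem_coeff_def poly_0_coeff_0[symmetric] poly_prod)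
  moreover have "?a e = det_of n (\<lambda>i j. y j ^ (n - Suc i))"
    by (rule det_of_cong) (simp add: exponent_def e_def)
  ultimately have empty: "?s e * z = (- 1) ^ d * det_of n (\<lambda>i j. y j ^ (n - Suc i))"
    using minor[OF e] by (simp add: e_def sum_list_replicate)
  have "?s l = (- 1) ^ sum_list l * ?s e"
    unfolding sign_arrangement[OF l] by (simp add: e_def)
  then have "(- 1) ^ (sum_list l + d) * ?a l = (- 1) ^ (sum_list l + d) * (?E l * det_of n (\<lambda>i j. y j ^ (n - Suc i)))"
    unfolding minor[OF l, symmetric] using empty by (simp add: power_add mult.assoc mult.left_commute)
  then show ?thesis unfolding E[OF l] by simp
qed

section \<open>The spin chain acting on Slater determinants\<close>

text \<open>
The Slater determinant of a list of one-particle functions evaluated at \<open>0, \<dots>, n - 1\<close>, scaled by \<open>c\<close>. It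
is 0 for a wrong number of functions, so that particle number needs no separate bookkeeping.
\<close>

definition slater :: "nat \<Rightarrow> 'a::comm_ring_1 \<Rightarrow> (nat \<Rightarrow> 'a) list \<Rightarrow> 'a" where
  "slater n c fs = (if length fs = n then c * det_of n (\<lambda>i b. (fs ! i) b) else 0)"

lemma slater_leibniz:
  "length fs = n \<Longrightarrow> slater n c fs =
    (\<Sum>p | p permutes {0..<n}. c * of_int (sign p) * (\<Prod>i=0..<n. (fs ! i) (p i)))"
  unfolding slater_def det_of_leibniz by (simp add: sum_distrib_left ac_simps)

lemma slater_linear:
  "slater n c (xs @ (\<lambda>b. r * f b + s * g b) # ys) =
    r * slater n c (xs @ f # ys) + s * slater n c (xs @ g # ys)"
proof (cases "Suc (length xs + length ys) = n")
  case True
  let ?k = "length xs" and ?F = "\<lambda>f. xs @ f # ys"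
  have k: "?k \<in> {0..<n}" using True by simp
  have rest: "(\<Prod>i\<in>{0..<n} - {?k}. (?F h ! i) (p i)) = (\<Prod>i\<in>{0..<n} - {?k}. (?F f ! i) (p i))" for h p
    by (rule prod.cong[OF refl]) (auto simp: nth_append nth_Cons')
  have split: "(\<Prod>i=0..<n. (?F h ! i) (p i)) = h (p ?k) * (\<Prod>i\<in>{0..<n} - {?k}. (?F f ! i) (p i))" for h p
    unfolding rest[of h p, symmetric] using prod.remove[OF _ k, of "\<lambda>i. (?F h ! i) (p i)"] by simp
  have "slater n c (?F h) = (\<Sum>p | p permutes {0..<n}.
      c * of_int (sign p) * (h (p ?k) * (\<Prod>i\<in>{0..<n} - {?k}. (?F f ! i) (p i))))" for h
    using slater_leibniz[of "?F h" n c] True by (simp only: split length_append list.size add_Suc_right)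
  note this[of "\<lambda>b. r * f b + s * g b"] this[of f] this[of g]
  then show ?thesis by (simp add: sum_distrib_left sum.distrib[symmetric] algebra_simps)
next
  case False
  then show ?thesis by (simp add: slater_def)
qed

lemma slater_repeat: "slater n c (xs @ f # f # ys) = 0"
proof (cases "Suc (Suc (length xs + length ys)) = n")
  case True
  have "det_of n (\<lambda>i b. ((xs @ f # f # ys) ! i) b) = 0"
    by (rule det_of_identical_rows[of "length xs" _ "Suc (length xs)"])
      (use True in \<open>auto simp: nth_append\<close>)
  then show ?thesis by (simp add: slater_def)
qed (simp add: slater_def)

text \<open>
Apply \<open>slater_repeat\<close> to the sum of both functions and expand.
\<close>

lemma slater_swap: "slater n c (xs @ f # g # ys) = - slater n c (xs @ g # f # ys)"
proof -
  let ?h = "\<lambda>b. 1 * f b + 1 * g b"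
  have "0 = slater n c (xs @ ?h # ?h # ys)" by (simp only: slater_repeat)
  also have "\<dots> = slater n c ((xs @ [f]) @ ?h # ys) + slater n c ((xs @ [g]) @ ?h # ys)"
    by (subst slater_linear) simp
  also have "\<dots> = slater n c (xs @ f # g # ys) + slater n c (xs @ g # f # ys)"
    unfolding slater_linear by (simp add: slater_repeat)
  finally show ?thesis by (simp add: eq_neg_iff_add_eq_0)
qed

lemma slater_rotate: "slater n c (xs @ f # ys) = (- 1) ^ length ys * slater n c (xs @ ys @ [f])"
proof (induction ys arbitrary: xs)
  case (Cons g ys)
  have "slater n c (xs @ f # g # ys) = - slater n c ((xs @ [g]) @ f # ys)"
    by (subst slater_swap) simp
  also have "slater n c ((xs @ [g]) @ f # ys) = (- 1) ^ length ys * slater n c ((xs @ [g]) @ ys @ [f])"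
    by (rule Cons.IH)
  finally show ?case by simp
qed simp

lemma slater_cong_Cons:
  assumes "\<And>b. b < n \<Longrightarrow> f b = g b"
  shows "slater n c (f # fs) = slater n c (g # fs)"
proof -
  have "det_of n (\<lambda>i b. ((f # fs) ! i) b) = det_of n (\<lambda>i b. ((g # fs) ! i) b)"
    by (rule det_of_cong) (use assms in \<open>simp add: nth_Cons'\<close>)
  then show ?thesis by (simp add: slater_def)
qed

lemma slater_scale:
  "slater n c (map (\<lambda>f b. d b * f b) fs) = (\<Prod>b=0..<n. d b) * slater n c fs"
proof (cases "length fs = n")
  case True
  have "det_of n (\<lambda>i b. (map (\<lambda>f b. d b * f b) fs ! i) b) = det_of n (\<lambda>i b. d b * (fs ! i) b)"
    by (rule det_of_cong) (use True in simp)
  then show ?thesis using True by (simp add: slater_def det_of_scale_columns)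
qed (simp add: slater_def)

lemma slater_hom:
  assumes "comm_ring_hom h"
  shows "h (slater n c fs) = slater n (h c) (map (\<lambda>f b. h (f b)) fs)"
proof (cases "length fs = n")
  case True
  interpret comm_ring_hom h by (rule assms)
  have "h (det_of n (\<lambda>i b. (fs ! i) b)) = det_of n (\<lambda>i b. (map (\<lambda>f b. h (f b)) fs ! i) b)"
    unfolding hom_det[symmetric]
    by (rule arg_cong[of _ _ det], rule eq_matI) (use True in auto)
  then show ?thesis using True by (simp add: slater_def hom_mult)
next
  case False
  interpret comm_ring_hom h by (rule assms)
  show ?thesis using False by (simp add: slater_def)
qed

lemma lax_entries:
  "entry_A (lax t x j) v J = (if j \<in> J then (1 + x * t j) * v J else v J)"
  "entry_B (lax t x j) v J = (if j \<in> J then x * v (J - {j}) else 0)"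
  "entry_C (lax t x j) v J = (if j \<in> J then 0 else v (insert j J))"
  "entry_D (lax t x j) v J = (if j \<in> J then x * v J else 0)"
  by (simp_all add: lax_def sigma_plus_def sigma_minus_def insert_absorb algebra_simps)

lemma monodromy_Suc_entries:
  "entry_A (monodromy t x (Suc m)) v = (\<lambda>J. entry_A (lax t x (Suc m)) (entry_A (monodromy t x m) v) J +
     entry_B (lax t x (Suc m)) (entry_C (monodromy t x m) v) J)"
  "entry_B (monodromy t x (Suc m)) v = (\<lambda>J. entry_A (lax t x (Suc m)) (entry_B (monodromy t x m) v) J +
     entry_B (lax t x (Suc m)) (entry_D (monodromy t x m) v) J)"
  "entry_C (monodromy t x (Suc m)) v = (\<lambda>J. entry_C (lax t x (Suc m)) (entry_A (monodromy t x m) v) J +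
     entry_D (lax t x (Suc m)) (entry_C (monodromy t x m) v) J)"
  "entry_D (monodromy t x (Suc m)) v = (\<lambda>J. entry_C (lax t x (Suc m)) (entry_B (monodromy t x m) v) J +
     entry_D (lax t x (Suc m)) (entry_D (monodromy t x m) v) J)"
  by (simp_all add: mat2_mult_def)

text \<open>
The occupied sites are split at \<open>m\<close> because the product of the first \<open>m\<close> Lax matrices moves the particles
on the sites up to \<open>m\<close> only.
\<close>

definition sites_upto :: "nat set \<Rightarrow> nat \<Rightarrow> nat list" where
  "sites_upto J m = filter (\<lambda>j. j \<in> J) [1..<Suc m]"

definition sites_after :: "nat \<Rightarrow> nat set \<Rightarrow> nat \<Rightarrow> nat list" where
  "sites_after N J m = filter (\<lambda>j. j \<in> J) [Suc m..<Suc N]"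

lemma sites_upto_simps:
  "sites_upto J 0 = []"
  "sites_upto J (Suc m) = sites_upto J m @ (if Suc m \<in> J then [Suc m] else [])"
  "sites_upto (insert (Suc m) J) m = sites_upto J m"
  "sites_upto (J - {Suc m}) m = sites_upto J m"
  by (auto simp: sites_upto_def intro!: filter_cong)

lemma sites_after_simps:
  "sites_after N J N = []"
  "m < N \<Longrightarrow> sites_after N J m = (if Suc m \<in> J then [Suc m] else []) @ sites_after N J (Suc m)"
  "sites_after N (insert (Suc m) J) (Suc m) = sites_after N J (Suc m)"
  "sites_after N (J - {Suc m}) (Suc m) = sites_after N J (Suc m)"
proof -
  show "m < N \<Longrightarrow> sites_after N J m = (if Suc m \<in> J then [Suc m] else []) @ sites_after N J (Suc m)"
    unfolding sites_after_def by (subst upt_rec) simp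
qed (auto simp: sites_after_def intro!: filter_cong)

lemma sites_after_0: "sites_after N J 0 = sites_upto J N"
  by (simp add: sites_after_def sites_upto_def)

text \<open>
Multiplication by \<open>y\<close> moves a particle from site \<open>j\<close> to site \<open>j - 1\<close> or leaves it there with weight \<open>t\<^sub>j\<close>.
\<close>

locale hopping =
  fixes N n :: nat and c x q :: "'a::comm_ring_1" and t y :: "nat \<Rightarrow> 'a" and \<psi> :: "nat \<Rightarrow> nat \<Rightarrow> 'a"
  assumes hop: "1 \<le> j \<Longrightarrow> j \<le> N \<Longrightarrow> y b * \<psi> j b = t j * \<psi> j b + \<psi> (j - 1) b"
begin

definition \<phi> :: "nat \<Rightarrow> nat \<Rightarrow> 'a" where "\<phi> j b = (1 + x * y b) * \<psi> j b"

lemma \<phi>_eq: "1 \<le> j \<Longrightarrow> j \<le> N \<Longrightarrow> \<phi> j = (\<lambda>b. (1 + x * t j) * \<psi> j b + x * \<psi> (j - 1) b)"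
proof
  fix b assume "1 \<le> j" "j \<le> N"
  have "\<phi> j b = \<psi> j b + x * (y b * \<psi> j b)" by (simp add: \<phi>_def algebra_simps)
  then show "\<phi> j b = (1 + x * t j) * \<psi> j b + x * \<psi> (j - 1) b"
    unfolding hop[OF \<open>1 \<le> j\<close> \<open>j \<le> N\<close>] by (simp add: algebra_simps)
qed

definition closed_state :: "nat \<Rightarrow> 'a spin" where
  "closed_state m J = (if J \<subseteq> {1..N} then
     slater n c (map \<phi> (sites_upto J m) @ map \<psi> (sites_after N J m)) else 0)"

definition open_state :: "nat \<Rightarrow> 'a spin" where
  "open_state m J = (if J \<subseteq> {1..N} then
     slater n c (map \<phi> (sites_upto J m) @ \<psi> m # map \<psi> (sites_after N J m)) else 0)"

text \<open>
The first \<open>m\<close> Lax matrices act on the particles on the first \<open>m\<close> sites. The closed state has the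
auxiliary space in state 0; in the open state a particle is in transit and is still described by \<open>\<psi>\<^sub>m\<close>.
When the next site is occupied, the recursion of the closed state is the expansion of \<open>\<phi>\<close> into staying
and hopping. In the recursion of the open state the staying term duplicates the transit particle and
vanishes.
\<close>

lemma monodromy_state:
  "m \<le> N \<Longrightarrow>
    (\<forall>J. entry_A (monodromy t x m) (closed_state 0) J + entry_B (monodromy t x m) (open_state 0) J =
      closed_state m J) \<and>
    (\<forall>J. entry_C (monodromy t x m) (closed_state 0) J + entry_D (monodromy t x m) (open_state 0) J =
      open_state m J)"
proof (induction m)
  case (Suc m)
  let ?j = "Suc m"
  have mN: "m < N" using Suc by simp
  note IH = Suc.IH[OF less_imp_le[OF mN], THEN conjunct1, rule_format]
    Suc.IH[OF less_imp_le[OF mN], THEN conjunct2, rule_format]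
  note phi = \<phi>_eq[of ?j, simplified]
  have A: "entry_A (monodromy t x ?j) (closed_state 0) J + entry_B (monodromy t x ?j) (open_state 0) J =
    (if ?j \<in> J then (1 + x * t ?j) * closed_state m J + x * open_state m (J - {?j}) else closed_state m J)"
    and C: "entry_C (monodromy t x ?j) (closed_state 0) J + entry_D (monodromy t x ?j) (open_state 0) J =
    (if ?j \<in> J then x * open_state m J else closed_state m (insert ?j J))" for J
    unfolding monodromy_Suc_entries lax_entries IH[symmetric] by (simp_all add: algebra_simps)
  show ?case
  proof (intro conjI allI)
    fix J
    show "entry_A (monodromy t x ?j) (closed_state 0) J + entry_B (monodromy t x ?j) (open_state 0) J =
      closed_state ?j J"
    proof (cases "J \<subseteq> {1..N} \<and> ?j \<in> J")
      case True
      then have "J - {?j} \<subseteq> {1..N}" by auto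
      then show ?thesis
        unfolding A using True mN
        by (simp add: closed_state_def open_state_def sites_upto_simps sites_after_simps(2)[of m]
            sites_after_simps(4) phi slater_linear)
    next
      case False
      moreover have "\<not> J - {?j} \<subseteq> {1..N}" if "\<not> J \<subseteq> {1..N}" using that mN by auto
      ultimately show ?thesis
        unfolding A using mN
        by (auto simp add: closed_state_def open_state_def sites_upto_simps sites_after_simps(2)[of m])
    qed
    show "entry_C (monodromy t x ?j) (closed_state 0) J + entry_D (monodromy t x ?j) (open_state 0) J =
      open_state ?j J"
    proof (cases "J \<subseteq> {1..N}")
      case True
      then have "insert ?j J \<subseteq> {1..N}" using mN by auto
      then show ?thesis
        unfolding C using True mN slater_linear[of n c "map \<phi> (sites_upto J m)" "1 + x * t ?j" "\<psi> ?j" x "\<psi> m"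
          "\<psi> ?j # map \<psi> (sites_after N J ?j)"]
        by (auto simp add: closed_state_def open_state_def sites_upto_simps sites_after_simps(2)[of m]
            sites_after_simps(3) phi slater_repeat)
    next
      case False
      then show ?thesis unfolding C by (auto simp: closed_state_def open_state_def)
    qed
  qed
qed simp

lemma closed_state_final: "closed_state N J = (\<Prod>b=0..<n. 1 + x * y b) * closed_state 0 J"
proof -
  have "map \<phi> js = map (\<lambda>f b. (1 + x * y b) * f b) (map \<psi> js)" for js
    by (simp add: \<phi>_def[abs_def])
  then show ?thesis
    by (simp only: closed_state_def sites_upto_simps(1) sites_after_simps(1) sites_after_0 slater_scale
      list.map append_Nil append_Nil2) simp
qed

text \<open>
A particle leaving over the left end is described by \<open>\<psi>\<^sub>0\<close>. Moving its row past the \<open>n - 1\<close> other rows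
cancels the sign in the boundary condition, so it amounts to removing a particle from site \<open>N\<close> with
weight \<open>q\<close>.
\<close>

lemma open_state_initial:
  assumes "0 < n" "0 < N" "\<And>b. b < n \<Longrightarrow> \<psi> 0 b = (- 1) ^ (n - 1) * q * \<psi> N b"
  shows "open_state 0 = (\<lambda>J. q * sigma_minus N (closed_state 0) J)"
proof
  fix J
  let ?ys = "map \<psi> (sites_upto J N)"
  have "slater n c ([] @ \<psi> 0 # ?ys) = q * slater n c (?ys @ [\<psi> N])"
  proof (cases "Suc (length ?ys) = n")
    case True
    have "slater n c (\<psi> 0 # ?ys) = slater n c ((\<lambda>b. (- 1) ^ (n - 1) * q * \<psi> N b) # ?ys)"
      by (rule slater_cong_Cons) (rule assms(3))
    then have "slater n c ([] @ \<psi> 0 # ?ys) = (- 1) ^ (n - 1) * q * slater n c ([] @ \<psi> N # ?ys)"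
      using slater_linear[of n c "[]" "(- 1) ^ (n - 1) * q" "\<psi> N" 0 "\<psi> N" ?ys] by simp
    also have "slater n c ([] @ \<psi> N # ?ys) = (- 1) ^ length ?ys * slater n c (?ys @ [\<psi> N])"
      by (subst slater_rotate) simp
    also have "length ?ys = n - 1" using True by simp
    finally show ?thesis by (simp add: ac_simps flip: power_add)
  next
    case False
    then show ?thesis by (simp add: slater_def)
  qed
  then have eq: "open_state 0 J = (if J \<subseteq> {1..N} then q * slater n c (?ys @ [\<psi> N]) else 0)"
    by (simp add: open_state_def sites_upto_simps(1) sites_after_0)
  obtain M where M: "N = Suc M" using assms(2) by (cases N) auto
  show "open_state 0 J = q * sigma_minus N (closed_state 0) J"
  proof (cases "N \<in> J")
    case True
    then have "slater n c (?ys @ [\<psi> N]) = 0"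
      using slater_repeat[of n c "map \<psi> (sites_upto J M)" "\<psi> N" "[]"] by (simp add: M sites_upto_simps(2))
    then show ?thesis using True by (simp add: eq sigma_minus_def)
  next
    case False
    then have "map \<psi> (sites_upto (insert N J) N) = ?ys @ [\<psi> N]"
      by (simp add: M sites_upto_simps)
    then show ?thesis
      using False assms(2) by (simp add: eq sigma_minus_def closed_state_def sites_upto_simps(1) sites_after_0)
  qed
qed

end

definition linear_op :: "'a::comm_ring_1 spin_op \<Rightarrow> bool" where
  "linear_op F \<longleftrightarrow> (\<forall>u v. F (\<lambda>J. u J + v J) = (\<lambda>J. F u J + F v J)) \<and>
    (\<forall>c v. F (\<lambda>J. c * v J) = (\<lambda>J. c * F v J))"

lemma linear_op_add: "linear_op F \<Longrightarrow> F (\<lambda>J. u J + v J) = (\<lambda>J. F u J + F v J)"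
  and linear_op_scale: "linear_op F \<Longrightarrow> F (\<lambda>J. c * v J) = (\<lambda>J. c * F v J)"
  by (simp_all add: linear_op_def)

lemma linear_op_zero: "linear_op F \<Longrightarrow> F (\<lambda>J. 0) = (\<lambda>J. 0)"
  using linear_op_scale[of F 0 "\<lambda>J. 0"] by simp

lemma linear_op_sum:
  assumes "linear_op F"
  shows "F (\<lambda>J. \<Sum>i\<in>I. a i * u i J) = (\<lambda>J. \<Sum>i\<in>I. a i * F (u i) J)"
proof (induction I rule: infinite_finite_induct)
  case (insert i I)
  have "F (\<lambda>J. \<Sum>i\<in>insert i I. a i * u i J) = F (\<lambda>J. a i * u i J + (\<Sum>i\<in>I. a i * u i J))"
    using insert by simp
  also have "\<dots> = (\<lambda>J. F (\<lambda>J. a i * u i J) J + F (\<lambda>J. \<Sum>i\<in>I. a i * u i J) J)"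
    by (rule linear_op_add[OF assms])
  also have "\<dots> = (\<lambda>J. \<Sum>i\<in>insert i I. a i * F (u i) J)"
    unfolding insert.IH linear_op_scale[OF assms] using insert by simp
  finally show ?case .
qed (simp_all add: linear_op_zero[OF assms])

lemma linear_op_combination:
  "linear_op F \<Longrightarrow> linear_op G \<Longrightarrow> linear_op (\<lambda>v J. a * F v J + b * G v J)"
  by (simp add: linear_op_def algebra_simps)

lemma linear_op_add_comp:
  "linear_op F \<Longrightarrow> linear_op F' \<Longrightarrow> linear_op G \<Longrightarrow> linear_op G' \<Longrightarrow>
    linear_op (\<lambda>v J. F (F' v) J + G (G' v) J)"
  by (simp add: linear_op_def algebra_simps)

lemma linear_op_lax:
  "linear_op (entry_A (lax t x j))" "linear_op (entry_B (lax t x j))"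
  "linear_op (entry_C (lax t x j))" "linear_op (entry_D (lax t x j))"
  by (simp_all add: linear_op_def fun_eq_iff lax_entries algebra_simps)

lemma linear_op_monodromy:
  "linear_op (entry_A (monodromy t x m)) \<and> linear_op (entry_B (monodromy t x m)) \<and>
    linear_op (entry_C (monodromy t x m)) \<and> linear_op (entry_D (monodromy t x m))"
proof (induction m)
  case 0
  then show ?case by (simp add: linear_op_def)
next
  case (Suc m)
  note ops = Suc[THEN conjunct1] Suc[THEN conjunct2, THEN conjunct1]
    Suc[THEN conjunct2, THEN conjunct2, THEN conjunct1] Suc[THEN conjunct2, THEN conjunct2, THEN conjunct2]
  show ?case
    unfolding monodromy_Suc_entries[abs_def]
    by (intro conjI
        linear_op_add_comp[OF linear_op_lax(1) ops(1) linear_op_lax(2) ops(3)]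
        linear_op_add_comp[OF linear_op_lax(1) ops(2) linear_op_lax(2) ops(4)]
        linear_op_add_comp[OF linear_op_lax(3) ops(1) linear_op_lax(4) ops(3)]
        linear_op_add_comp[OF linear_op_lax(3) ops(2) linear_op_lax(4) ops(4)])
qed

lemma monodromy_sigma_minus:
  "m < j \<Longrightarrow>
    (\<forall>J. entry_A (monodromy t x m) (sigma_minus j v) J = sigma_minus j (entry_A (monodromy t x m) v) J) \<and>
    (\<forall>J. entry_B (monodromy t x m) (sigma_minus j v) J = sigma_minus j (entry_B (monodromy t x m) v) J) \<and>
    (\<forall>J. entry_C (monodromy t x m) (sigma_minus j v) J = sigma_minus j (entry_C (monodromy t x m) v) J) \<and>
    (\<forall>J. entry_D (monodromy t x m) (sigma_minus j v) J = sigma_minus j (entry_D (monodromy t x m) v) J)"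
proof (induction m)
  case (Suc m)
  note IH = Suc.IH[OF Suc_lessD[OF Suc.prems]]
  have "insert j (J - {Suc m}) = insert j J - {Suc m}" for J using Suc.prems by auto
  then show ?case
    unfolding monodromy_Suc_entries lax_entries using IH Suc.prems
    by (simp add: sigma_minus_def insert_commute)
qed (simp add: sigma_minus_def)

text \<open>
A particle that enters at site 1 while one is removed from site \<open>N\<close> beforehand is the same as one that
leaves through site \<open>N\<close>: the factors at the last site agree, and the others do not act on it.
\<close>

lemma monodromy_B_sigma_minus:
  "0 < N \<Longrightarrow> entry_B (monodromy t x N) (sigma_minus N v) = entry_D (monodromy t x N) v"
proof (cases N)
  case (Suc M)
  show ?thesis
    unfolding Suc monodromy_Suc_entries lax_entries
    using monodromy_sigma_minus[of M "Suc M" t x v]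
    by (simp add: fun_eq_iff sigma_minus_def insert_absorb)
qed simp

context hopping
begin

text \<open>
The twisted trace \<open>A + q D\<close> is the closed part of \<open>monodromy_state\<close> for the initial open state that the
boundary condition produces.
\<close>

lemma transfer_state:
  assumes "0 < n" "0 < N" "\<And>b. b < n \<Longrightarrow> \<psi> 0 b = (- 1) ^ (n - 1) * q * \<psi> N b"
  shows "entry_A (monodromy t x N) (closed_state 0) J + q * entry_D (monodromy t x N) (closed_state 0) J =
    (\<Prod>b=0..<n. 1 + x * y b) * closed_state 0 J"
proof -
  have "entry_B (monodromy t x N) (open_state 0) =
    entry_B (monodromy t x N) (\<lambda>J. q * sigma_minus N (closed_state 0) J)"
    by (rule arg_cong[OF open_state_initial[OF assms]])
  also have "\<dots> = (\<lambda>J. q * entry_B (monodromy t x N) (sigma_minus N (closed_state 0)) J)"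
    by (rule linear_op_scale) (simp add: linear_op_monodromy)
  finally have "entry_B (monodromy t x N) (open_state 0) = (\<lambda>J. q * entry_D (monodromy t x N) (closed_state 0) J)"
    by (simp only: monodromy_B_sigma_minus[OF assms(2)])
  then show ?thesis using monodromy_state[of N] by (simp add: closed_state_final)
qed

end

definition determinant_state :: "nat \<Rightarrow> nat \<Rightarrow> 'a::comm_ring_1 \<Rightarrow> (nat \<Rightarrow> nat \<Rightarrow> 'a) \<Rightarrow> 'a spin" where
  "determinant_state N n c \<psi> J =
     (if J \<subseteq> {1..N} then slater n c (map \<psi> (sites_upto J N)) else 0)"

lemma factorial_power_Suc: "factorial_power x a (Suc r) = (x - a (Suc r)) * factorial_power x a r"
  by (simp add: factorial_power_def mult.commute)

lemma linear_op_E: "linear_op (E_op N T q r)"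
proof -
  define F where "F = transfer_E N T q"
  have F: "linear_op F"
  proof -
    let ?M = "monodromy (\<lambda>j. [:rev_param N T j:]) [:0, 1:] N"
    have "linear_op (\<lambda>v J. 1 * entry_A ?M v J + [:q:] * entry_D ?M v J)"
      using linear_op_combination[of "entry_A ?M" "entry_D ?M" 1 "[:q:]"] linear_op_monodromy by blast
    then show ?thesis unfolding F_def by (simp add: transfer_E_def[abs_def] Let_def)
  qed
  have add: "F (\<lambda>K. [:u K + v K:]) = (\<lambda>J. F (\<lambda>K. [:u K:]) J + F (\<lambda>K. [:v K:]) J)" for u v
    using linear_op_add[OF F, of "\<lambda>K. [:u K:]" "\<lambda>K. [:v K:]"] by simp
  have scale: "F (\<lambda>K. [:c * v K:]) = (\<lambda>J. [:c:] * F (\<lambda>K. [:v K:]) J)" for c v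
    using linear_op_scale[OF F, of "[:c:]" "\<lambda>K. [:v K:]"] by (simp add: mult.commute)
  show ?thesis
    unfolding linear_op_def E_op_def[abs_def] F_def[symmetric] add scale
    by (cases "r < 0") simp_all
qed

text \<open>
The functions \<open>\<psi>\<^sub>j = (y|T)\<^bsup>N-j\<^esup>\<close> satisfy the hopping relation over the polynomial ring in the spectral
parameter; the hypothesis on \<open>y\<close> is the Bethe equation and gives the boundary condition.
\<close>

theorem E_op_determinant_state:
  fixes T y :: "nat \<Rightarrow> 'a::comm_ring_1" and c :: 'a
  assumes "0 < n" "0 < N" "\<And>b. b < n \<Longrightarrow> factorial_power (y b) T N = (- 1) ^ (n - 1) * q"
  defines "v \<equiv> determinant_state N n c (\<lambda>j b. factorial_power (y b) T (N - j))"
  shows "E_op N T q r v =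
    (\<lambda>J. (if r < 0 then 0 else poly.coeff (\<Prod>b=0..<n. [:1, y b:]) (nat r)) * v J)"
proof -
  define \<psi> where "\<psi> j b = [:factorial_power (y b) T (N - j):]" for j b
  have hom: "comm_ring_hom (\<lambda>a::'a. [:a:])" by unfold_locales auto
  interpret hopping N n "[:c:]" "[:0, 1:]" "[:q:]" "\<lambda>j. [:rev_param N T j:]" "\<lambda>b. [:y b:]" \<psi>
  proof
    fix j b assume "1 \<le> j" "j \<le> N"
    then have "factorial_power (y b) T (N - (j - 1)) =
      (y b - rev_param N T j) * factorial_power (y b) T (N - j)"
      using factorial_power_Suc[of "y b" T "N - j"] by (simp add: rev_param_def Suc_diff_le)
    then show "[:y b:] * \<psi> j b = [:rev_param N T j:] * \<psi> j b + \<psi> (j - 1) b"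
      by (simp add: \<psi>_def algebra_simps)
  qed
  have state: "closed_state 0 = (\<lambda>J. [:v J:])"
  proof
    fix J
    show "closed_state 0 J = [:v J:]"
      unfolding closed_state_def v_def determinant_state_def
      by (simp add: slater_hom[OF hom] sites_upto_simps(1) sites_after_0 \<psi>_def[abs_def] o_def)
  qed
  have boundary: "\<psi> 0 b = (- 1) ^ (n - 1) * [:q:] * \<psi> N b" if "b < n" for b
  proof -
    have "\<psi> 0 b = [:(- 1) ^ (n - 1) * q:]" by (simp add: \<psi>_def assms(3)[OF that])
    also have "\<dots> = (- 1) ^ (n - 1) * [:q:]"
      by (cases "even (n - 1)") simp_all
    finally show ?thesis by (simp add: \<psi>_def factorial_power_def)
  qed
  note eigen = transfer_state[OF assms(1,2) boundary]
  have "1 + [:0, 1:] * [:y b:] = [:1, y b:]" for b by (simp add: one_pCons)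
  then have "transfer_E N T q (\<lambda>K. [:v K:]) J = (\<Prod>b=0..<n. [:1, y b:]) * [:v J:]" for J
    using eigen[of J] by (simp only: transfer_E_def Let_def state)
  then show ?thesis by (simp add: E_op_def fun_eq_iff mult.commute)
qed

lemma linear_op_foldr:
  "(\<And>i. linear_op (M i)) \<Longrightarrow> linear_op (foldr M is)"
  by (induction "is") (simp_all add: linear_op_def)

lemma foldr_eigenvector:
  assumes "\<And>i. linear_op (M i)" "\<And>i. M i v = (\<lambda>J. e i * v J)"
  shows "foldr M is v = (\<lambda>J. prod_list (map e is) * v J)"
proof (induction "is")
  case (Cons i "is")
  then show ?case
    using linear_op_scale[OF assms(1), of i "prod_list (map e is)" v] by (simp add: assms(2) ac_simps)
qed simp

lemma linear_op_op_det:
  assumes "\<And>i j. linear_op (M i j)"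
  shows "linear_op (op_det k M)"
proof -
  have "linear_op (foldr (\<lambda>i. M i (p i)) is)" for p "is" by (rule linear_op_foldr) (rule assms)
  then show ?thesis
    by (simp add: linear_op_def op_det_def sum.distrib sum_distrib_left algebra_simps)
qed

lemma op_det_eigenvector:
  assumes "\<And>i j. linear_op (M i j)" "\<And>i j. M i j v = (\<lambda>J. e i j * v J)"
  shows "op_det k M v =
    (\<lambda>J. (\<Sum>p | p permutes {1..k}. of_int (sign p) * (\<Prod>i=1..k. e i (p i))) * v J)"
proof -
  have "foldr (\<lambda>i. M i (p i)) [1..<Suc k] v = (\<lambda>J. (\<Prod>i=1..k. e i (p i)) * v J)" for p
    by (subst foldr_eigenvector[of "\<lambda>i. M i (p i)" v "\<lambda>i. e i (p i)"])
      (simp_all only: assms prod.distinct_set_conv_list[symmetric] distinct_upt set_upt atLeastLessThanSuc_atLeastAtMost)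
  then show ?thesis by (simp add: op_det_def sum_distrib_right mult.assoc)
qed

section \<open>Eigenvalues of the modified operators\<close>

text \<open>
The zero block has more than \<open>n\<close> rows and columns in total, so every permutation meets it.
\<close>

lemma det_of_zero_block:
  assumes "i0 < n" "\<And>i j. i0 \<le> i \<Longrightarrow> i < n \<Longrightarrow> j \<le> i0 \<Longrightarrow> f i j = 0"
  shows "det_of n f = 0"
  unfolding det_of_leibniz
proof (rule sum.neutral, rule ballI)
  fix p assume "p \<in> {p. p permutes {0..<n}}"
  then have p: "p permutes {0..<n}" by simp
  have "\<exists>i\<in>{i0..<n}. p i \<le> i0"
  proof (rule ccontr)
    assume "\<not> ?thesis"
    then have "p ` {i0..<n} \<subseteq> {Suc i0..<n}"
      using permutes_in_image[OF p] by (force simp: not_le Suc_le_eq)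
    from card_mono[OF _ this] show False
      using assms(1) by (simp add: card_image permutes_inj_on[OF p])
  qed
  then obtain i where "i0 \<le> i" "i < n" "p i \<le> i0" by auto
  then have "(\<Prod>i=0..<n. f i (p i)) = 0" by (intro prod_zero) (auto intro: bexI[of _ i] assms(2))
  then show "of_int (sign p) * (\<Prod>i=0..<n. f i (p i)) = 0" by simp
qed

text \<open>
The signs \<open>(-1)\<^bsup>r+s\<^esup>\<close> of \<open>factorial_power_expand\<close> split into row and column factors. A partition \<open>m\<close> that
is not contained in \<open>l\<close> contributes 0, because the indices of the elementary symmetric polynomials are
negative on a block.
\<close>

lemma factorial_alternant_expand:
  fixes t y :: "nat \<Rightarrow> 'a::comm_ring_1"
  assumes l: "l \<in> box_partitions n (N - n)" and n: "n \<le> N"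
  shows "det_of n (\<lambda>i j. factorial_power (y j) t (exponent l i)) =
    (\<Sum>m | m \<in> box_partitions n (N - n) \<and> (\<forall>i<n. m ! i \<le> l ! i).
      (- 1) ^ (sum_list l - sum_list m) *
      det_of n (\<lambda>i j. elem_sym (int (l ! i) - int (m ! j) - int i + int j) (n + l ! i - Suc i) t) *
      det_of n (\<lambda>i j. y j ^ exponent m i))"
proof -
  let ?X = "box_partitions n (N - n)"
  define d where "d = (\<Sum>i=0..<n. n - Suc i)"
  define A where "A i s = (- 1) ^ (exponent l i + s) * elem_sym (int (exponent l i) - int s) (exponent l i) t" for i s
  define D where "D m = det_of n (\<lambda>i j. elem_sym (int (l ! i) - int (m ! j) - int i + int j) (n + l ! i - Suc i) t)" for m
  have "det_of n (\<lambda>i j. factorial_power (y j) t (exponent l i)) = det_of n (\<lambda>i j. \<Sum>s<N. A i s * y j ^ s)"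
    unfolding A_def by (rule det_of_cong) (rule factorial_power_expand[OF exponent_less_length[OF l n]])
  also have "\<dots> = (\<Sum>m\<in>?X. det_of n (\<lambda>i j. A i (exponent m j)) * det_of n (\<lambda>i j. y j ^ exponent m i))"
    by (rule cauchy_binet[OF n])
  also have "\<dots> = (\<Sum>m\<in>?X. (- 1) ^ (sum_list l + sum_list m) * D m * det_of n (\<lambda>i j. y j ^ exponent m i))"
  proof (rule sum.cong[OF refl])
    fix m assume m: "m \<in> ?X"
    have "det_of n (\<lambda>i j. A i (exponent m j)) = det_of n (\<lambda>i j. (- 1) ^ exponent l i *
      ((- 1) ^ exponent m j * elem_sym (int (l ! i) - int (m ! j) - int i + int j) (n + l ! i - Suc i) t))"
    proof (rule det_of_cong)
      fix i j assume "i < n" "j < n"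
      then have "int (exponent l i) - int (exponent m j) = int (l ! i) - int (m ! j) - int i + int j"
        by (simp add: exponent_def box_partitions_nth(1)[OF l] box_partitions_nth(1)[OF m] of_nat_diff)
      moreover have "exponent l i = n + l ! i - Suc i"
        by (simp add: exponent_def box_partitions_nth(1)[OF l])
      ultimately show "A i (exponent m j) = (- 1) ^ exponent l i *
        ((- 1) ^ exponent m j * elem_sym (int (l ! i) - int (m ! j) - int i + int j) (n + l ! i - Suc i) t)"
        by (simp add: A_def power_add mult.assoc)
    qed
    also have "\<dots> = (- 1) ^ (sum_list l + d) * ((- 1) ^ (sum_list m + d) * D m)"
      unfolding det_of_scale_rows det_of_scale_columns power_sum[symmetric]
        sum_exponents[OF l] sum_exponents[OF m] D_def d_def ..
    also have "\<dots> = (- 1) ^ (sum_list l + sum_list m) * D m"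
      by (simp add: minus_one_power_iff)
    finally show "det_of n (\<lambda>i j. A i (exponent m j)) * det_of n (\<lambda>i j. y j ^ exponent m i) =
      (- 1) ^ (sum_list l + sum_list m) * D m * det_of n (\<lambda>i j. y j ^ exponent m i)" by simp
  qed
  also have "\<dots> = (\<Sum>m | m \<in> ?X \<and> (\<forall>i<n. m ! i \<le> l ! i).
    (- 1) ^ (sum_list l + sum_list m) * D m * det_of n (\<lambda>i j. y j ^ exponent m i))"
  proof (rule sum.mono_neutral_right[OF finite_box_partitions])
    show "\<forall>m\<in>?X - {m. m \<in> ?X \<and> (\<forall>i<n. m ! i \<le> l ! i)}.
      (- 1) ^ (sum_list l + sum_list m) * D m * det_of n (\<lambda>i j. y j ^ exponent m i) = 0"
    proof
      fix m assume "m \<in> ?X - {m. m \<in> ?X \<and> (\<forall>i<n. m ! i \<le> l ! i)}"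
      then obtain i0 where m: "m \<in> ?X" and i0: "i0 < n" "l ! i0 < m ! i0" by (auto simp: not_le)
      have "D m = 0"
        unfolding D_def
      proof (rule det_of_zero_block[OF i0(1)], rule elem_sym_neg)
        fix i j assume "i0 \<le> i" "i < n" "j \<le> i0"
        then show "int (l ! i) - int (m ! j) - int i + int j < 0"
          using box_partitions_nth(3)[OF l, of i0 i] box_partitions_nth(3)[OF m, of j i0] i0 by linarith
      qed
      then show "(- 1) ^ (sum_list l + sum_list m) * D m * det_of n (\<lambda>i j. y j ^ exponent m i) = 0"
        by simp
    qed
  qed auto
  also have "\<dots> = (\<Sum>m | m \<in> ?X \<and> (\<forall>i<n. m ! i \<le> l ! i).
    (- 1) ^ (sum_list l - sum_list m) * D m * det_of n (\<lambda>i j. y j ^ exponent m i))"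
  proof (rule sum.cong[OF refl])
    fix m assume m: "m \<in> {m. m \<in> ?X \<and> (\<forall>i<n. m ! i \<le> l ! i)}"
    then have "sum_list m \<le> sum_list l"
      using box_partitions_nth(1)[OF l] box_partitions_nth(1)[of m n "N - n"]
      by (auto simp: sum_list_sum_nth intro!: sum_mono)
    then have "even (sum_list l + sum_list m) = even (sum_list l - sum_list m)" by simp
    then have "(- 1 :: 'a) ^ (sum_list l + sum_list m) = (- 1) ^ (sum_list l - sum_list m)"
      by (simp only: minus_one_power_iff)
    then show "(- 1) ^ (sum_list l + sum_list m) * D m * det_of n (\<lambda>i j. y j ^ exponent m i) =
      (- 1) ^ (sum_list l - sum_list m) * D m * det_of n (\<lambda>i j. y j ^ exponent m i)" by simp
  qed
  finally show ?thesis unfolding D_def .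
qed

lemma linear_op_S: "linear_op (S_op N n T q l)"
  unfolding S_op_def by (rule linear_op_op_det) (rule linear_op_E)

lemma linear_op_S_tilde: "linear_op (S_tilde N n T q l)"
  by (simp add: linear_op_def S_tilde_def[abs_def] linear_op_add[OF linear_op_S] linear_op_scale[OF linear_op_S]
      sum.distrib sum_distrib_left algebra_simps)

lemma S_op_eigenvector:
  fixes T y :: "nat \<Rightarrow> 'a::field"
  assumes E: "\<And>r. E_op N T q r v = (\<lambda>J. elem_coeff n y r * v J)"
    and l: "l \<in> box_partitions n (N - n)" and y: "det_of n (\<lambda>i j. y j ^ (n - Suc i)) \<noteq> 0"
  shows "S_op N n T q l v =
    (\<lambda>J. det_of n (\<lambda>i j. y j ^ exponent l i) / det_of n (\<lambda>i j. y j ^ (n - Suc i)) * v J)"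
proof -
  have "S_op N n T q l v = (\<lambda>J. det_of (N - n) (\<lambda>i j. elem_coeff n y
      (int (conjugate_part l (Suc i)) - int (Suc i) + int (Suc j))) * v J)"
    unfolding S_op_def
    by (subst op_det_eigenvector[OF linear_op_E E]) (simp only: sum_permutes_Suc[where f = "\<lambda>i j. elem_coeff n y
      (int (conjugate_part l i) - int i + int j)"])
  also have "det_of (N - n) (\<lambda>i j. elem_coeff n y (int (conjugate_part l (Suc i)) - int (Suc i) + int (Suc j))) =
    det_of (N - n) (\<lambda>i j. elem_coeff n y (int (conjugate_part l (Suc i)) - int i + int j))"
    by (rule det_of_cong, rule arg_cong[of _ _ "elem_coeff n y"]) simp
  also have "\<dots> = det_of n (\<lambda>i j. y j ^ exponent l i) / det_of n (\<lambda>i j. y j ^ (n - Suc i))"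
    using dual_jacobi_trudi[OF l, of y] y by (simp add: eq_divide_eq)
  finally show ?thesis .
qed

lemma factorial_schur_eq:
  assumes "l \<in> box_partitions n k"
  shows "factorial_schur n l x a = det_of n (\<lambda>i j. factorial_power (x (Suc j)) a (exponent l i)) /
    det_of n (\<lambda>i j. x (Suc j) ^ (n - Suc i))"
  unfolding factorial_schur_def
  using det_of_factorial_power_decreasing[of n "\<lambda>j. x (Suc j)" a]
  by (simp add: exponent_def box_partitions_nth(1)[OF assms])

text \<open>
On a common eigenvector, \<open>S\<^sub>m\<close> acts by the quotient of the alternants of \<open>m\<close> and of the empty partition, so the
defining sum of the operator is the expansion of the factorial alternant.
\<close>

theorem S_tilde_eigenvector:
  fixes T x :: "nat \<Rightarrow> 'a::field"
  assumes E: "\<And>r. E_op N T q r v = (\<lambda>J. elem_coeff n (\<lambda>b. x (Suc b)) r * v J)"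
    and l: "l \<in> box_partitions n (N - n)" and n: "n \<le> N"
    and x: "det_of n (\<lambda>i j. x (Suc j) ^ (n - Suc i)) \<noteq> 0"
  shows "S_tilde N n T q l v = (\<lambda>J. factorial_schur n l x (rev_param N T) * v J)"
proof
  fix J
  let ?V = "det_of n (\<lambda>i j. x (Suc j) ^ (n - Suc i))"
  let ?D = "\<lambda>m. det_of n (\<lambda>i j.
    elem_sym (int (l ! i) - int (m ! j) - int i + int j) (n + l ! i - Suc i) (rev_param N T))"
  have "S_tilde N n T q l v J = (\<Sum>m | m \<in> box_partitions n (N - n) \<and> (\<forall>i<n. m ! i \<le> l ! i).
    (- 1) ^ (sum_list l - sum_list m) * ?D m * (det_of n (\<lambda>i j. x (Suc j) ^ exponent m i) / ?V * v J))"
    unfolding S_tilde_def by (rule sum.cong[OF refl]) (simp add: S_op_eigenvector[OF E _ x])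
  also have "\<dots> = det_of n (\<lambda>i j. factorial_power (x (Suc j)) (rev_param N T) (exponent l i)) / ?V * v J"
    unfolding factorial_alternant_expand[OF l n, of "\<lambda>j. x (Suc j)"]
    by (simp add: sum_divide_distrib sum_distrib_right mult.assoc)
  finally show "S_tilde N n T q l v J = factorial_schur n l x (rev_param N T) * v J"
    by (simp add: factorial_schur_eq[OF l])
qed

section \<open>Divided differences at the Bethe roots\<close>

lemma position_eq_exponent:
  assumes "l \<in> box_partitions n k" "1 \<le> i" "i \<le> n"
  shows "position l i = Suc (exponent l (n - i))"
  using assms by (simp add: position_def exponent_def box_partitions_nth(1)[OF assms(1)])

lemma positions_eq_exponents:
  assumes l: "l \<in> box_partitions n k"
  shows "positions l = Suc ` exponent l ` {0..<n}"
proof -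
  have "positions l = (\<lambda>i. Suc (exponent l (n - i))) ` {1..n}"
    unfolding positions_def box_partitions_nth(1)[OF l]
    by (rule image_cong) (use position_eq_exponent[OF l] in auto)
  also have "\<dots> = Suc ` exponent l ` (\<lambda>i. n - i) ` {1..n}" by (simp add: image_image)
  also have "(\<lambda>i. n - i) ` {1..n} = {0..<n}"
  proof (intro equalityI subsetI)
    fix x assume "x \<in> {0..<n}"
    then show "x \<in> (\<lambda>i. n - i) ` {1..n}" by (intro image_eqI[of _ _ "n - x"]) auto
  qed auto
  finally show ?thesis .
qed

lemma bij_betw_positions:
  assumes "n \<le> N"
  shows "bij_betw positions (box_partitions n (N - n)) {J. J \<subseteq> {1..N} \<and> card J = n}"
proof -
  have "bij_betw (image Suc) {R. R \<subseteq> {0..<N} \<and> card R = n} {J. J \<subseteq> {1..N} \<and> card J = n}"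
  proof (rule bij_betwI[of _ _ _ "image (\<lambda>j. j - 1)"])
    show "image Suc \<in> {R. R \<subseteq> {0..<N} \<and> card R = n} \<rightarrow> {J. J \<subseteq> {1..N} \<and> card J = n}"
      by (auto simp: card_image)
    show "image (\<lambda>j. j - 1) \<in> {J. J \<subseteq> {1..N} \<and> card J = n} \<rightarrow> {R. R \<subseteq> {0..<N} \<and> card R = n}"
    proof
      fix J assume J: "J \<in> {J. J \<subseteq> {1..N} \<and> card J = n}"
      have "inj_on (\<lambda>j. j - 1) J"
      proof (rule inj_onI)
        fix x y assume "x \<in> J" "y \<in> J" "x - 1 = y - 1"
        then have "1 \<le> x" "1 \<le> y" using J by auto
        then show "x = y" using \<open>x - 1 = y - 1\<close> by linarith
      qed
      then show "(\<lambda>j. j - 1) ` J \<in> {R. R \<subseteq> {0..<N} \<and> card R = n}"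
        using J by (auto simp: card_image subset_iff)
    qed
    show "Suc ` (\<lambda>j. j - 1) ` J = J" if J: "J \<in> {J. J \<subseteq> {1..N} \<and> card J = n}" for J
    proof -
      have "(\<lambda>j. Suc (j - 1)) ` J = (\<lambda>j. j) ` J" by (rule image_cong) (use J in auto)
      then show ?thesis by (simp add: image_image)
    qed
  qed (simp add: image_image)
  from bij_betw_trans[OF bij_betw_exponents[OF assms] this]
  have "bij_betw (image Suc \<circ> (\<lambda>l. exponent l ` {0..<n})) (box_partitions n (N - n)) {J. J \<subseteq> {1..N} \<and> card J = n}" .
  then show ?thesis
    by (rule bij_betw_cong[THEN iffD1, rotated]) (simp add: positions_eq_exponents)
qed

lemma position_less:
  assumes l: "l \<in> box_partitions n k" and "i < j" "j < n"
  shows "position l (Suc i) < position l (Suc j)"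
  using exponent_less[OF l, of "n - Suc j" "n - Suc i"] assms by (simp add: position_eq_exponent[OF l])

lemma bij_betw_position:
  assumes l: "l \<in> box_partitions n k"
  shows "bij_betw (\<lambda>i. position l (Suc i)) {0..<n} (positions l)"
proof (rule bij_betw_imageI)
  show "inj_on (\<lambda>i. position l (Suc i)) {0..<n}"
    by (rule linorder_inj_onI') (use position_less[OF l] in fastforce)
  have "positions l = position l ` Suc ` {0..<n}"
    by (simp only: positions_def box_partitions_nth(1)[OF l] image_Suc_atLeastLessThan
      atLeastLessThanSuc_atLeastAtMost One_nat_def)
  then show "(\<lambda>i. position l (Suc i)) ` {0..<n} = positions l" by (simp only: image_image)
qed

lemma sites_upto_positions:
  assumes l: "l \<in> box_partitions n (N - n)" and n: "n \<le> N"
  shows "sites_upto (positions l) N = map (\<lambda>i. position l (Suc i)) [0..<n]"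
proof (rule strict_sorted_equal)
  have "positions l \<subseteq> {1..N}" using bij_betwE[OF bij_betw_positions[OF n]] l by auto
  then have "set (sites_upto (positions l) N) = positions l" by (auto simp: sites_upto_def)
  moreover have "set (map (\<lambda>i. position l (Suc i)) [0..<n]) = positions l"
    using bij_betw_imp_surj_on[OF bij_betw_position[OF l]] by simp
  ultimately show "set (sites_upto (positions l) N) = set (map (\<lambda>i. position l (Suc i)) [0..<n])" by simp
  show "sorted_wrt (<) (sites_upto (positions l) N)"
    unfolding sites_upto_def by (rule sorted_wrt_filter[OF sorted_wrt_upt])
  show "sorted_wrt (<) (map (\<lambda>i. position l (Suc i)) [0..<n])"
    using position_less[OF l] by (simp add: sorted_wrt_iff_nth_less)
qed

lemma exponent_dual_partition:
  assumes l: "l \<in> box_partitions n (N - n)" and n: "n \<le> N" and i: "i < n"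
  shows "exponent (dual_partition (N - n) l) i = N - Suc (exponent l (n - Suc i))"
    and "dual_partition (N - n) l \<in> box_partitions n (N - n)"
proof -
  let ?k = "N - n"
  have len: "length l = n" "length (dual_partition ?k l) = n"
    using box_partitions_nth(1)[OF l] by (simp_all add: dual_partition_def)
  have nth: "dual_partition ?k l ! i = ?k - l ! (n - Suc i)" if "i < n" for i
    using that len by (simp add: dual_partition_def rev_nth)
  show "exponent (dual_partition ?k l) i = N - Suc (exponent l (n - Suc i))"
    using box_partitions_nth(2)[OF l, of "n - Suc i"] i n
    by (simp add: exponent_def len nth[OF i])
  show "dual_partition ?k l \<in> box_partitions n ?k"
    unfolding box_partitions_def
  proof (intro CollectI conjI len ballI)
    show "sorted_wrt (\<ge>) (dual_partition ?k l)"
      unfolding sorted_wrt_iff_nth_less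
    proof (intro allI impI)
      fix a b assume ab: "a < b" "b < length (dual_partition ?k l)"
      then have "l ! (n - Suc a) \<le> l ! (n - Suc b)"
        using len by (intro box_partitions_nth(3)[OF l]) auto
      then show "dual_partition ?k l ! b \<le> dual_partition ?k l ! a" using ab len by (simp add: nth)
    qed
  qed (auto simp: dual_partition_def)
qed

lemma factorial_power_rev_param: "factorial_power x (rev_param N T) N = factorial_power x T N"
  unfolding factorial_power_def
  by (rule prod.reindex_bij_witness[of _ "\<lambda>i. N + 1 - i" "\<lambda>i. N + 1 - i"]) (auto simp: rev_param_def)

text \<open>
A polynomial form of \<open>((u|T)\<^sup>N - (w|T)\<^sup>N) / (u - w)\<close>, which makes sense also for \<open>u = w\<close>. Its two factors are the
entries of the alternants of the dual partition and of the partition.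
\<close>

definition divided_difference :: "nat \<Rightarrow> (nat \<Rightarrow> 'a::comm_ring_1) \<Rightarrow> 'a \<Rightarrow> 'a \<Rightarrow> 'a" where
  "divided_difference N T u w =
     (\<Sum>r<N. factorial_power u T (N - Suc r) * factorial_power w (rev_param N T) r)"

text \<open>
Since \<open>t\<^bsub>r+1\<^esub> = T\<^bsub>N-r\<^esub>\<close>, the sum telescopes.
\<close>

lemma divided_difference:
  "(u - w) * divided_difference N T u w = factorial_power u T N - factorial_power w T N"
proof -
  define h where "h r = factorial_power u T (N - r) * factorial_power w (rev_param N T) r" for r
  have "(u - w) * divided_difference N T u w = (\<Sum>r<N. h r - h (Suc r))"
    unfolding divided_difference_def sum_distrib_left
  proof (rule sum.cong[OF refl])
    fix r assume "r \<in> {..<N}"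
    then have "N - r = Suc (N - Suc r)" by auto
    then have u: "factorial_power u T (N - r) = (u - T (N - r)) * factorial_power u T (N - Suc r)"
      using factorial_power_Suc[of u T "N - Suc r"] by simp
    have w: "factorial_power w (rev_param N T) (Suc r) =
      (w - T (N - r)) * factorial_power w (rev_param N T) r"
      using factorial_power_Suc[of w "rev_param N T" r] by (simp add: rev_param_def)
    show "(u - w) * (factorial_power u T (N - Suc r) * factorial_power w (rev_param N T) r) =
      h r - h (Suc r)" unfolding h_def u w by (simp add: algebra_simps)
  qed
  also have "\<dots> = h 0 - h N" by (rule sum_lessThan_telescope')
  finally show ?thesis by (simp add: h_def factorial_power_rev_param) (simp add: factorial_power_def)
qed

text \<open>
Passing to the dual partition replaces each exponent \<open>r\<close> by \<open>N - 1 - r\<close> and reverses the rows, which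
costs the sign of the reversal.
\<close>

lemma schur_pairing:
  fixes T x y :: "nat \<Rightarrow> 'a::comm_ring_1"
  assumes n: "n \<le> N"
  shows "(\<Sum>l\<in>box_partitions n (N - n).
      det_of n (\<lambda>i j. factorial_power (x j) T (exponent (dual_partition (N - n) l) i)) *
      det_of n (\<lambda>i j. factorial_power (y j) (rev_param N T) (exponent l i))) =
    of_int (sign (reversal n)) * det_of n (\<lambda>i j. divided_difference N T (x i) (y j))"
proof -
  let ?A = "\<lambda>i r. factorial_power (x i) T (N - Suc r)"
  let ?B = "\<lambda>r j. factorial_power (y j) (rev_param N T) r"
  have "det_of n (\<lambda>i j. factorial_power (x j) T (exponent (dual_partition (N - n) l) i)) =
    of_int (sign (reversal n)) * det_of n (\<lambda>i j. ?A i (exponent l j))" if l: "l \<in> box_partitions n (N - n)" for l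
  proof -
    have "det_of n (\<lambda>i j. factorial_power (x j) T (exponent (dual_partition (N - n) l) i)) =
      det_of n (\<lambda>i j. ?A j (exponent l (n - Suc i)))"
      by (rule det_of_cong) (simp add: exponent_dual_partition[OF l n])
    also have "\<dots> = of_int (sign (reversal n)) * det_of n (\<lambda>i j. ?A j (exponent l i))"
      by (rule det_of_reverse[where f = "\<lambda>i j. ?A j (exponent l i)"])
    also have "det_of n (\<lambda>i j. ?A j (exponent l i)) = det_of n (\<lambda>i j. ?A i (exponent l j))"
      by (rule det_of_transpose[where f = "\<lambda>i j. ?A i (exponent l j)"])
    finally show ?thesis .
  qed
  then show ?thesis
    unfolding divided_difference_def cauchy_binet[OF n, of ?A ?B] by (simp add: sum_distrib_left mult.assoc)
qed

text \<open>
The product over all ordered pairs differs from the square of the Vandermonde product by the sign of the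
reversal, the same sign as in \<open>schur_pairing\<close>.
\<close>

lemma vandermonde_product:
  fixes x :: "nat \<Rightarrow> 'a::comm_ring_1"
  shows "of_int (sign (reversal n)) * (\<Prod>i=0..<n. \<Prod>j\<in>{0..<n} - {i}. x i - x j) =
    det_of n (\<lambda>i j. x j ^ (n - Suc i)) * det_of n (\<lambda>i j. x j ^ (n - Suc i))"
proof -
  let ?s = "of_int (sign (reversal n)) :: 'a"
  let ?V = "det_of n (\<lambda>i j. x j ^ i)" and ?V' = "det_of n (\<lambda>i j. x j ^ (n - Suc i))"
  have rev: "?V' = ?s * ?V" by (rule det_of_reverse)
  have "det_of n (\<lambda>i j. x (n - Suc j) ^ i) = ?s * ?V"
    using det_of_reverse[of n "\<lambda>i j. x i ^ j"]
    by (simp add: det_of_transpose[of n "\<lambda>i j. x (n - Suc j) ^ i"] det_of_transpose[of n "\<lambda>i j. x j ^ i"])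
  then have "?V' = (\<Prod>i=0..<n. \<Prod>j=0..<i. x (n - Suc i) - x (n - Suc j))"
    unfolding rev vandermonde by simp
  also have "\<dots> = (\<Prod>i=0..<n. \<Prod>j=0..<n - Suc i. x i - x (n - Suc j))"
    by (rule prod.reindex_bij_witness[of _ "\<lambda>i. n - Suc i" "\<lambda>i. n - Suc i"]) auto
  also have "\<dots> = (\<Prod>i=0..<n. \<Prod>j=Suc i..<n. x i - x j)"
    by (rule prod.cong[OF refl], rule prod.reindex_bij_witness[of _ "\<lambda>i. n - Suc i" "\<lambda>i. n - Suc i"]) auto
  finally have decreasing: "?V' = (\<Prod>i=0..<n. \<Prod>j=Suc i..<n. x i - x j)" .
  have "?V * ?V' = (\<Prod>i=0..<n. (\<Prod>j=0..<i. x i - x j) * (\<Prod>j=Suc i..<n. x i - x j))"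
    unfolding vandermonde decreasing by (simp add: prod.distrib)
  also have "\<dots> = (\<Prod>i=0..<n. \<Prod>j\<in>{0..<n} - {i}. x i - x j)"
  proof (rule prod.cong[OF refl])
    fix i assume "i \<in> {0..<n}"
    then have "{0..<n} - {i} = {0..<i} \<union> {Suc i..<n}" by auto
    then show "(\<Prod>j=0..<i. x i - x j) * (\<Prod>j=Suc i..<n. x i - x j) = (\<Prod>j\<in>{0..<n} - {i}. x i - x j)"
      by (simp add: prod.union_disjoint)
  qed
  finally have "?s * (\<Prod>i=0..<n. \<Prod>j\<in>{0..<n} - {i}. x i - x j) = (?s * ?V) * ?V'"
    by (simp only: mult.assoc)
  then show ?thesis by (simp only: rev[symmetric])
qed

lemma det_of_zero_row:
  assumes "i < n" "\<And>j. j < n \<Longrightarrow> f i j = 0"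
  shows "det_of n f = 0"
  unfolding det_of_leibniz
proof (rule sum.neutral, rule ballI)
  fix p assume "p \<in> {p. p permutes {0..<n}}"
  then have "p i < n" using permutes_in_image[of p "{0..<n}" i] assms(1) by simp
  then have "(\<Prod>i=0..<n. f i (p i)) = 0" using assms by (intro prod_zero) (auto intro: bexI[of _ i])
  then show "of_int (sign p) * (\<Prod>i=0..<n. f i (p i)) = 0" by simp
qed

text \<open>
The Bethe equation in abstract form: \<open>N\<close> distinct points at which \<open>(x|T)\<^sup>N\<close> takes the same value.
\<close>

locale root_system =
  fixes N :: nat and T Y :: "nat \<Rightarrow> 'a::field" and \<kappa> :: 'a
  assumes N: "0 < N"
    and inj: "inj_on Y {1..N}"
    and root: "\<And>j. j \<in> {1..N} \<Longrightarrow> factorial_power (Y j) T N = \<kappa>"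
begin

lemma factorization: "(\<Prod>i=1..N. [:- T i, 1:]) - [:\<kappa>:] = (\<Prod>j=1..N. [:- Y j, 1:])"
proof (rule ccontr)
  let ?P = "\<Prod>i=1..N. [:- T i, 1:]" and ?Q = "\<Prod>j=1..N. [:- Y j, 1:]"
  let ?D = "?P - [:\<kappa>:] - ?Q"
  assume "?P - [:\<kappa>:] \<noteq> ?Q"
  then have nz: "?D \<noteq> 0" by simp
  have deg: "degree (\<Prod>i=1..N. [:- a i, 1:]) = N" for a :: "nat \<Rightarrow> 'a"
    by (subst degree_prod_eq_sum_degree) auto
  have lead: "poly.coeff (\<Prod>i=1..N. [:- a i, 1:]) N = 1" for a :: "nat \<Rightarrow> 'a"
    using lead_coeff_prod[of "\<lambda>i. [:- a i, 1:]" "{1..N}"] unfolding deg by simp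
  have "poly.coeff [:\<kappa>:] N = 0" using N by (cases N) auto
  then have "poly.coeff ?D N = 0" by (simp only: coeff_diff lead) simp
  moreover have "degree ?D \<le> N"
    by (intro degree_diff_le) (simp_all only: deg order_refl degree_pCons_0 le0)
  ultimately have "degree ?D < N"
    using nz N by (metis leading_coeff_0_iff le_neq_implies_less)
  moreover have "poly ?D (Y j) = 0" if j: "j \<in> {1..N}" for j
  proof -
    have "poly ?P (Y j) = \<kappa>" using root[OF j] by (simp add: poly_prod factorial_power_def)
    moreover have "poly ?Q (Y j) = 0" using j by (auto simp: poly_prod intro!: prod_zero bexI[of _ j])
    ultimately show ?thesis by simp
  qed
  then have "Y ` {1..N} \<subseteq> {x. poly ?D x = 0}" by auto
  then have "card (Y ` {1..N}) \<le> degree ?D"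
    using card_mono[OF poly_roots_finite[OF nz]] card_poly_roots_bound[OF nz] by (meson le_trans)
  ultimately show False using card_image[OF inj] by simp
qed

text \<open>
For equal roots, the divided difference is evaluated as a polynomial in \<open>u\<close>: multiplied by \<open>u - y\<^sub>i\<close> it
gives the full product of \<open>factorization\<close>, and this factor cancels.
\<close>

lemma divided_difference_roots:
  assumes "i \<in> {1..N}" "j \<in> {1..N}"
  shows "divided_difference N T (Y i) (Y j) = (if i = j then \<Prod>m\<in>{1..N} - {i}. Y i - Y m else 0)"
proof (cases "i = j")
  case False
  then have "Y i - Y j \<noteq> 0" using inj_onD[OF inj] assms by auto
  then show ?thesis
    using divided_difference[of "Y i" "Y j" N T] root[OF assms(1)] root[OF assms(2)] False by simp
next
  case True
  \<comment> \<open>Both arguments cannot be set to the same root before dividing, so the first one is made an indeterminate.\<close>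
  let ?T = "\<lambda>i. [:T i:]" and ?w = "[:Y i:]" and ?X = "[:0, 1:] :: 'a poly"
  let ?G = "divided_difference N ?T ?X ?w"
  have const: "factorial_power [:a:] (\<lambda>i. [:b i:]) r = [:factorial_power a b r:]" for a :: 'a and b r
    by (induction r) (simp_all add: factorial_power_Suc, simp add: factorial_power_def one_pCons)
  have X: "factorial_power ?X (\<lambda>i. [:b i:]) r = (\<Prod>i=1..r. [:- b i, 1:])" for b :: "nat \<Rightarrow> 'a" and r
    by (simp add: factorial_power_def)
  have "[:- Y i, 1:] * ?G = (\<Prod>j=1..N. [:- Y j, 1:])"
    using divided_difference[of ?X ?w N ?T] factorization root[OF assms(1)] by (simp add: X const)
  also have "\<dots> = [:- Y i, 1:] * (\<Prod>m\<in>{1..N} - {i}. [:- Y m, 1:])"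
    by (rule prod.remove) (use assms in auto)
  finally have "?G = (\<Prod>m\<in>{1..N} - {i}. [:- Y m, 1:])"
    by (rule mult_left_cancel[THEN iffD1, rotated]) simp
  then have "poly ?G (Y i) = (\<Prod>m\<in>{1..N} - {i}. Y i - Y m)" by (simp add: poly_prod)
  moreover have "rev_param N ?T = (\<lambda>i. [:rev_param N T i:])" by (simp add: rev_param_def fun_eq_iff)
  then have "poly ?G (Y i) = divided_difference N T (Y i) (Y i)"
    by (simp add: divided_difference_def poly_sum const X poly_prod factorial_power_def[of "Y i" T] mult.commute)
  ultimately show ?thesis using True by simp
qed

lemma root_vandermonde_nonzero:
  assumes l: "l \<in> box_partitions n (N - n)" and n: "n \<le> N"
  shows "det_of n (\<lambda>i j. Y (position l (Suc j)) ^ (n - Suc i)) \<noteq> 0"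
proof -
  have "inj_on (Y \<circ> (\<lambda>i. position l (Suc i))) {0..<n}"
    using bij_betw_position[OF l] inj_on_subset[OF inj] bij_betwE[OF bij_betw_positions[OF n]] l
    by (intro comp_inj_on) (auto simp: bij_betw_def)
  from vandermonde_nonzero[OF this]
  show ?thesis
    using det_of_reverse[of n "\<lambda>i j. Y (position l (Suc j)) ^ i"] by (simp add: sign_def)
qed

text \<open>
For different \<open>\<alpha>\<close> and \<open>\<beta>\<close>, some root of \<open>y\<^sub>\<alpha>\<close> is not in \<open>y\<^sub>\<beta>\<close>, and its row of divided differences vanishes.
For equal ones the matrix is diagonal; the factors between two roots of \<open>y\<^sub>\<alpha>\<close> cancel the Vandermonde
determinants and the others form the product on the right.
\<close>

lemma on_shell_orthogonality:
  assumes n: "0 < n" "n \<le> N" and \<alpha>: "\<alpha> \<in> box_partitions n (N - n)" and \<beta>: "\<beta> \<in> box_partitions n (N - n)"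
  shows "(\<Sum>l\<in>box_partitions n (N - n).
      factorial_schur n (dual_partition (N - n) l) (\<lambda>j. Y (position \<alpha> j)) T *
      factorial_schur n l (\<lambda>j. Y (position \<beta> j)) (rev_param N T)) =
    (if \<alpha> = \<beta> then \<Prod>i\<in>positions \<alpha>. \<Prod>j\<in>{1..N} - positions \<alpha>. Y i - Y j else 0)"
proof -
  let ?X = "box_partitions n (N - n)"
  define x where "x i = Y (position \<alpha> (Suc i))" for i
  define y where "y i = Y (position \<beta> (Suc i))" for i
  let ?V = "\<lambda>x. det_of n (\<lambda>i j. x j ^ (n - Suc i))" and ?s = "of_int (sign (reversal n)) :: 'a"
  let ?e = "\<Prod>i\<in>positions \<alpha>. \<Prod>j\<in>{1..N} - positions \<alpha>. Y i - Y j"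
  let ?G = "\<lambda>i j. divided_difference N T (x i) (y j)"
  have pos: "positions l \<subseteq> {1..N}" "card (positions l) = n" if "l \<in> ?X" for l
    using bij_betwE[OF bij_betw_positions[OF n(2)]] that by auto
  have in_pos: "position l (Suc i) \<in> positions l" if "l \<in> ?X" "i < n" for l i
    using bij_betwE[OF bij_betw_position[OF that(1)]] that(2) by simp
  have "(\<Sum>l\<in>?X. factorial_schur n (dual_partition (N - n) l) (\<lambda>j. Y (position \<alpha> j)) T *
      factorial_schur n l (\<lambda>j. Y (position \<beta> j)) (rev_param N T)) =
    (\<Sum>l\<in>?X. det_of n (\<lambda>i j. factorial_power (x j) T (exponent (dual_partition (N - n) l) i)) *
      det_of n (\<lambda>i j. factorial_power (y j) (rev_param N T) (exponent l i))) / (?V x * ?V y)"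
    unfolding sum_divide_distrib
  proof (rule sum.cong[OF refl])
    fix l assume l: "l \<in> ?X"
    show "factorial_schur n (dual_partition (N - n) l) (\<lambda>j. Y (position \<alpha> j)) T *
        factorial_schur n l (\<lambda>j. Y (position \<beta> j)) (rev_param N T) =
      det_of n (\<lambda>i j. factorial_power (x j) T (exponent (dual_partition (N - n) l) i)) *
      det_of n (\<lambda>i j. factorial_power (y j) (rev_param N T) (exponent l i)) / (?V x * ?V y)"
      unfolding factorial_schur_eq[OF l] factorial_schur_eq[OF exponent_dual_partition(2)[OF l n(2) n(1)]]
      by (simp add: x_def y_def)
  qed
  also have "\<dots> = ?s * det_of n ?G / (?V x * ?V y)" by (simp only: schur_pairing[OF n(2)])
  also have "\<dots> = (if \<alpha> = \<beta> then ?e else 0)"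
  proof (cases "\<alpha> = \<beta>")
    case False
    then have "positions \<alpha> \<noteq> positions \<beta>"
      using bij_betw_imp_inj_on[OF bij_betw_positions[OF n(2)]] \<alpha> \<beta> by (auto dest: inj_onD)
    then have "\<not> positions \<alpha> \<subseteq> positions \<beta>"
      using card_subset_eq[of "positions \<beta>" "positions \<alpha>"] pos[OF \<alpha>] pos[OF \<beta>] finite_subset by auto
    then obtain p where p: "p \<in> positions \<alpha>" "p \<notin> positions \<beta>" by blast
    have "p \<in> (\<lambda>i. position \<alpha> (Suc i)) ` {0..<n}"
      using p(1) bij_betw_imp_surj_on[OF bij_betw_position[OF \<alpha>]] by simp
    then obtain i where i: "i < n" "position \<alpha> (Suc i) \<notin> positions \<beta>" using p(2) by auto
    have "?G i j = 0" if "j < n" for j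
    proof -
      have "position \<alpha> (Suc i) \<in> {1..N}" "position \<beta> (Suc j) \<in> {1..N}"
        using in_pos[OF \<alpha> i(1)] in_pos[OF \<beta> that] pos(1)[OF \<alpha>] pos(1)[OF \<beta>] by blast+
      moreover have "position \<alpha> (Suc i) \<noteq> position \<beta> (Suc j)" using in_pos[OF \<beta> that] i(2) by auto
      ultimately show ?thesis by (simp only: x_def y_def divided_difference_roots if_False)
    qed
    then have "det_of n ?G = 0" by (rule det_of_zero_row[OF i(1)])
    then show ?thesis using False by simp
  next
    case True
    let ?I = "positions \<alpha>" and ?p = "\<lambda>i. position \<alpha> (Suc i)"
    note bij = bij_betw_position[OF \<alpha>]
    have finI: "finite ?I" using pos(1)[OF \<alpha>] finite_subset by blast
    have "?G i j = (if i = j then \<Prod>m\<in>{1..N} - {?p i}. Y (?p i) - Y m else 0)" if "i < n" "j < n" for i j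
    proof -
      have "?p i \<in> {1..N}" "?p j \<in> {1..N}" using in_pos[OF \<alpha>] that pos(1)[OF \<alpha>] by blast+
      moreover have "?p i = ?p j \<longleftrightarrow> i = j"
        using inj_on_eq_iff[OF bij_betw_imp_inj_on[OF bij]] that by simp
      ultimately show ?thesis
        unfolding x_def y_def True[symmetric] by (simp only: divided_difference_roots)
    qed
    then have "det_of n ?G = (\<Prod>i=0..<n. \<Prod>m\<in>{1..N} - {?p i}. Y (?p i) - Y m)"
      by (subst det_of_lower_triangular) auto
    also have "\<dots> = (\<Prod>p\<in>?I. \<Prod>m\<in>{1..N} - {p}. Y p - Y m)"
      by (rule prod.reindex_bij_betw[OF bij])
    also have "\<dots> = (\<Prod>p\<in>?I. (\<Prod>m\<in>{1..N} - ?I. Y p - Y m) * (\<Prod>m\<in>?I - {p}. Y p - Y m))"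
    proof (rule prod.cong[OF refl])
      fix p assume "p \<in> ?I"
      then have "{1..N} - {p} = ({1..N} - ?I) \<union> (?I - {p})" using pos(1)[OF \<alpha>] by auto
      then show "(\<Prod>m\<in>{1..N} - {p}. Y p - Y m) =
        (\<Prod>m\<in>{1..N} - ?I. Y p - Y m) * (\<Prod>m\<in>?I - {p}. Y p - Y m)"
        by (simp only:) (rule prod.union_disjoint, use finI in auto)
    qed
    also have "\<dots> = ?e * (\<Prod>p\<in>?I. \<Prod>m\<in>?I - {p}. Y p - Y m)" by (rule prod.distrib)
    also have "(\<Prod>p\<in>?I. \<Prod>m\<in>?I - {p}. Y p - Y m) = (\<Prod>i=0..<n. \<Prod>j\<in>{0..<n} - {i}. x i - x j)"
    proof -
      have "(\<Prod>p\<in>?I. \<Prod>m\<in>?I - {p}. Y p - Y m) = (\<Prod>i=0..<n. \<Prod>m\<in>?I - {?p i}. Y (?p i) - Y m)"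
        by (rule prod.reindex_bij_betw[OF bij, symmetric])
      also have "\<dots> = (\<Prod>i=0..<n. \<Prod>j\<in>{0..<n} - {i}. x i - x j)"
      proof (rule prod.cong[OF refl])
        fix i assume i: "i \<in> {0..<n}"
        have "bij_betw ?p ({0..<n} - {i}) (?I - {?p i})"
          by (rule bij_betw_DiffI[OF bij]) (use i in_pos[OF \<alpha>] in \<open>auto simp: bij_betw_def\<close>)
        from prod.reindex_bij_betw[OF this, of "\<lambda>m. Y (?p i) - Y m"]
        show "(\<Prod>m\<in>?I - {?p i}. Y (?p i) - Y m) = (\<Prod>j\<in>{0..<n} - {i}. x i - x j)"
          by (simp add: x_def)
      qed
      finally show ?thesis .
    qed
    finally have "?s * det_of n ?G = ?e * (?s * (\<Prod>i=0..<n. \<Prod>j\<in>{0..<n} - {i}. x i - x j))" by simp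
    then have "?s * det_of n ?G = ?e * (?V x * ?V x)" by (simp only: vandermonde_product)
    moreover have "?V x \<noteq> 0"
      unfolding x_def by (rule root_vandermonde_nonzero[OF \<alpha> n(2)])
    moreover have "y = x" using True by (simp add: x_def[abs_def] y_def[abs_def])
    ultimately show ?thesis using True by simp
  qed
  finally show ?thesis .
qed

end

section \<open>The Bethe roots\<close>

lemma fps_to_fls_prod: "fps_to_fls (\<Prod>i\<in>I. f i) = (\<Prod>i\<in>I. fps_to_fls (f i :: 'a::comm_ring_1 fps))"
  by (induction I rule: infinite_finite_induct) (simp_all add: fls_times_fps_to_fls)

lemma fps_prod_nth_0: "(\<Prod>i\<in>I. f i :: 'a::comm_ring_1 fps) $ 0 = (\<Prod>i\<in>I. f i $ 0)"
  by (induction I rule: infinite_finite_induct) simp_all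

text \<open>
With \<open>z = t\<^sub>j + w\<close> the equation reads \<open>f(w) = c\<close> for a power series \<open>f\<close> with zero constant and nonzero linear
term, so \<open>w\<close> is the compositional inverse of \<open>f\<close> applied to \<open>c\<close>.
\<close>

lemma fps_root_lift:
  fixes t :: "nat \<Rightarrow> 'a::field" and c :: "'a fps"
  assumes "inj_on t {1..N}" "j \<in> {1..N}" "c $ 0 = 0"
  obtains z where "z $ 0 = t j" "(\<Prod>i=1..N. z - fps_const (t i)) = c"
proof -
  \<comment> \<open>The left-hand side of the equation as a series in \<open>w = z - t\<^sub>j\<close>; the factor for \<open>i = j\<close> is \<open>w\<close> itself.\<close>
  define f where "f = (\<Prod>i=1..N. fps_const (t j - t i) + fps_X)"
  define h where "h = (\<Prod>i\<in>{1..N} - {j}. fps_const (t j - t i) + fps_X)"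
  have f: "f = fps_X * h"
    unfolding f_def h_def by (subst prod.remove[OF _ assms(2)]) simp_all
  have "h $ 0 = (\<Prod>i\<in>{1..N} - {j}. t j - t i)"
    unfolding h_def fps_prod_nth_0 by simp
  then have "h $ 0 \<noteq> 0" using inj_onD[OF assms(1)] assms(2) by auto
  then have f1: "f $ 0 = 0" "f $ 1 \<noteq> 0" by (simp_all add: f)
  define w where "w = fps_inv f oo c"
  have inv0: "fps_inv f $ 0 = 0" by (simp add: fps_inv_def)
  then have w0: "w $ 0 = 0" by (simp add: w_def)
  have "f oo w = (f oo fps_inv f) oo c"
    unfolding w_def by (rule fps_compose_assoc[OF assms(3) inv0])
  also have "\<dots> = c" using assms(3) by (simp add: fps_inv_right[OF f1])
  finally have "(\<Prod>i=1..N. fps_const (t j - t i) + w) = c"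
    by (simp add: f_def fps_compose_prod_distrib[OF w0] fps_compose_add_distrib w0)
  moreover have "fps_const (t j - t i) + w = (fps_const (t j) + w) - fps_const (t i)" for i
    by (simp flip: fps_const_sub)
  ultimately show thesis using w0 by (intro that[of "fps_const (t j) + w"]) simp_all
qed

lemma puiseux_var_inj: "inj_on (puiseux_var :: nat \<Rightarrow> 'n::finite puiseux) {1..CARD('n)}"
proof (rule inj_onI)
  fix i j assume i: "i \<in> {1..CARD('n)}" and j: "j \<in> {1..CARD('n)}"
    and eq: "(puiseux_var i :: 'n puiseux) = puiseux_var j"
  let ?e = "\<lambda>m. if m = i then 1 else 0 :: rat"
  have "puiseux_coeff (puiseux_var i :: 'n puiseux) ?e = 1" using i by (simp add: puiseux_coeff_var)
  then have "puiseux_coeff (puiseux_var j :: 'n puiseux) ?e = 1" by (simp only: eq)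
  then have "?e = (\<lambda>m. if m = j then 1 else 0)"
    using j by (simp add: puiseux_coeff_var split: if_splits)
  from fun_cong[OF this, of i] show "i = j" by (simp split: if_splits)
qed

text \<open>
The lifted roots have the distinct constant terms \<open>t\<^sub>j\<close>, so they are \<open>N\<close> distinct roots of a polynomial of
degree \<open>N\<close>. Any other solution is one of them, and its constant term says which one; this is the
uniqueness that the definite description requires.
\<close>

lemma root_system_bethe_root:
  assumes "0 < n"
  shows "root_system CARD('n) Fq_T (bethe_root n :: nat \<Rightarrow> 'n::finite Fq) ((- 1) ^ (n - 1) * Fq_q)"
proof -
  let ?N = "CARD('n)" and ?\<kappa> = "(- 1) ^ (n - 1) * Fq_q :: 'n Fq"
  define t :: "nat \<Rightarrow> 'n puiseux" where "t i = puiseux_var (?N + 1 - i)" for i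
  have t: "rev_param ?N Fq_T i = fls_const (t i)" for i
    by (simp add: rev_param_def Fq_T_def t_def)
  have inj_t: "inj_on t {1..?N}"
  proof (rule inj_onI)
    fix i j assume i: "i \<in> {1..?N}" and j: "j \<in> {1..?N}" and "t i = t j"
    then have "?N + 1 - i = ?N + 1 - j"
      by (intro inj_onD[OF puiseux_var_inj[where 'n = 'n]]) (auto simp: t_def)
    then show "i = j" using i j by auto
  qed
  have root_iff: "(\<Prod>i=1..?N. y - rev_param ?N Fq_T i) + (- 1) ^ n * Fq_q = 0 \<longleftrightarrow>
    factorial_power y Fq_T ?N = ?\<kappa>" for y :: "'n Fq"
  proof -
    have "(- 1) ^ n = - ((- 1) ^ (n - 1) :: 'n Fq)" using assms by (cases n) simp_all
    moreover have "(\<Prod>i=1..?N. y - rev_param ?N Fq_T i) = factorial_power y Fq_T ?N"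
      unfolding factorial_power_rev_param[of y ?N Fq_T, symmetric] by (simp add: factorial_power_def)
    ultimately show ?thesis by simp
  qed
  define is_root where "is_root j y \<longleftrightarrow>
    (\<Prod>i=1..?N. y - rev_param ?N Fq_T i) + (- 1) ^ n * Fq_q = 0 \<and>
    0 \<le> fls_subdegree y \<and> fls_const (fls_nth y 0) = rev_param ?N Fq_T j" for j and y :: "'n Fq"
  have "\<exists>y. is_root j y" if j: "j \<in> {1..?N}" for j
  proof -
    \<comment> \<open>The right-hand side is \<open>q\<close> up to sign, in terms of the variable \<open>q\<^bsup>1/N\<^esup>\<close>.\<close>
    obtain z where z: "z $ 0 = t j" "(\<Prod>i=1..?N. z - fps_const (t i)) = (- 1) ^ (n - 1) * fps_X ^ ?N"
      by (rule fps_root_lift[OF inj_t j, of "(- 1) ^ (n - 1) * fps_X ^ ?N"]) simp_all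
    have "(\<Prod>i=1..?N. fps_to_fls z - rev_param ?N Fq_T i) = fps_to_fls (\<Prod>i=1..?N. z - fps_const (t i))"
      unfolding fps_to_fls_prod by (simp add: t)
    also have "\<dots> = ?\<kappa>"
      unfolding z(2) by (simp add: Fq_q_def fls_times_fps_to_fls fps_to_fls_power)
    finally have "is_root j (fps_to_fls z)"
      unfolding is_root_def root_iff
      using factorial_power_rev_param[of "fps_to_fls z" ?N Fq_T] z(1) fls_subdegree_fls_to_fps_gt0[of z]
      by (simp add: factorial_power_def t)
    then show ?thesis ..
  qed
  then obtain Y where Y: "\<And>j. j \<in> {1..?N} \<Longrightarrow> is_root j (Y j)" by metis
  have const: "fls_nth (Y j) 0 = t j" if "j \<in> {1..?N}" for j
  proof -
    have "fls_const (fls_nth (Y j) 0) = fls_const (t j)" using Y[OF that] by (simp add: is_root_def t)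
    from arg_cong[OF this, of "\<lambda>f. fls_nth f 0"] show ?thesis by simp
  qed
  interpret root_system ?N Fq_T Y ?\<kappa>
  proof
    show "inj_on Y {1..?N}"
      by (rule inj_onI) (metis const inj_onD[OF inj_t])
    show "factorial_power (Y j) Fq_T ?N = ?\<kappa>" if "j \<in> {1..?N}" for j
      using Y[OF that] unfolding is_root_def root_iff by blast
  qed simp
  have unique: "y = Y j" if j: "j \<in> {1..?N}" and y: "is_root j y" for j y
  proof -
    have "factorial_power y Fq_T ?N = ?\<kappa>" using y unfolding is_root_def root_iff by blast
    then have "poly (\<Prod>j=1..?N. [:- Y j, 1:]) y = 0"
      unfolding factorization[symmetric] by (simp add: poly_prod factorial_power_def)
    then obtain i where i: "i \<in> {1..?N}" "y = Y i" by (auto simp: poly_prod)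
    then have "fls_const (t i) = fls_const (t j)" using y const[OF i(1)] by (simp add: is_root_def t)
    from arg_cong[OF this, of "\<lambda>f. fls_nth f 0"] have "t i = t j" by simp
    then show ?thesis using inj_onD[OF inj_t] i j by auto
  qed
  have eq: "bethe_root n j = Y j" if "j \<in> {1..?N}" for j
    unfolding bethe_root_def is_root_def[symmetric]
    by (rule the_equality) (use that Y unique in auto)
  show ?thesis
  proof
    show "inj_on (bethe_root n :: nat \<Rightarrow> 'n Fq) {1..?N}"
      by (rule inj_on_cong[THEN iffD2, OF eq inj])
    show "factorial_power (bethe_root n j) Fq_T ?N = ?\<kappa>" if "j \<in> {1..?N}" for j
      unfolding eq[OF that] by (rule root[OF that])
  qed simp
qed

section \<open>The two algebras\<close>

lemma spin_algebra_simps [simp]: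
  "carrier (spin_algebra N n T q) = {v. \<forall>J. v J \<noteq> 0 \<longrightarrow> J \<subseteq> {1..N} \<and> card J = n}"
  "v \<otimes>\<^bsub>spin_algebra N n T q\<^esub> w = spin_mult N n T q v w"
  "\<one>\<^bsub>spin_algebra N n T q\<^esub> = spin_basis (positions (replicate n 0))"
  "\<zero>\<^bsub>spin_algebra N n T q\<^esub> = (\<lambda>J. 0)"
  "v \<oplus>\<^bsub>spin_algebra N n T q\<^esub> w = (\<lambda>J. v J + w J)"
  "a \<odot>\<^bsub>spin_algebra N n T q\<^esub> v = (\<lambda>J. a * v J)"
  by (simp_all add: spin_algebra_def)

lemma generalised_matrix_algebra_simps [simp]:
  "carrier (generalised_matrix_algebra A c) = {f. \<forall>i. i \<notin> A \<longrightarrow> f i = 0}"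
  "f \<otimes>\<^bsub>generalised_matrix_algebra A c\<^esub> g = (\<lambda>i. c i * f i * g i)"
  "\<one>\<^bsub>generalised_matrix_algebra A c\<^esub> = (\<lambda>i. if i \<in> A then inverse (c i) else 0)"
  "\<zero>\<^bsub>generalised_matrix_algebra A c\<^esub> = (\<lambda>i. 0)"
  "f \<oplus>\<^bsub>generalised_matrix_algebra A c\<^esub> g = (\<lambda>i. f i + g i)"
  "a \<odot>\<^bsub>generalised_matrix_algebra A c\<^esub> f = (\<lambda>i. a * f i)"
  by (simp_all add: generalised_matrix_algebra_def)

lemma cring_generalised_matrix_algebra:
  assumes "\<And>i. i \<in> A \<Longrightarrow> c i \<noteq> (0::'a::field)"
  shows "cring (generalised_matrix_algebra A c)"
proof (rule cringI)
  show "abelian_group (generalised_matrix_algebra A c)"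
  proof (rule abelian_groupI)
    fix f assume "f \<in> carrier (generalised_matrix_algebra A c)"
    then show "\<exists>g\<in>carrier (generalised_matrix_algebra A c).
        g \<oplus>\<^bsub>generalised_matrix_algebra A c\<^esub> f = \<zero>\<^bsub>generalised_matrix_algebra A c\<^esub>"
      by (intro bexI[of _ "\<lambda>i. - f i"]) auto
  qed (auto simp: algebra_simps)
  show "comm_monoid (generalised_matrix_algebra A c)"
    by (rule comm_monoidI) (use assms in \<open>auto simp: algebra_simps\<close>)
qed (auto simp: algebra_simps)

lemma abelian_group_spin_algebra: "abelian_group (spin_algebra N n T q)"
proof (rule abelian_groupI)
  fix v assume "v \<in> carrier (spin_algebra N n T q)"
  then show "\<exists>w\<in>carrier (spin_algebra N n T q). w \<oplus>\<^bsub>spin_algebra N n T q\<^esub> v = \<zero>\<^bsub>spin_algebra N n T q\<^esub>"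
    by (intro bexI[of _ "\<lambda>J. - v J"]) auto
next
  fix v w assume "v \<in> carrier (spin_algebra N n T q)" "w \<in> carrier (spin_algebra N n T q)"
  then show "v \<oplus>\<^bsub>spin_algebra N n T q\<^esub> w \<in> carrier (spin_algebra N n T q)"
    by simp (metis add.right_neutral)
qed (auto simp: algebra_simps)

lemma finsum_spin_algebra:
  assumes "finite A" "\<And>i. i \<in> A \<Longrightarrow> f i \<in> carrier (spin_algebra N n T q)"
  shows "finsum (spin_algebra N n T q) f A = (\<lambda>J. \<Sum>i\<in>A. f i J)"
proof -
  interpret abelian_group "spin_algebra N n T q" by (rule abelian_group_spin_algebra)
  show ?thesis
    using assms
  proof (induction A)
    case (insert i A)
    then have "finsum (spin_algebra N n T q) f (insert i A) =
      f i \<oplus>\<^bsub>spin_algebra N n T q\<^esub> finsum (spin_algebra N n T q) f A"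
      by (intro finsum_insert Pi_I insert.hyps insert.prems) simp_all
    moreover have "finsum (spin_algebra N n T q) f A = (\<lambda>J. \<Sum>i\<in>A. f i J)"
      by (rule insert.IH) (use insert.prems in blast)
    ultimately show ?case using insert.hyps by simp
  qed (simp only: finsum_empty, simp)
qed

text \<open>
A left ideal contains, with an element, each of its components, because multiplication by a multiple of a
basis element isolates the component. It is therefore the span of the basis elements in its support, and
the span of the remaining ones is a complement.
\<close>

lemma semisimple_ring_if_iso:
  fixes c :: "'i \<Rightarrow> 'a::field"
  assumes finite: "finite A" and c: "\<And>i. i \<in> A \<Longrightarrow> c i \<noteq> 0" and R: "ring R"
    and iso: "\<phi> \<in> ring_iso (generalised_matrix_algebra A c) R"
  shows "semisimple_ring R"
proof -
  define G where "G = generalised_matrix_algebra A c"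
  note G [simp] = generalised_matrix_algebra_simps[of A c, folded G_def]
  have "ring G" using cring_generalised_matrix_algebra[OF c] unfolding G_def by (rule cring.axioms)
  have hom: "\<phi> \<in> Ring.ring_hom G R" and bij: "bij_betw \<phi> (carrier G) (carrier R)"
    using iso by (simp_all add: ring_iso_def G_def)
  interpret ring_hom_ring G R \<phi>
    by (rule ring_hom_ringI2) (use \<open>ring G\<close> R hom in auto)
  have surj: "\<exists>f\<in>carrier G. x = \<phi> f" if "x \<in> carrier R" for x
    using bij that by (auto simp: bij_betw_def)
  show ?thesis
    unfolding semisimple_ring_def
  proof (intro conjI R allI impI)
    fix I assume I: "left_ideal R I"
    then interpret I: additive_subgroup I R by (simp add: left_ideal_def)
    have I_mult: "r \<otimes>\<^bsub>R\<^esub> x \<in> I" if "r \<in> carrier R" "x \<in> I" for r x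
      using I that by (simp add: left_ideal_def)
    define S where "S = {i \<in> A. \<exists>f\<in>carrier G. \<phi> f \<in> I \<and> f i \<noteq> 0}"
    define I' where "I' = \<phi> ` {f \<in> carrier G. \<forall>i\<in>S. f i = 0}"
    have S: "finite S" "S \<subseteq> A" using finite by (auto simp: S_def)
    have vanish: "f i = 0" if "f \<in> carrier G" "\<phi> f \<in> I" "i \<notin> S" for f i
      using that by (cases "i \<in> A") (auto simp: S_def)
    have unit: "\<phi> (\<lambda>j. if j = i then a else 0) \<in> I" if i: "i \<in> S" for i a
    proof -
      obtain g where g: "g \<in> carrier G" "\<phi> g \<in> I" "g i \<noteq> 0" "i \<in> A" using i by (auto simp: S_def)
      define h where "h = (\<lambda>j. if j = i then a / (c i * g i) else 0)"
      have h: "h \<in> carrier G" using g(4) by (simp add: h_def)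
      have "\<phi> (h \<otimes>\<^bsub>G\<^esub> g) \<in> I"
        unfolding hom_mult[OF h g(1)] by (rule I_mult) (use h g in auto)
      moreover have "h \<otimes>\<^bsub>G\<^esub> g = (\<lambda>j. if j = i then a else 0)"
        using g(3) c[OF g(4)] by (auto simp: h_def)
      ultimately show ?thesis by simp
    qed
    have span: "\<phi> f \<in> I" if "f \<in> carrier G" "\<And>i. i \<notin> S \<Longrightarrow> f i = 0" for f
    proof -
      have "\<phi> (\<lambda>i. if i \<in> F then f i else 0) \<in> I" if "F \<subseteq> S" for F
        using finite_subset[OF that S(1)] that
      proof (induction F rule: finite_induct)
        case empty
        then show ?case using hom_zero I.zero_closed by simp
      next
        case (insert i F)
        let ?d = "\<lambda>j. if j = i then f i else 0" and ?g = "\<lambda>j. if j \<in> F then f j else 0"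
        have mem: "?d \<in> carrier G" "?g \<in> carrier G" using insert S(2) by auto
        have "(\<lambda>j. if j \<in> insert i F then f j else 0) = ?d \<oplus>\<^bsub>G\<^esub> ?g" using insert by auto
        then have "\<phi> (\<lambda>j. if j \<in> insert i F then f j else 0) = \<phi> ?d \<oplus>\<^bsub>R\<^esub> \<phi> ?g"
          using hom_add[OF mem] by simp
        also have "\<dots> \<in> I" using unit[of i "f i"] insert by (intro I.a_closed) auto
        finally show ?case .
      qed
      moreover have "(\<lambda>i. if i \<in> S then f i else 0) = f" using that(2) by auto
      ultimately show ?thesis by (metis order_refl)
    qed
    have "left_ideal R I'"
      unfolding left_ideal_def
    proof (intro conjI ballI)
      show "additive_subgroup I' R"
      proof (rule additive_subgroupI, rule group.subgroupI)
        show "group (add_monoid R)" by (rule S.a_group)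
        show "I' \<subseteq> carrier (add_monoid R)" unfolding I'_def using hom_closed by auto
        have "(\<lambda>i. 0) \<in> {f \<in> carrier G. \<forall>i\<in>S. f i = 0}" by simp
        then show "I' \<noteq> {}" unfolding I'_def by blast
      next
        fix x assume "x \<in> I'"
        then obtain f where f: "f \<in> carrier G" "\<forall>i\<in>S. f i = 0" "x = \<phi> f" by (auto simp: I'_def)
        have "inv\<^bsub>add_monoid R\<^esub> x = \<phi> (\<ominus>\<^bsub>G\<^esub> f)" using f by (simp only: a_inv_def[symmetric] hom_a_inv)
        moreover have "\<ominus>\<^bsub>G\<^esub> f = (\<lambda>i. - f i)"
          using f by (intro R.minus_equality) auto
        ultimately show "inv\<^bsub>add_monoid R\<^esub> x \<in> I'" unfolding I'_def using f by auto
      next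
        fix x y assume "x \<in> I'" "y \<in> I'"
        then obtain f g where f: "f \<in> carrier G" "\<forall>i\<in>S. f i = 0" "x = \<phi> f"
          and g: "g \<in> carrier G" "\<forall>i\<in>S. g i = 0" "y = \<phi> g" by (auto simp: I'_def)
        have "x \<otimes>\<^bsub>add_monoid R\<^esub> y = \<phi> (f \<oplus>\<^bsub>G\<^esub> g)" using hom_add[OF f(1) g(1)] f g by simp
        then show "x \<otimes>\<^bsub>add_monoid R\<^esub> y \<in> I'" unfolding I'_def using f g by auto
      qed
      fix r x assume r: "r \<in> carrier R" and "x \<in> I'"
      then obtain f where f: "f \<in> carrier G" "\<forall>i\<in>S. f i = 0" "x = \<phi> f" by (auto simp: I'_def)
      obtain h where h: "h \<in> carrier G" "r = \<phi> h" using surj[OF r] by blast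
      have "r \<otimes>\<^bsub>R\<^esub> x = \<phi> (h \<otimes>\<^bsub>G\<^esub> f)" using hom_mult[OF h(1) f(1)] f h by simp
      then show "r \<otimes>\<^bsub>R\<^esub> x \<in> I'" unfolding I'_def using f h by auto
    qed
    moreover have "I \<inter> I' = {\<zero>\<^bsub>R\<^esub>}"
    proof (intro equalityI subsetI)
      fix x assume "x \<in> I \<inter> I'"
      then obtain f where f: "f \<in> carrier G" "\<forall>i\<in>S. f i = 0" "x = \<phi> f" "\<phi> f \<in> I" by (auto simp: I'_def)
      have "f i = 0" for i using f(2) vanish[OF f(1,4), of i] by blast
      then have "f = \<zero>\<^bsub>G\<^esub>" by auto
      then show "x \<in> {\<zero>\<^bsub>R\<^esub>}" using f(3) hom_zero by simp
    next
      fix x assume "x \<in> {\<zero>\<^bsub>R\<^esub>}"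
      then have "x = \<phi> (\<lambda>i. 0)" using hom_zero by simp
      moreover have "(\<lambda>i. 0) \<in> {f \<in> carrier G. \<forall>i\<in>S. f i = 0}" by simp
      ultimately have "x \<in> I'" unfolding I'_def by (rule image_eqI)
      then show "x \<in> I \<inter> I'" using \<open>x \<in> {\<zero>\<^bsub>R\<^esub>}\<close> I.zero_closed by simp
    qed
    moreover have "I <+>\<^bsub>R\<^esub> I' = carrier R"
    proof (intro equalityI subsetI)
      fix x assume "x \<in> I <+>\<^bsub>R\<^esub> I'"
      then obtain a b where ab: "a \<in> I" "b \<in> I'" "x = a \<oplus>\<^bsub>R\<^esub> b" unfolding set_add_def' by blast
      have "a \<in> carrier R" using ab(1) I.a_subset by blast
      moreover have "b \<in> carrier R" using ab(2) hom_closed unfolding I'_def by blast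
      ultimately show "x \<in> carrier R" using ab(3) S.a_closed by simp
    next
      fix x assume "x \<in> carrier R"
      then obtain f where f: "f \<in> carrier G" "x = \<phi> f" using surj by blast
      let ?g = "\<lambda>i. if i \<in> S then f i else 0" and ?h = "\<lambda>i. if i \<in> S then 0 else f i"
      have mem: "?g \<in> carrier G" "?h \<in> carrier G" using f S by auto
      have "f = ?g \<oplus>\<^bsub>G\<^esub> ?h" by auto
      then have "x = \<phi> ?g \<oplus>\<^bsub>R\<^esub> \<phi> ?h" using hom_add[OF mem] f by simp
      moreover have "\<phi> ?g \<in> I" by (rule span) (use mem in auto)
      moreover have "\<phi> ?h \<in> I'" unfolding I'_def using mem by auto
      ultimately show "x \<in> I <+>\<^bsub>R\<^esub> I'" unfolding set_add_def' by blast
    qed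
    ultimately show "\<exists>I'. left_ideal R I' \<and> I \<inter> I' = {\<zero>\<^bsub>R\<^esub>} \<and> I <+>\<^bsub>R\<^esub> I' = carrier R" by blast
  qed
qed

lemma two_sided_inverse:
  fixes P Q :: "'i \<Rightarrow> 'i \<Rightarrow> 'a::field"
  assumes fin: "finite A" and PQ: "\<And>a b. a \<in> A \<Longrightarrow> b \<in> A \<Longrightarrow> (\<Sum>l\<in>A. P a l * Q l b) = (if a = b then 1 else 0)"
    and lm: "l \<in> A" "m \<in> A"
  shows "(\<Sum>a\<in>A. Q l a * P a m) = (if l = m then 1 else 0)"
proof -
  obtain h where h: "bij_betw h {0..<card A} A" using ex_bij_betw_nat_finite[OF fin] by blast
  let ?d = "card A"
  let ?P = "mat ?d ?d (\<lambda>(i, j). P (h i) (h j))" and ?Q = "mat ?d ?d (\<lambda>(i, j). Q (h i) (h j))"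
  have in_A: "h i \<in> A" if "i < ?d" for i using bij_betwE[OF h] that by simp
  have eq: "h i = h j \<longleftrightarrow> i = j" if "i < ?d" "j < ?d" for i j
    using inj_on_eq_iff[OF bij_betw_imp_inj_on[OF h]] that by simp
  have sum: "(\<Sum>i=0..<?d. g (h i)) = sum g A" for g :: "'i \<Rightarrow> 'a"
    by (rule sum.reindex_bij_betw[OF h])
  have "?P * ?Q = 1\<^sub>m ?d"
    by (rule eq_matI) (simp_all add: scalar_prod_def sum[of "\<lambda>l. P (h _) l * Q l (h _)"] PQ in_A eq)
  then have QP: "?Q * ?P = 1\<^sub>m ?d" by (rule mat_mult_left_right_inverse[rotated 2]) simp_all
  have "l \<in> h ` {0..<?d}" "m \<in> h ` {0..<?d}" using lm by (simp_all only: bij_betw_imp_surj_on[OF h])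
  then obtain i j where ij: "i < ?d" "h i = l" "j < ?d" "h j = m" by fastforce
  have "(?Q * ?P) $$ (i, j) = (\<Sum>a\<in>A. Q l a * P a m)"
    using sum[of "\<lambda>a. Q l a * P a m"] ij by (simp add: scalar_prod_def)
  then show ?thesis using ij eq[OF ij(1,3)] by (simp add: QP)
qed

section \<open>The algebra in the Bethe basis\<close>

lemma spin_algebra_expand:
  fixes w :: "'a::comm_ring_1 spin"
  assumes w: "\<And>J. w J \<noteq> 0 \<Longrightarrow> J \<subseteq> {1..N} \<and> card J = n" and n: "n \<le> N"
  shows "w = (\<lambda>J. \<Sum>m\<in>box_partitions n (N - n). w (positions m) * spin_basis (positions m) J)"
proof
  fix J
  let ?X = "box_partitions n (N - n)"
  have inj: "positions m = positions m' \<longleftrightarrow> m = m'" if "m \<in> ?X" "m' \<in> ?X" for m m'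
    using inj_on_eq_iff[OF bij_betw_imp_inj_on[OF bij_betw_positions[OF n]]] that by blast
  show "w J = (\<Sum>m\<in>?X. w (positions m) * spin_basis (positions m) J)"
  proof (cases "J \<subseteq> {1..N} \<and> card J = n")
    case True
    then have "J \<in> positions ` ?X" using bij_betw_imp_surj_on[OF bij_betw_positions[OF n]] by simp
    then obtain m0 where m0: "m0 \<in> ?X" "J = positions m0" by blast
    have "(\<Sum>m\<in>?X. w (positions m) * spin_basis (positions m) J) = (\<Sum>m\<in>?X. if m = m0 then w J else 0)"
      by (rule sum.cong) (auto simp: m0 spin_basis_def inj)
    then show ?thesis using m0(1) by (simp add: finite_box_partitions)
  next
    case False
    have "positions m \<noteq> J" if "m \<in> ?X" for m
      using bij_betwE[OF bij_betw_positions[OF n]] that False by auto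
    then have "(\<Sum>m\<in>?X. w (positions m) * spin_basis (positions m) J) = 0"
      by (intro sum.neutral) (auto simp: spin_basis_def)
    then show ?thesis using w[of J] False by auto
  qed
qed

text \<open>
By linearity of the operators, the double sum in the definition of the product is an action on the second
factor.
\<close>

lemma spin_mult_eq:
  fixes w :: "'a::comm_ring_1 spin"
  assumes w: "\<And>J. w J \<noteq> 0 \<Longrightarrow> J \<subseteq> {1..N} \<and> card J = n" and n: "n \<le> N"
  shows "spin_mult N n T q v w = (\<lambda>J. \<Sum>l\<in>box_partitions n (N - n). v (positions l) * S_tilde N n T q l w J)"
proof -
  have "S_tilde N n T q l w =
    S_tilde N n T q l (\<lambda>J. \<Sum>m\<in>box_partitions n (N - n). w (positions m) * spin_basis (positions m) J)" for l
    by (rule arg_cong[OF spin_algebra_expand[OF w n]])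
  then have "S_tilde N n T q l w =
    (\<lambda>J. \<Sum>m\<in>box_partitions n (N - n). w (positions m) * S_tilde N n T q l (spin_basis (positions m)) J)" for l
    by (simp only: linear_op_sum[OF linear_op_S_tilde])
  then show ?thesis by (simp add: spin_mult_def sum_distrib_left mult.assoc)
qed

text \<open>
The Bethe vectors need only a field in which the Bethe equation has \<open>N\<close> distinct roots \<open>Y 1, \<dots>, Y N\<close>.
\<close>

locale on_shell = root_system N T Y "(- 1) ^ (n - 1) * q"
  for N :: nat and T Y :: "nat \<Rightarrow> 'a::field" and n :: nat and q :: 'a +
  assumes n: "0 < n" "n \<le> N"
begin

abbreviation "box \<equiv> box_partitions n (N - n)"
abbreviation "V \<equiv> spin_algebra N n T q"

definition dual_schur :: "nat list \<Rightarrow> nat list \<Rightarrow> 'a" where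
  "dual_schur \<alpha> l = factorial_schur n (dual_partition (N - n) l) (\<lambda>j. Y (position \<alpha> j)) T"

definition schur :: "nat list \<Rightarrow> nat list \<Rightarrow> 'a" where
  "schur l \<alpha> = factorial_schur n l (\<lambda>j. Y (position \<alpha> j)) (rev_param N T)"

definition bethe :: "nat list \<Rightarrow> 'a spin" where
  "bethe \<alpha> = (\<lambda>J. \<Sum>m\<in>box. dual_schur \<alpha> m * spin_basis (positions m) J)"

definition euler :: "nat list \<Rightarrow> 'a" where
  "euler \<alpha> = (\<Prod>i\<in>positions \<alpha>. \<Prod>j\<in>{1..N} - positions \<alpha>. Y i - Y j)"

lemma orthogonality:
  "\<alpha> \<in> box \<Longrightarrow> \<beta> \<in> box \<Longrightarrow> (\<Sum>l\<in>box. dual_schur \<alpha> l * schur l \<beta>) = (if \<alpha> = \<beta> then euler \<alpha> else 0)"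
  unfolding dual_schur_def schur_def euler_def by (rule on_shell_orthogonality[OF n])

lemma euler_nonzero: "\<alpha> \<in> box \<Longrightarrow> euler \<alpha> \<noteq> 0"
proof -
  assume "\<alpha> \<in> box"
  then have pos: "positions \<alpha> \<subseteq> {1..N}" using bij_betwE[OF bij_betw_positions[OF n(2)]] by auto
  then have "finite (positions \<alpha>)" using finite_subset by blast
  moreover have "Y i - Y j \<noteq> 0" if "i \<in> positions \<alpha>" "j \<in> {1..N} - positions \<alpha>" for i j
    using inj_onD[OF inj, of i j] that pos by auto
  ultimately show ?thesis unfolding euler_def by (auto simp: prod_zero_iff)
qed

lemma position_inj: "l \<in> box \<Longrightarrow> m \<in> box \<Longrightarrow> positions l = positions m \<longleftrightarrow> l = m"
  using inj_on_eq_iff[OF bij_betw_imp_inj_on[OF bij_betw_positions[OF n(2)]]] by blast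

lemma basis_positions: "m \<in> box \<Longrightarrow> positions m \<subseteq> {1..N} \<and> card (positions m) = n"
  using bij_betwE[OF bij_betw_positions[OF n(2)]] by auto

lemma bethe_positions:
  assumes "m \<in> box"
  shows "bethe \<alpha> (positions m) = dual_schur \<alpha> m"
proof -
  have "bethe \<alpha> (positions m) = (\<Sum>l\<in>box. if l = m then dual_schur \<alpha> m else 0)"
    unfolding bethe_def by (rule sum.cong) (use assms in \<open>auto simp: spin_basis_def position_inj\<close>)
  then show ?thesis using assms by (simp add: finite_box_partitions)
qed

lemma bethe_support: "bethe \<alpha> J \<noteq> 0 \<Longrightarrow> J \<subseteq> {1..N} \<and> card J = n"
proof (rule ccontr)
  assume "bethe \<alpha> J \<noteq> 0" "\<not> (J \<subseteq> {1..N} \<and> card J = n)"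
  moreover from this(2) have "positions m \<noteq> J" if "m \<in> box" for m using basis_positions[OF that] by auto
  then have "bethe \<alpha> J = 0" unfolding bethe_def by (intro sum.neutral) (auto simp: spin_basis_def)
  ultimately show False by simp
qed

text \<open>
The exponent of the dual partition belonging to a site \<open>j\<close> is \<open>N - j\<close>.
\<close>

lemma bethe_determinant_state:
  assumes \<alpha>: "\<alpha> \<in> box"
  shows "bethe \<alpha> = determinant_state N n (1 / det_of n (\<lambda>i j. Y (position \<alpha> (Suc j)) ^ (n - Suc i)))
    (\<lambda>j b. factorial_power (Y (position \<alpha> (Suc b))) T (N - j))"
    (is "_ = determinant_state N n ?c ?\<psi>")
proof
  fix J
  show "bethe \<alpha> J = determinant_state N n ?c ?\<psi> J"
  proof (cases "J \<subseteq> {1..N} \<and> card J = n")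
    case True
    then have "J \<in> positions ` box" using bij_betw_imp_surj_on[OF bij_betw_positions[OF n(2)]] by simp
    then obtain m where m: "m \<in> box" "J = positions m" by blast
    have "determinant_state N n ?c ?\<psi> J = ?c * det_of n (\<lambda>i b. ?\<psi> (position m (Suc i)) b)"
    proof -
      have "det_of n (\<lambda>i b. (map ?\<psi> (map (\<lambda>i. position m (Suc i)) [0..<n]) ! i) b) =
        det_of n (\<lambda>i b. ?\<psi> (position m (Suc i)) b)"
        by (rule det_of_cong) simp
      then show ?thesis
        using True by (simp add: determinant_state_def slater_def m(2) sites_upto_positions[OF m(1) n(2)])
    qed
    also have "det_of n (\<lambda>i b. ?\<psi> (position m (Suc i)) b) =
      det_of n (\<lambda>i j. factorial_power (Y (position \<alpha> (Suc j))) T (exponent (dual_partition (N - n) m) i))"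
    proof (rule det_of_cong)
      fix i j assume "i < n" "j < n"
      then have "N - position m (Suc i) = exponent (dual_partition (N - n) m) i"
        by (simp add: position_eq_exponent[OF m(1)] exponent_dual_partition(1)[OF m(1) n(2)])
      then show "?\<psi> (position m (Suc i)) j =
        factorial_power (Y (position \<alpha> (Suc j))) T (exponent (dual_partition (N - n) m) i)" by simp
    qed
    also have "?c * \<dots> = dual_schur \<alpha> m"
      unfolding dual_schur_def factorial_schur_eq[OF exponent_dual_partition(2)[OF m(1) n(2) n(1)]] by simp
    finally show ?thesis using bethe_positions[OF m(1)] m(2) by simp
  next
    case False
    have "slater n ?c (map ?\<psi> (sites_upto J N)) = 0" if "J \<subseteq> {1..N}"
    proof -
      have "set (sites_upto J N) = J" "distinct (sites_upto J N)"
        using that by (auto simp: sites_upto_def)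
      then have "length (sites_upto J N) = card J" using distinct_card by metis
      then show ?thesis using False that by (simp add: slater_def)
    qed
    then show ?thesis using False bethe_support[of \<alpha> J] by (auto simp: determinant_state_def)
  qed
qed

lemma S_tilde_bethe:
  assumes "l \<in> box" "\<alpha> \<in> box"
  shows "S_tilde N n T q l (bethe \<alpha>) = (\<lambda>J. schur l \<alpha> * bethe \<alpha> J)"
  unfolding schur_def
proof (rule S_tilde_eigenvector[OF _ assms(1) n(2)])
  let ?y = "\<lambda>b. Y (position \<alpha> (Suc b))"
  have "factorial_power (?y b) T N = (- 1) ^ (n - 1) * q" if "b < n" for b
  proof (rule root)
    have "position \<alpha> (Suc b) \<in> positions \<alpha>"
      using bij_betwE[OF bij_betw_position[OF assms(2)]] that by simp
    then show "position \<alpha> (Suc b) \<in> {1..N}" using basis_positions[OF assms(2)] by blast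
  qed
  from E_op_determinant_state[OF n(1) N this]
  show "E_op N T q r (bethe \<alpha>) = (\<lambda>J. elem_coeff n ?y r * bethe \<alpha> J)" for r
    unfolding elem_coeff_def bethe_determinant_state[OF assms(2)] by simp
  show "det_of n (\<lambda>i j. Y (position \<alpha> (Suc j)) ^ (n - Suc i)) \<noteq> 0"
    by (rule root_vandermonde_nonzero[OF assms(2) n(2)])
qed

lemma spin_mult_bethe:
  assumes "\<beta> \<in> box"
  shows "spin_mult N n T q v (bethe \<beta>) = (\<lambda>J. (\<Sum>l\<in>box. v (positions l) * schur l \<beta>) * bethe \<beta> J)"
  by (subst spin_mult_eq[OF bethe_support n(2)])
    (simp_all add: S_tilde_bethe assms sum_distrib_right mult.assoc)

lemma bethe_mult_bethe:
  assumes "\<alpha> \<in> box" "\<beta> \<in> box"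
  shows "spin_mult N n T q (bethe \<alpha>) (bethe \<beta>) = (if \<alpha> = \<beta> then \<lambda>J. euler \<alpha> * bethe \<alpha> J else (\<lambda>J. 0))"
  unfolding spin_mult_bethe[OF assms(2)]
  using orthogonality[OF assms] by (simp add: bethe_positions)

lemma bethe_carrier: "bethe \<alpha> \<in> carrier V"
  using bethe_support[of \<alpha>] by simp

lemma linear_combination_bethe: "linear_combination V box bethe c = (\<lambda>J. \<Sum>\<alpha>\<in>box. c \<alpha> * bethe \<alpha> J)"
  unfolding linear_combination_def
proof (subst finsum_spin_algebra[OF finite_box_partitions])
  show "c \<alpha> \<odot>\<^bsub>V\<^esub> bethe \<alpha> \<in> carrier V" for \<alpha> using bethe_carrier[of \<alpha>] by simp
qed simp

lemma linear_combination_carrier: "linear_combination V box bethe c \<in> carrier V"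
proof -
  have "J \<subseteq> {1..N} \<and> card J = n" if "linear_combination V box bethe c J \<noteq> 0" for J
  proof -
    have "(\<Sum>\<alpha>\<in>box. c \<alpha> * bethe \<alpha> J) \<noteq> 0" using that by (simp only: linear_combination_bethe not_False_eq_True)
    then obtain \<alpha> where "c \<alpha> * bethe \<alpha> J \<noteq> 0" by (rule sum.not_neutral_contains_not_neutral)
    then have "bethe \<alpha> J \<noteq> 0" by auto
    then show ?thesis by (rule bethe_support)
  qed
  then show ?thesis by simp
qed

text \<open>
Pairing a vector with the factorial Schur functions at the roots \<open>y\<^sub>\<alpha>\<close> extracts its coefficient at the
Bethe vector of \<open>\<alpha>\<close>.
\<close>

definition coordinate :: "'a spin \<Rightarrow> nat list \<Rightarrow> 'a" where
  "coordinate v \<alpha> = (if \<alpha> \<in> box then (\<Sum>l\<in>box. v (positions l) * schur l \<alpha>) / euler \<alpha> else 0)"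

lemma coordinate_linear_combination:
  assumes "\<And>i. i \<notin> box \<Longrightarrow> c i = 0"
  shows "coordinate (linear_combination V box bethe c) = c"
proof
  fix \<beta>
  show "coordinate (linear_combination V box bethe c) \<beta> = c \<beta>"
  proof (cases "\<beta> \<in> box")
    case True
    have "(\<Sum>l\<in>box. linear_combination V box bethe c (positions l) * schur l \<beta>) =
      (\<Sum>l\<in>box. \<Sum>\<alpha>\<in>box. c \<alpha> * (dual_schur \<alpha> l * schur l \<beta>))"
      by (simp add: linear_combination_bethe bethe_positions sum_distrib_right mult.assoc)
    also have "\<dots> = (\<Sum>\<alpha>\<in>box. c \<alpha> * (\<Sum>l\<in>box. dual_schur \<alpha> l * schur l \<beta>))"
      by (subst sum.swap) (simp add: sum_distrib_left)
    also have "\<dots> = (\<Sum>\<alpha>\<in>box. if \<alpha> = \<beta> then c \<beta> * euler \<beta> else 0)"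
      by (rule sum.cong) (use True in \<open>auto simp: orthogonality\<close>)
    also have "\<dots> = c \<beta> * euler \<beta>" using True by (simp add: finite_box_partitions)
    finally show ?thesis using True euler_nonzero by (simp add: coordinate_def)
  qed (simp add: coordinate_def assms)
qed

text \<open>
\<open>orthogonality\<close> says that two square matrices are inverse to each other after scaling by the diagonal. The
product in the other order is the completeness relation needed here.
\<close>

lemma linear_combination_coordinate:
  assumes v: "v \<in> carrier V"
  shows "linear_combination V box bethe (coordinate v) = v"
proof -
  have completeness: "(\<Sum>\<alpha>\<in>box. schur l \<alpha> * (dual_schur \<alpha> m / euler \<alpha>)) = (if l = m then 1 else 0)"
    if "l \<in> box" "m \<in> box" for l m
  proof (rule two_sided_inverse[OF finite_box_partitions _ that])
    fix \<alpha> \<beta> assume ab: "\<alpha> \<in> box" "\<beta> \<in> box"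
    have "(\<Sum>l\<in>box. dual_schur \<alpha> l / euler \<alpha> * schur l \<beta>) = (\<Sum>l\<in>box. dual_schur \<alpha> l * schur l \<beta>) / euler \<alpha>"
      by (simp add: sum_divide_distrib)
    also have "\<dots> = (if \<alpha> = \<beta> then euler \<alpha> else 0) / euler \<alpha>" by (simp only: orthogonality[OF ab])
    also have "\<dots> = (if \<alpha> = \<beta> then 1 else 0)" using euler_nonzero[OF ab(1)] by auto
    finally show "(\<Sum>l\<in>box. dual_schur \<alpha> l / euler \<alpha> * schur l \<beta>) = (if \<alpha> = \<beta> then 1 else 0)" .
  qed
  let ?u = "linear_combination V box bethe (coordinate v)"
  have "?u (positions m) = v (positions m)" if m: "m \<in> box" for m
  proof -
    have "?u (positions m) = (\<Sum>\<alpha>\<in>box. \<Sum>l\<in>box. v (positions l) * (schur l \<alpha> * (dual_schur \<alpha> m / euler \<alpha>)))"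
      by (simp add: linear_combination_bethe coordinate_def bethe_positions[OF m] sum_distrib_right
        sum_divide_distrib mult.assoc)
    also have "\<dots> = (\<Sum>l\<in>box. v (positions l) * (\<Sum>\<alpha>\<in>box. schur l \<alpha> * (dual_schur \<alpha> m / euler \<alpha>)))"
      by (subst sum.swap) (simp add: sum_distrib_left)
    also have "\<dots> = (\<Sum>l\<in>box. if l = m then v (positions m) else 0)"
      by (rule sum.cong) (use m completeness in auto)
    finally show ?thesis using m by (simp add: finite_box_partitions)
  qed
  moreover have "?u J \<noteq> 0 \<Longrightarrow> J \<subseteq> {1..N} \<and> card J = n" for J
    using linear_combination_carrier by simp
  then have "?u = (\<lambda>J. \<Sum>m\<in>box. ?u (positions m) * spin_basis (positions m) J)"
    by (rule spin_algebra_expand[OF _ n(2)])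
  moreover have "v = (\<lambda>J. \<Sum>m\<in>box. v (positions m) * spin_basis (positions m) J)"
    using v by (intro spin_algebra_expand[OF _ n(2)]) simp
  ultimately show ?thesis by simp
qed

theorem basis: "is_basis V box bethe"
  unfolding is_basis_def
proof (intro conjI ballI finite_box_partitions)
  show "bethe ` box \<subseteq> carrier V" using bethe_carrier by blast
  fix v assume v: "v \<in> carrier V"
  show "\<exists>!c. (\<forall>i. i \<notin> box \<longrightarrow> c i = 0) \<and> v = linear_combination V box bethe c"
  proof (rule ex1I[of _ "coordinate v"])
    show "(\<forall>i. i \<notin> box \<longrightarrow> coordinate v i = 0) \<and> v = linear_combination V box bethe (coordinate v)"
      using linear_combination_coordinate[OF v] by (simp add: coordinate_def)
    show "c = coordinate v" if "(\<forall>i. i \<notin> box \<longrightarrow> c i = 0) \<and> v = linear_combination V box bethe c" for c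
      using coordinate_linear_combination[of c] that by simp
  qed
qed

lemma empty_partition: "replicate n 0 \<in> box"
  by (auto simp: box_partitions_def sorted_wrt_iff_nth_less)

text \<open>
The factorial Schur function of the empty partition is 1, so each coordinate of the unit is
\<open>1 / e(y\<^sub>\<alpha>)\<close>.
\<close>

lemma unit: "\<one>\<^bsub>V\<^esub> = linear_combination V box bethe (\<lambda>\<alpha>. if \<alpha> \<in> box then inverse (euler \<alpha>) else 0)"
proof -
  let ?e = "replicate n 0" and ?u = "spin_basis (positions (replicate n 0)) :: 'a spin"
  have "coordinate ?u = (\<lambda>\<alpha>. if \<alpha> \<in> box then inverse (euler \<alpha>) else 0)"
  proof
    fix \<alpha>
    show "coordinate ?u \<alpha> = (if \<alpha> \<in> box then inverse (euler \<alpha>) else 0)"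
    proof (cases "\<alpha> \<in> box")
      case True
      have "(\<Sum>l\<in>box. ?u (positions l) * schur l \<alpha>) = (\<Sum>l\<in>box. if l = ?e then schur ?e \<alpha> else 0)"
        by (rule sum.cong) (auto simp: spin_basis_def position_inj[OF _ empty_partition])
      also have "\<dots> = schur ?e \<alpha>" using empty_partition by (simp add: finite_box_partitions)
      also have "\<dots> = 1"
      proof -
        have "det_of n (\<lambda>i j. factorial_power (Y (position \<alpha> (Suc j))) (rev_param N T) (exponent ?e i)) =
          det_of n (\<lambda>i j. factorial_power (Y (position \<alpha> (Suc j))) (rev_param N T) (n - Suc i))"
          by (rule det_of_cong) (simp add: exponent_def)
        also have "\<dots> = det_of n (\<lambda>i j. Y (position \<alpha> (Suc j)) ^ (n - Suc i))"
          by (rule det_of_factorial_power_decreasing)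
        finally show ?thesis
          unfolding schur_def factorial_schur_eq[OF empty_partition]
          using root_vandermonde_nonzero[OF True n(2)] by simp
      qed
      finally show ?thesis using True by (simp add: coordinate_def inverse_eq_divide)
    qed (simp add: coordinate_def)
  qed
  moreover have "?u \<in> carrier V"
    using basis_positions[OF empty_partition] by (simp add: spin_basis_def)
  ultimately show ?thesis using linear_combination_coordinate[of ?u] by simp
qed

lemma mult_linear_combination:
  assumes "\<And>i. i \<notin> box \<Longrightarrow> f i = 0"
  shows "linear_combination V box bethe f \<otimes>\<^bsub>V\<^esub> linear_combination V box bethe g =
    linear_combination V box bethe (\<lambda>\<alpha>. euler \<alpha> * f \<alpha> * g \<alpha>)"
proof -
  let ?v = "linear_combination V box bethe f" and ?w = "linear_combination V box bethe g"
  have coordinate: "coordinate ?v = f" by (rule coordinate_linear_combination) (rule assms)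
  have coord: "(\<Sum>l\<in>box. ?v (positions l) * schur l \<alpha>) = euler \<alpha> * f \<alpha>" if "\<alpha> \<in> box" for \<alpha>
  proof -
    have "(\<Sum>l\<in>box. ?v (positions l) * schur l \<alpha>) / euler \<alpha> = f \<alpha>"
      using fun_cong[OF coordinate, of \<alpha>] by (simp only: coordinate_def that if_True)
    then show ?thesis using euler_nonzero[OF that] by (simp add: divide_eq_eq mult.commute)
  qed
  have "S_tilde N n T q l ?w = (\<lambda>J. \<Sum>\<alpha>\<in>box. g \<alpha> * S_tilde N n T q l (bethe \<alpha>) J)" for l
    unfolding linear_combination_bethe by (rule linear_op_sum[OF linear_op_S_tilde])
  then have "spin_mult N n T q ?v ?w =
    (\<lambda>J. \<Sum>l\<in>box. \<Sum>\<alpha>\<in>box. ?v (positions l) * (g \<alpha> * S_tilde N n T q l (bethe \<alpha>) J))"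
    using linear_combination_carrier[of g]
    by (subst spin_mult_eq[OF _ n(2)]) (simp_all add: sum_distrib_left)
  also have "\<dots> = (\<lambda>J. \<Sum>\<alpha>\<in>box. \<Sum>l\<in>box. g \<alpha> * bethe \<alpha> J * (?v (positions l) * schur l \<alpha>))"
    by (subst sum.swap) (simp add: S_tilde_bethe ac_simps)
  also have "\<dots> = (\<lambda>J. \<Sum>\<alpha>\<in>box. g \<alpha> * bethe \<alpha> J * (euler \<alpha> * f \<alpha>))"
    by (simp add: sum_distrib_left[symmetric] coord)
  also have "\<dots> = linear_combination V box bethe (\<lambda>\<alpha>. euler \<alpha> * f \<alpha> * g \<alpha>)"
    by (simp add: linear_combination_bethe ac_simps)
  finally show ?thesis by simp
qed

abbreviation "G \<equiv> generalised_matrix_algebra box euler"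

lemma iso: "linear_combination V box bethe \<in> ring_iso G V"
proof (rule ring_iso_memI)
  show "linear_combination V box bethe f \<in> carrier V" for f by (rule linear_combination_carrier)
  show "linear_combination V box bethe (f \<otimes>\<^bsub>G\<^esub> g) =
      linear_combination V box bethe f \<otimes>\<^bsub>V\<^esub> linear_combination V box bethe g"
    if "f \<in> carrier G" "g \<in> carrier G" for f g
    using mult_linear_combination[of f g] that by simp
  show "linear_combination V box bethe (f \<oplus>\<^bsub>G\<^esub> g) =
      linear_combination V box bethe f \<oplus>\<^bsub>V\<^esub> linear_combination V box bethe g" for f g
    by (simp add: linear_combination_bethe sum.distrib algebra_simps)
  show "linear_combination V box bethe \<one>\<^bsub>G\<^esub> = \<one>\<^bsub>V\<^esub>" using unit by simp
  show "bij_betw (linear_combination V box bethe) (carrier G) (carrier V)"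
  proof (rule bij_betwI[of _ _ _ coordinate])
    show "linear_combination V box bethe \<in> carrier G \<rightarrow> carrier V" using linear_combination_carrier by blast
    show "coordinate \<in> carrier V \<rightarrow> carrier G" by (simp add: coordinate_def)
    show "coordinate (linear_combination V box bethe c) = c" if "c \<in> carrier G" for c
      by (rule coordinate_linear_combination) (use that in simp)
    show "linear_combination V box bethe (coordinate v) = v" if "v \<in> carrier V" for v
      by (rule linear_combination_coordinate[OF that])
  qed
qed

text \<open>
Associativity, commutativity and the unit laws, which are far from visible in the definition of the
product, are transported along the isomorphism.
\<close>

lemma cring_V: "cring V"
proof -
  have "cring (V\<lparr>zero := linear_combination V box bethe \<zero>\<^bsub>G\<^esub>\<rparr>)"
    by (rule cring.ring_iso_imp_img_cring[OF cring_generalised_matrix_algebra[OF euler_nonzero] iso])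
  also have "linear_combination V box bethe \<zero>\<^bsub>G\<^esub> = (\<lambda>J. 0)" by (simp add: linear_combination_bethe)
  also have "V\<lparr>zero := \<lambda>J. 0\<rparr> = V" by (simp add: spin_algebra_def)
  finally show ?thesis .
qed

lemma cring_field_ring: "cring (field_ring :: 'a ring)"
proof (rule cringI)
  show "abelian_group (field_ring :: 'a ring)"
  proof (rule abelian_groupI)
    fix x :: 'a
    show "\<exists>y\<in>carrier field_ring. y \<oplus>\<^bsub>field_ring\<^esub> x = \<zero>\<^bsub>field_ring\<^esub>"
      by (intro bexI[of _ "- x"]) (simp_all add: field_ring_def)
  qed (simp_all add: field_ring_def)
  show "Group.comm_monoid (field_ring :: 'a ring)"
    by (rule comm_monoidI) (simp_all add: field_ring_def)
qed (simp add: field_ring_def algebra_simps)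

lemma algebra_V: "algebra field_ring V"
proof (rule algebraI[OF cring_field_ring cring_V])
  fix a b :: 'a and v w assume "v \<in> carrier V" "w \<in> carrier V"
  show "(a \<odot>\<^bsub>V\<^esub> v) \<otimes>\<^bsub>V\<^esub> w = a \<odot>\<^bsub>V\<^esub> (v \<otimes>\<^bsub>V\<^esub> w)"
    by (simp add: spin_mult_def sum_distrib_left mult.assoc)
qed (simp_all add: field_ring_def algebra_simps)

theorem idempotents:
  "complete_orthogonal_idempotents V box (\<lambda>\<alpha>. inverse (euler \<alpha>) \<odot>\<^bsub>V\<^esub> bethe \<alpha>)"
  unfolding complete_orthogonal_idempotents_def
proof (intro conjI ballI finite_box_partitions)
  let ?u = "\<lambda>\<alpha>. inverse (euler \<alpha>) \<odot>\<^bsub>V\<^esub> bethe \<alpha>"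
  interpret algebra field_ring V by (rule algebra_V)
  have single: "?u \<alpha> = linear_combination V box bethe (\<lambda>i. if i = \<alpha> then inverse (euler \<alpha>) else 0)"
    if "\<alpha> \<in> box" for \<alpha>
    using that by (simp add: linear_combination_bethe finite_box_partitions if_distrib[of "\<lambda>x. x * _"] cong: if_cong)
  fix \<alpha> assume a: "\<alpha> \<in> box"
  show "?u \<alpha> \<in> carrier V" unfolding single[OF a] by (rule linear_combination_carrier)
  show "?u \<alpha> \<noteq> \<zero>\<^bsub>V\<^esub>"
  proof
    let ?c = "\<lambda>i. if i = \<alpha> then inverse (euler \<alpha>) else 0"
    have c: "?c i = 0" if "i \<notin> box" for i using a that by auto
    have coordinates: "coordinate (linear_combination V box bethe ?c) = ?c"
      "coordinate (linear_combination V box bethe (\<lambda>i. 0)) = (\<lambda>i. 0)"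
      by (rule coordinate_linear_combination, use c in simp)+
    assume "?u \<alpha> = \<zero>\<^bsub>V\<^esub>"
    then have "linear_combination V box bethe ?c = linear_combination V box bethe (\<lambda>i. 0)"
      unfolding single[OF a] by (simp add: linear_combination_bethe)
    from arg_cong[OF this, of coordinate] have "?c = (\<lambda>i. 0)"
      by (simp only: coordinates)
    from fun_cong[OF this, of \<alpha>] show False using euler_nonzero[OF a] by simp
  qed
  fix \<beta> assume b: "\<beta> \<in> box"
  have "?u \<alpha> \<otimes>\<^bsub>V\<^esub> ?u \<beta> = (\<lambda>J. inverse (euler \<alpha>) * (inverse (euler \<beta>) * spin_mult N n T q (bethe \<alpha>) (bethe \<beta>) J))"
    by (simp add: spin_mult_def sum_distrib_left ac_simps)
  also have "\<dots> = (if \<alpha> = \<beta> then ?u \<alpha> else \<zero>\<^bsub>V\<^esub>)"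
    unfolding bethe_mult_bethe[OF a b] using euler_nonzero[OF a] by auto
  finally show "?u \<alpha> \<otimes>\<^bsub>V\<^esub> ?u \<beta> = (if \<alpha> = \<beta> then ?u \<alpha> else \<zero>\<^bsub>V\<^esub>)" .
next
  have "finsum V (\<lambda>\<alpha>. inverse (euler \<alpha>) \<odot>\<^bsub>V\<^esub> bethe \<alpha>) box =
    linear_combination V box bethe (\<lambda>\<alpha>. inverse (euler \<alpha>))"
    by (simp only: linear_combination_def)
  also have "\<dots> = \<one>\<^bsub>V\<^esub>"
    unfolding unit linear_combination_bethe by (simp cong: sum.cong)
  finally show "finsum V (\<lambda>\<alpha>. inverse (euler \<alpha>) \<odot>\<^bsub>V\<^esub> bethe \<alpha>) box = \<one>\<^bsub>V\<^esub>" .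
qed

end

theorem corollary6p9:
  fixes n k :: nat and V :: "('n::finite Fq, 'n Fq spin) module"
  assumes "0 < n" "n < CARD('n)" "k = CARD('n) - n"
    and "V = spin_algebra CARD('n) n Fq_T Fq_q"
  shows "algebra field_ring V \<and>
    semisimple_ring V \<and>
    is_basis V (box_partitions n k) (bethe_vector n) \<and>
    (\<forall>\<alpha>\<in>box_partitions n k. \<forall>\<beta>\<in>box_partitions n k.
      bethe_vector n \<alpha> \<otimes>\<^bsub>V\<^esub> bethe_vector n \<beta> =
        (if \<alpha> = \<beta> then bethe_euler n \<alpha> \<odot>\<^bsub>V\<^esub> bethe_vector n \<alpha> else \<zero>\<^bsub>V\<^esub>)) \<and>
    linear_combination V (box_partitions n k) (bethe_vector n) \<in>
      algebra_iso field_ring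
        (generalised_matrix_algebra (box_partitions n k) (bethe_euler n)) V \<and>
    (\<forall>\<alpha>\<in>box_partitions n k. bethe_euler n \<alpha> \<noteq> (0 :: 'n Fq)) \<and>
    complete_orthogonal_idempotents V (box_partitions n k)
      (\<lambda>\<alpha>. inverse (bethe_euler n \<alpha>) \<odot>\<^bsub>V\<^esub> bethe_vector n \<alpha>)"
proof -
  interpret on_shell "CARD('n)" Fq_T "bethe_root n :: nat \<Rightarrow> 'n Fq" n Fq_q
    by (intro on_shell.intro root_system_bethe_root on_shell_axioms.intro) (use assms in auto)
  have vector: "bethe_vector n = (bethe :: _ \<Rightarrow> 'n Fq spin)"
    by (simp add: fun_eq_iff bethe_vector_def bethe_def dual_schur_def)
  have euler: "bethe_euler n = (euler :: _ \<Rightarrow> 'n Fq)"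
    by (simp add: fun_eq_iff bethe_euler_def euler_def)
  have iso': "linear_combination V box bethe \<in> algebra_iso field_ring (generalised_matrix_algebra box euler) V"
    unfolding algebra_iso_def assms(4)
    using iso by (auto simp: linear_combination_bethe sum_distrib_left mult.assoc)
  show ?thesis
    unfolding vector euler assms(3)
    using algebra_V semisimple_ring_if_iso[OF finite_box_partitions euler_nonzero cring.axioms(1)[OF cring_V] iso]
      basis bethe_mult_bethe iso' euler_nonzero idempotents
    by (simp add: assms(4) del: spin_algebra_simps(1))
qed

end
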